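(* Let $B$ be a real or complex Banach space and let $(x_j)$ be a non-trivial weak-Cauchy sequence in $B$. Then either $(x_j)$ has a strongly summing subsequence, or $(x_j)$ has a convex block basis which is equivalent to the summing basis.
   Context: A sequence in a Banach space $B$ is weak-Cauchy if $\lim_j b^*(b_j)$ exists for all $b^*\in B^*$; it is non-trivial if it is not weakly convergent. A basic sequence is a sequence $(b_j)$ that is a Schauder basis of its closed linear span $[b_j]$. A sequence $(b_j)$ is strongly summing (s.s.) if it is a weak-Cauchy basic sequence such that whenever scalars $(c_j)$ satisfy $\sup_n\|\sum_{j=1}^n c_jb_j\|<\infty$, the series $\sum c_j$ converges. A block basis of $(x_j)$ is a sequence $(u_j)$ of non-zero elements for which there are integers $0\le n_1<n_2<\cdots$ and scalars $c_1,c_2,\dots$ with $u_j=\sum_{i=n_j+1}^{n_{j+1}}c_ix_i$ for all $j$; it is a convex block basis if moreover $c_i\ge 0$ for all $i$ and $\sum_{i=n_j+1}^{n_{j+1}}c_i=1$ for all $j$. Two sequences $(x_j)$, $(y_j)$ in Banach spaces are equivalent if there is an isomorphism (bounded invertible linear operator) $T:[x_j]\to[y_j]$ with $Tx_j=y_j$ for all $j$. The summing basis is the unit vector basis of the Banach space of all scalar sequences $(c_j)$ with $\sum c_j$ convergent, under the norm $\|(c_j)\|=\sup_n|\sum_{j=1}^nc_j|$. *)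

theory Defs
  imports "HOL-Analysis.Analysis"
begin

text \<open>
  A Banach space over the scalars \<open>'k\<close>: HOL-Analysis only has real Banach spaces as a type class,
  so multiplication by scalars in \<open>'k\<close> (used for \<open>real\<close> and \<open>complex\<close>) is an explicit parameter
  extending the real scalar multiplication. For real scalars it is \<open>scaleR\<close>.
\<close>

locale banach_over = vector_space sc
  for sc :: "'k::real_normed_field \<Rightarrow> 'a::banach \<Rightarrow> 'a" +
  assumes norm_scale: "norm (sc c v) = norm c * norm v"
    and scale_of_real: "sc (of_real r) v = r *\<^sub>R v"

lemma banach_over_scaleR: "banach_over (scaleR :: real \<Rightarrow> 'a::banach \<Rightarrow> 'a)"
  by unfold_locales (simp_all add: algebra_simps)

definition dual :: "('k::real_normed_field \<Rightarrow> 'a::real_normed_vector \<Rightarrow> 'a) \<Rightarrow> ('a \<Rightarrow> 'k) set" where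
  "dual sc = {f. bounded_linear f \<and> (\<forall>c v. f (sc c v) = c * f v)}"

definition weak_Cauchy ::
    "('k::real_normed_field \<Rightarrow> 'a::real_normed_vector \<Rightarrow> 'a) \<Rightarrow> (nat \<Rightarrow> 'a) \<Rightarrow> bool" where
  "weak_Cauchy sc b \<longleftrightarrow> (\<forall>f\<in>dual sc. convergent (\<lambda>j. f (b j)))"

definition weakly_convergent ::
    "('k::real_normed_field \<Rightarrow> 'a::real_normed_vector \<Rightarrow> 'a) \<Rightarrow> (nat \<Rightarrow> 'a) \<Rightarrow> bool" where
  "weakly_convergent sc b \<longleftrightarrow> (\<exists>l. \<forall>f\<in>dual sc. (\<lambda>j. f (b j)) \<longlonglongrightarrow> f l)"

definition nontrivial_weak_Cauchy ::
    "('k::real_normed_field \<Rightarrow> 'a::real_normed_vector \<Rightarrow> 'a) \<Rightarrow> (nat \<Rightarrow> 'a) \<Rightarrow> bool" where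
  "nontrivial_weak_Cauchy sc b \<longleftrightarrow> weak_Cauchy sc b \<and> \<not> weakly_convergent sc b"

definition closed_span ::
    "('k::real_normed_field \<Rightarrow> 'a::real_normed_vector \<Rightarrow> 'a) \<Rightarrow> (nat \<Rightarrow> 'a) \<Rightarrow> 'a set" where
  "closed_span sc b = closure (module.span sc (range b))"

definition schauder_basis_of ::
    "('k::real_normed_field \<Rightarrow> 'a::real_normed_vector \<Rightarrow> 'a) \<Rightarrow> (nat \<Rightarrow> 'a) \<Rightarrow> 'a set \<Rightarrow> bool" where
  "schauder_basis_of sc b Y \<longleftrightarrow>
     range b \<subseteq> Y \<and> (\<forall>y\<in>Y. \<exists>!c. (\<lambda>j. sc (c j) (b j)) sums y)"

definition basic_sequence ::
    "('k::real_normed_field \<Rightarrow> 'a::real_normed_vector \<Rightarrow> 'a) \<Rightarrow> (nat \<Rightarrow> 'a) \<Rightarrow> bool" where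
  "basic_sequence sc b \<longleftrightarrow> schauder_basis_of sc b (closed_span sc b)"

definition strongly_summing ::
    "('k::real_normed_field \<Rightarrow> 'a::real_normed_vector \<Rightarrow> 'a) \<Rightarrow> (nat \<Rightarrow> 'a) \<Rightarrow> bool" where
  "strongly_summing sc b \<longleftrightarrow>
     weak_Cauchy sc b \<and> basic_sequence sc b \<and>
     (\<forall>c. bdd_above (range (\<lambda>n. norm (\<Sum>j\<le>n. sc (c j) (b j)))) \<longrightarrow> summable c)"

text \<open>
  Sequences are indexed from \<open>0\<close>, so the block of (1-based) indices \<open>n\<^sub>j + 1, \<dots>, n\<^sub>j\<^sub>+\<^sub>1\<close> becomes
  \<open>{n j..<n (Suc j)}\<close>.
\<close>

definition block_basis_with ::
    "('k::real_normed_field \<Rightarrow> 'a::real_normed_vector \<Rightarrow> 'a) \<Rightarrow> (nat \<Rightarrow> 'a) \<Rightarrow> (nat \<Rightarrow> nat) \<Rightarrow>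
     (nat \<Rightarrow> 'k) \<Rightarrow> (nat \<Rightarrow> 'a) \<Rightarrow> bool" where
  "block_basis_with sc x n c u \<longleftrightarrow>
     strict_mono n \<and> (\<forall>j. u j \<noteq> 0 \<and> u j = (\<Sum>i\<in>{n j..<n (Suc j)}. sc (c i) (x i)))"

definition convex_block_basis ::
    "('k::real_normed_field \<Rightarrow> 'a::real_normed_vector \<Rightarrow> 'a) \<Rightarrow> (nat \<Rightarrow> 'a) \<Rightarrow> (nat \<Rightarrow> 'a) \<Rightarrow> bool" where
  "convex_block_basis sc x u \<longleftrightarrow>
     (\<exists>n (c :: nat \<Rightarrow> real). block_basis_with sc x n (\<lambda>i. of_real (c i)) u \<and>
        (\<forall>i. c i \<ge> 0) \<and> (\<forall>j. (\<Sum>i\<in>{n j..<n (Suc j)}. c i) = 1))"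

definition isomorphism_between ::
    "('k::real_normed_field \<Rightarrow> 'a::real_normed_vector \<Rightarrow> 'a) \<Rightarrow> 'a set \<Rightarrow>
     ('k \<Rightarrow> 'b::real_normed_vector \<Rightarrow> 'b) \<Rightarrow> 'b set \<Rightarrow> ('a \<Rightarrow> 'b) \<Rightarrow> bool" where
  "isomorphism_between sc1 X sc2 Y T \<longleftrightarrow>
     bij_betw T X Y \<and>
     (\<forall>v\<in>X. \<forall>w\<in>X. T (v + w) = T v + T w) \<and>
     (\<forall>c. \<forall>v\<in>X. T (sc1 c v) = sc2 c (T v)) \<and>
     (\<exists>K. \<forall>v\<in>X. norm (T v) \<le> K * norm v) \<and>
     (\<exists>K. \<forall>w\<in>Y. norm (inv_into X T w) \<le> K * norm w)"

definition equivalent_sequences ::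
    "('k::real_normed_field \<Rightarrow> 'a::real_normed_vector \<Rightarrow> 'a) \<Rightarrow> (nat \<Rightarrow> 'a) \<Rightarrow>
     ('k \<Rightarrow> 'b::real_normed_vector \<Rightarrow> 'b) \<Rightarrow> (nat \<Rightarrow> 'b) \<Rightarrow> bool" where
  "equivalent_sequences sc1 x sc2 y \<longleftrightarrow>
     (\<exists>T. isomorphism_between sc1 (closed_span sc1 x) sc2 (closed_span sc2 y) T \<and>
          (\<forall>j. T (x j) = y j))"

text \<open>The Banach space of scalar sequences with convergent sum, normed by the partial sums.\<close>

typedef (overloaded) 'k summing_space = "{c :: nat \<Rightarrow> 'k::real_normed_field. summable c}"
  morphisms coord Abs_summing_space
  by (rule exI[of _ "\<lambda>_. 0"]) simp

setup_lifting type_definition_summing_space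

lemma summable_coord: "summable (coord v)"
  using coord[of v] by simp

instantiation summing_space :: (real_normed_field) real_vector
begin

lift_definition zero_summing_space :: "'a summing_space" is "\<lambda>_. 0" by simp
lift_definition plus_summing_space :: "'a summing_space \<Rightarrow> 'a summing_space \<Rightarrow> 'a summing_space"
  is "\<lambda>c d j. c j + d j" by (rule summable_add)
lift_definition minus_summing_space :: "'a summing_space \<Rightarrow> 'a summing_space \<Rightarrow> 'a summing_space"
  is "\<lambda>c d j. c j - d j" by (rule summable_diff)
lift_definition uminus_summing_space :: "'a summing_space \<Rightarrow> 'a summing_space"
  is "\<lambda>c j. - c j" by (rule summable_minus)
lift_definition scaleR_summing_space :: "real \<Rightarrow> 'a summing_space \<Rightarrow> 'a summing_space"
  is "\<lambda>r c j. r *\<^sub>R c j" by (rule summable_scaleR_right)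

instance
  by standard (transfer; simp add: algebra_simps)+

end

lemma bdd_above_partial_sums:
  "bdd_above (range (\<lambda>n. norm (\<Sum>j\<le>n. coord v j)))"
proof -
  have "(\<lambda>n. \<Sum>j\<le>n. coord v j) \<longlonglongrightarrow> suminf (coord v)"
    using summable_LIMSEQ'[OF summable_coord] .
  then have "Bseq (\<lambda>n. \<Sum>j\<le>n. coord v j)"
    by (intro convergent_imp_Bseq convergentI)
  then show ?thesis
    by (auto simp: Bseq_def bdd_above_def)
qed

instantiation summing_space :: (real_normed_field) real_normed_vector
begin

definition norm_summing_space :: "'a summing_space \<Rightarrow> real" where
  "norm_summing_space v = (SUP n. norm (\<Sum>j\<le>n. coord v j))"
definition dist_summing_space :: "'a summing_space \<Rightarrow> 'a summing_space \<Rightarrow> real" where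
  "dist_summing_space v w = norm (v - w)"
definition sgn_summing_space :: "'a summing_space \<Rightarrow> 'a summing_space" where
  "sgn_summing_space v = v /\<^sub>R norm v"
definition uniformity_summing_space :: "('a summing_space \<times> 'a summing_space) filter" where
  "uniformity_summing_space = (INF e\<in>{0<..}. principal {(v, w). dist v w < e})"
definition open_summing_space :: "'a summing_space set \<Rightarrow> bool" where
  "open_summing_space U = (\<forall>v\<in>U. eventually (\<lambda>(v', w). v' = v \<longrightarrow> w \<in> U) uniformity)"

instance
proof
  have upper: "norm (\<Sum>j\<le>n. coord v j) \<le> norm v" for v :: "'a summing_space" and n
    unfolding norm_summing_space_def by (rule cSUP_upper[OF UNIV_I bdd_above_partial_sums])
  have least: "norm v \<le> K" if "\<And>n. norm (\<Sum>j\<le>n. coord v j) \<le> K" for v :: "'a summing_space" and K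
    unfolding norm_summing_space_def by (rule cSUP_least) (use that in auto)
  fix v w :: "'a summing_space" and r :: real
  show "dist v w = norm (v - w)" by (rule dist_summing_space_def)
  show "sgn v = v /\<^sub>R norm v" by (rule sgn_summing_space_def)
  show "uniformity = (INF e\<in>{0<..}. principal {(v, w :: 'a summing_space). dist v w < e})"
    by (rule uniformity_summing_space_def)
  show "open U = (\<forall>v\<in>U. eventually (\<lambda>(v', w). v' = v \<longrightarrow> w \<in> U) uniformity)"
    for U :: "'a summing_space set" by (rule open_summing_space_def)
  show "norm v = 0 \<longleftrightarrow> v = 0"
  proof
    assume "norm v = 0"
    then have s: "(\<Sum>j\<le>n. coord v j) = 0" for n
      using upper[of v n] by simp
    have "coord v n = 0" for n
      using s[of n] s[of "n - 1"] by (cases n) simp_all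
    then show "v = 0"
      by transfer auto
  next
    assume "v = 0"
    then show "norm v = 0"
      by (simp add: norm_summing_space_def zero_summing_space.rep_eq)
  qed
  show "norm (v + w) \<le> norm v + norm w"
  proof (rule least)
    fix n
    have "norm (\<Sum>j\<le>n. coord (v + w) j) \<le> norm (\<Sum>j\<le>n. coord v j) + norm (\<Sum>j\<le>n. coord w j)"
      by (simp add: plus_summing_space.rep_eq sum.distrib norm_triangle_ineq)
    then show "norm (\<Sum>j\<le>n. coord (v + w) j) \<le> norm v + norm w"
      using upper[of v n] upper[of w n] by linarith
  qed
  have le: "norm (r *\<^sub>R v) \<le> \<bar>r\<bar> * norm v" for r and v :: "'a summing_space"
    by (rule least)
      (simp add: scaleR_summing_space.rep_eq scaleR_right.sum[symmetric] mult_left_mono upper)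
  show "norm (r *\<^sub>R v) = \<bar>r\<bar> * norm v"
  proof (cases "r = 0")
    case True
    then show ?thesis
      by (simp add: norm_summing_space_def zero_summing_space.rep_eq)
  next
    case False
    have "norm v = norm ((1 / r) *\<^sub>R r *\<^sub>R v)" using False by simp
    also have "\<dots> \<le> \<bar>1 / r\<bar> * norm (r *\<^sub>R v)" by (rule le)
    finally have "\<bar>r\<bar> * norm v \<le> norm (r *\<^sub>R v)"
      using False by (simp add: field_simps)
    with le[of r v] show ?thesis by simp
  qed
qed

end

lemma norm_partial_sum_le: "norm (\<Sum>j\<le>n. coord v j) \<le> norm v"
  unfolding norm_summing_space_def by (rule cSUP_upper[OF UNIV_I bdd_above_partial_sums])

lemma norm_summing_space_le: "(\<And>n. norm (\<Sum>j\<le>n. coord v j) \<le> K) \<Longrightarrow> norm v \<le> K"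
  unfolding norm_summing_space_def by (rule cSUP_least) auto

instance summing_space :: ("{real_normed_field, banach}") banach
proof
  fix X :: "nat \<Rightarrow> 'a summing_space"
  assume X: "Cauchy X"
  define s where "s m n = (\<Sum>j\<le>n. coord (X m) j)" for m n
  have s_diff: "norm (s m n - s k n) \<le> dist (X m) (X k)" for m n k
    using norm_partial_sum_le[of "X m - X k" n]
    by (simp add: s_def dist_norm minus_summing_space.rep_eq sum_subtractf)
  have "\<exists>M. \<forall>n m k. m \<ge> M \<longrightarrow> k \<ge> M \<longrightarrow> norm (s m n - s k n) < e" if "e > 0" for e
  proof -
    obtain M where "\<forall>m\<ge>M. \<forall>k\<ge>M. dist (X m) (X k) < e"
      using metric_CauchyD[OF X \<open>e > 0\<close>] by blast
    then show ?thesis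
      using s_diff by (intro exI[of _ M]) (meson le_less_trans)
  qed
  note unif = this
  have "Cauchy (\<lambda>m. s m n)" for n
    unfolding Cauchy_def dist_norm using unif by meson
  then obtain l where l: "\<And>n. (\<lambda>m. s m n) \<longlonglongrightarrow> l n"
    unfolding Cauchy_convergent_iff convergent_def by metis
  have close: "\<exists>M. \<forall>m\<ge>M. \<forall>n. norm (s m n - l n) \<le> e" if "e > 0" for e
  proof -
    obtain M where M: "\<And>n m k. m \<ge> M \<Longrightarrow> k \<ge> M \<Longrightarrow> norm (s m n - s k n) < e"
      using unif[OF \<open>e > 0\<close>] by blast
    have "norm (s m n - l n) \<le> e" if "m \<ge> M" for m n
    proof (rule LIMSEQ_le_const2)
      show "(\<lambda>k. norm (s m n - s k n)) \<longlonglongrightarrow> norm (s m n - l n)"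
        by (intro tendsto_intros l)
      show "\<exists>N. \<forall>k\<ge>N. norm (s m n - s k n) \<le> e"
        using M[OF that] less_imp_le by blast
    qed
    then show ?thesis by blast
  qed
  have "Cauchy l"
  proof (rule metric_CauchyI)
    fix e :: real assume "e > 0"
    then obtain M where M: "\<And>n. norm (s M n - l n) \<le> e / 4"
      using close[of "e / 4"] by auto
    have "Cauchy (s M)"
      using summable_LIMSEQ'[OF summable_coord[of "X M"]] unfolding s_def
      by (intro convergent_Cauchy convergentI)
    then obtain N where N: "\<forall>i\<ge>N. \<forall>k\<ge>N. dist (s M i) (s M k) < e / 4"
      using metric_CauchyD[of "s M" "e / 4"] \<open>e > 0\<close> by auto
    have "dist (l i) (l k) < e" if "i \<ge> N" "k \<ge> N" for i k
    proof -
      have "dist (l i) (l k) \<le> dist (s M i) (l i) + dist (s M i) (s M k) + dist (s M k) (l k)"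
        by metric
      also have "\<dots> < e"
        using N[rule_format, OF that] M[of i] M[of k] \<open>e > 0\<close> by (simp add: dist_norm)
      finally show ?thesis .
    qed
    then show "\<exists>N. \<forall>i\<ge>N. \<forall>k\<ge>N. dist (l i) (l k) < e" by blast
  qed
  define c where "c n = (case n of 0 \<Rightarrow> l 0 | Suc k \<Rightarrow> l (Suc k) - l k)" for n
  have sum_c: "(\<Sum>j\<le>n. c j) = l n" for n
    by (induction n) (auto simp: c_def)
  have "summable c"
    using \<open>Cauchy l\<close> unfolding summable_iff_convergent' sum_c by (rule Cauchy_convergent)
  then have coord_c: "coord (Abs_summing_space c) = c"
    by (simp add: Abs_summing_space_inverse)
  have "X \<longlonglongrightarrow> Abs_summing_space c"
  proof (rule metric_LIMSEQ_I)
    fix e :: real assume "e > 0"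
    then obtain M where M: "\<And>m n. m \<ge> M \<Longrightarrow> norm (s m n - l n) \<le> e / 2"
      using close[of "e / 2"] by auto
    have "dist (X m) (Abs_summing_space c) \<le> e / 2" if "m \<ge> M" for m
      unfolding dist_norm using M[OF that]
      by (intro norm_summing_space_le)
        (simp add: minus_summing_space.rep_eq sum_subtractf coord_c sum_c s_def)
    then show "\<exists>M. \<forall>m\<ge>M. dist (X m) (Abs_summing_space c) < e"
      using \<open>e > 0\<close> by (intro exI[of _ M]) (smt (verit) field_sum_of_halves)
  qed
  then show "convergent X" by (rule convergentI)
qed

lift_definition scale_summing_space ::
    "'k::real_normed_field \<Rightarrow> 'k summing_space \<Rightarrow> 'k summing_space"
  is "\<lambda>a c j. a * c j" by (rule summable_mult)

lemma banach_over_summing_space: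
  "banach_over (scale_summing_space :: 'k::{real_normed_field, banach} \<Rightarrow> _)"
proof
  fix a b :: 'k and v w :: "'k summing_space" and r :: real
  show "scale_summing_space a (v + w) = scale_summing_space a v + scale_summing_space a w"
    by transfer (simp add: algebra_simps)
  show "scale_summing_space (a + b) v = scale_summing_space a v + scale_summing_space b v"
    by transfer (simp add: algebra_simps)
  show "scale_summing_space a (scale_summing_space b v) = scale_summing_space (a * b) v"
    by transfer (simp add: algebra_simps)
  show "scale_summing_space 1 v = v"
    by transfer simp
  show "scale_summing_space (of_real r) v = r *\<^sub>R v"
    by transfer (simp add: scaleR_conv_of_real)
  have "norm (scale_summing_space a v) = (SUP n. norm a * norm (\<Sum>j\<le>n. coord v j))"
    by (simp add: norm_summing_space_def scale_summing_space.rep_eq sum_distrib_left[symmetric]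
        norm_mult)
  also have "\<dots> = norm a * norm v"
    unfolding norm_summing_space_def
    by (rule continuous_at_Sup_mono[symmetric, where f = "\<lambda>t. norm a * t" and
          S = "range (\<lambda>n. norm (\<Sum>j\<le>n. coord v j))", unfolded image_image])
      (auto intro!: monoI mult_left_mono continuous_intros bdd_above_partial_sums)
  finally show "norm (scale_summing_space a v) = norm a * norm v" .
qed

lift_definition summing_basis :: "nat \<Rightarrow> 'k::real_normed_field summing_space"
  is "\<lambda>n j. if j = n then 1 else 0"
  by (rule summable_finite[where N = "{n}" for n]) auto

end

theory Submission
  imports Defs
begin

text \<open>
  Passing to a subsequence \<open>b\<close>, one may assume that \<open>b\<close> is basic and dominates the summing basis.
  Identify the dual ball with the compact set \<open>K\<close> of scalar sequences \<open>t = (f (b\<^sub>j))\<^sub>j\<close>; all of them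
  converge. Consider the oscillation of \<open>Re \<circ> lim\<close> on \<open>K\<close>, defined by well-founded trees of successive
  small moves in \<open>K\<close>, of which chosen ones contribute the increment of \<open>Re \<circ> lim\<close>.

  If the oscillation is unbounded, thin out \<open>b\<close> so that along every tree and every choice of jump
  times the points of \<open>K\<close> are nearly constant between jumps. Given bounded sums
  \<open>\<Sum>c\<^sub>j b\<^sub>j\<close> whose coefficient sums \<open>\<Sum>\<^sub>i\<^sub>\<le>\<^sub>j c\<^sub>i\<close> have two cluster points, play the trees jumping at times where these
  sums are near one cluster point for the increments to be counted and near the other one for the
  rest. By Abel summation this contradicts the boundedness, so the thinned sequence is strongly summing.

  If the oscillation is bounded, then \<open>Re \<circ> lim\<close> is a difference of two bounded upper semicontinuous
  functions, hence a pointwise limit of differences of decreasing sequences of continuous functions.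
  By Simons' argument, convex blocks of \<open>b\<close> are uniformly close to the corresponding convex blocks of
  these, so their successive differences are weakly unconditionally Cauchy.
\<close>

section \<open>Linear functionals\<close>

text \<open>The thinned subsequence must be fixed before any coefficients are known, whereas the
  jump times depend on the coefficients. Hence a tree offers a move for every index and leaves the
  choice among them open. Jumps at finitely many selected indices reach only finitely many subtrees
  of finitely many trees, so thinning by induction can stabilise all of them.

  Uncounted moves cannot be dispensed with: along a path all of whose moves count, the increments of
  \<open>rp (lim t)\<close> telescope and stay below twice the bound of \<open>K\<close>. Uncounted
  moves let the path return without losing what was gained. Two distinct cluster points of the
  coefficient sums provide the weights: after subtracting one of them and rotating, a jump is
  weighted either by nearly 0 or by nearly a fixed positive number.

  Real parts are used because upper semicontinuity and Simons' argument need an order. The first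
  subsequence exists because the weak-star limit of \<open>x\<close> in the bidual lies at positive
  distance from the space, which is where non-triviality enters. Domination of the summing basis
  then bounds the coefficient sums in the first alternative and gives the lower estimate in the
  second.\<close>

definition sublinear :: "('a::real_vector \<Rightarrow> real) \<Rightarrow> bool" where
  "sublinear p \<longleftrightarrow> (\<forall>u v. p (u + v) \<le> p u + p v) \<and> (\<forall>t>0. \<forall>v. p (t *\<^sub>R v) \<le> t * p v)"

lemma sublinear_add: "sublinear p \<Longrightarrow> p (u + v) \<le> p u + p v"
  by (simp add: sublinear_def)

lemma sublinear_scaleR:
  assumes "sublinear p" "t > 0"
  shows "p (t *\<^sub>R v) = t * p v"
proof (rule antisym)
  show "p (t *\<^sub>R v) \<le> t * p v" using assms by (simp add: sublinear_def)
  have "p ((1/t) *\<^sub>R t *\<^sub>R v) \<le> (1/t) * p (t *\<^sub>R v)"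
    using assms by (metis sublinear_def zero_less_divide_1_iff)
  then show "t * p v \<le> p (t *\<^sub>R v)"
    using assms by (simp add: field_simps)
qed

lemma sublinear_0: "sublinear p \<Longrightarrow> p 0 = 0"
  using sublinear_scaleR[of p 2 0] by simp

lemma sublinear_minus: "sublinear p \<Longrightarrow> - p (- v) \<le> p v"
  using sublinear_add[of p v "-v"] sublinear_0[of p] by simp

text \<open>The witness \<open>k\<close> need not be \<open>i\<close> or \<open>j\<close>, so that
  the same argument serves for a chain, where \<open>k\<close> is the smaller function, for the
  half-line \<open>t \<ge> 0\<close>, and for a cone.\<close>

lemma sublinear_INF:
  assumes I: "I \<noteq> {}" and bdd: "\<And>v. bdd_below ((\<lambda>i. h i v) ` I)"
    and add: "\<And>i j u v. i \<in> I \<Longrightarrow> j \<in> I \<Longrightarrow> \<exists>k\<in>I. h k (u + v) \<le> h i u + h j v"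
    and scale: "\<And>i t v. i \<in> I \<Longrightarrow> t > 0 \<Longrightarrow> \<exists>k\<in>I. h k (t *\<^sub>R v) \<le> t * h i v"
  shows "sublinear (\<lambda>v. INF i\<in>I. (h i v :: real))"
  unfolding sublinear_def
proof (intro conjI allI impI)
  fix u v
  have *: "(INF k\<in>I. h k (u + v)) \<le> h i u + h j v" if "i \<in> I" "j \<in> I" for i j
    using add[OF that] bdd by (meson cINF_lower2)
  have "(INF k\<in>I. h k (u + v)) - h j v \<le> (INF i\<in>I. h i u)" if "j \<in> I" for j
    by (rule cINF_greatest[OF I]) (use *[OF _ that] in \<open>simp add: algebra_simps\<close>)
  then have "(INF k\<in>I. h k (u + v)) - (INF i\<in>I. h i u) \<le> (INF j\<in>I. h j v)"
    by (intro cINF_greatest[OF I]) (simp add: algebra_simps)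
  then show "(INF k\<in>I. h k (u + v)) \<le> (INF i\<in>I. h i u) + (INF j\<in>I. h j v)" by simp
next
  fix t v assume t: "(t::real) > 0"
  have "(INF k\<in>I. h k (t *\<^sub>R v)) / t \<le> (INF i\<in>I. h i v)"
  proof (rule cINF_greatest[OF I])
    fix i assume "i \<in> I"
    then obtain k where "k \<in> I" "h k (t *\<^sub>R v) \<le> t * h i v" using scale t by blast
    then have "(INF k\<in>I. h k (t *\<^sub>R v)) \<le> t * h i v" using bdd by (meson cINF_lower2)
    then show "(INF k\<in>I. h k (t *\<^sub>R v)) / t \<le> h i v" using t by (simp add: field_simps)
  qed
  then show "(INF k\<in>I. h k (t *\<^sub>R v)) \<le> t * (INF i\<in>I. h i v)"
    using t by (simp add: field_simps)
qed

text \<open>A minimal sublinear functional \<open>q\<close> coincides with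
  \<open>x \<mapsto> inf\<^sub>t\<^sub>\<ge>\<^sub>0 (q (x + t y) - t q y)\<close>, and is therefore additive.\<close>

lemma sublinear_dominates_linear:
  fixes p :: "'a::real_vector \<Rightarrow> real"
  assumes p: "sublinear p"
  shows "\<exists>g. linear g \<and> (\<forall>v. g v \<le> p v)"
proof -
  define A where "A = {q. sublinear q \<and> (\<forall>v. q v \<le> p v)}"
  \<comment> \<open>The order is reversed: a maximal element for \<open>P\<close> is a pointwise
    minimal sublinear functional.\<close>
  define P where "P q r \<longleftrightarrow> (\<forall>v. r v \<le> q v)" for q r :: "'a \<Rightarrow> real"
  have po: "partial_order_on A (relation_of P A)"
    by (rule partial_order_on_relation_ofI) (auto simp: P_def intro: order.trans intro!: ext antisym)
  have "\<exists>u\<in>A. \<forall>a\<in>C. P a u" if C: "C \<in> Chains (relation_of P A)" for C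
  proof (cases "C = {}")
    case True
    then show ?thesis using p by (auto simp: A_def)
  next
    case False
    have CA: "C \<subseteq> A"
      using C by (auto simp: Chains_def relation_of_def)
    have cmp: "P q r \<or> P r q" if "q \<in> C" "r \<in> C" for q r
      using C that by (auto simp: Chains_def relation_of_def)
    \<comment> \<open>A lower bound common to the whole chain, which keeps its infimum
      finite.\<close>
    have low: "- p (- v) \<le> q v" if "q \<in> C" for q v
    proof -
      have "q \<in> A" using that CA by auto
      then have "- q (- v) \<le> q v" "q (- v) \<le> p (- v)" by (auto simp: A_def sublinear_minus)
      then show ?thesis by linarith
    qed
    then have bdd: "bdd_below ((\<lambda>q. q v) ` C)" for v
      by (intro bdd_belowI[of _ "- p (- v)"]) auto
    have "sublinear (\<lambda>v. INF q\<in>C. q v)"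
    proof (rule sublinear_INF[OF False bdd])
      fix i j u v assume ij: "i \<in> C" "j \<in> C"
      then have s: "sublinear i" "sublinear j" using CA by (auto simp: A_def)
      from cmp[OF ij] show "\<exists>k\<in>C. k (u + v) \<le> i u + j v"
      proof
        assume "P i j"
        then have "j (u + v) \<le> i u + j v"
          using sublinear_add[OF s(2), of u v] by (auto simp: P_def intro: order.trans)
        then show ?thesis using ij by blast
      next
        assume "P j i"
        then have "i (u + v) \<le> i u + j v"
          using sublinear_add[OF s(1), of u v] unfolding P_def by (meson add_left_mono order.trans)
        then show ?thesis using ij by blast
      qed
    next
      fix i t v assume "i \<in> C" "(t::real) > 0"
      then show "\<exists>k\<in>C. k (t *\<^sub>R v) \<le> t * i v"
        using CA sublinear_scaleR[of i t v] by (intro bexI[of _ i]) (auto simp: A_def)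
    qed
    moreover have le: "(INF q\<in>C. q v) \<le> r v" if "r \<in> C" for r v
      by (rule cINF_lower[OF bdd that])
    moreover have "(INF q\<in>C. q v) \<le> p v" for v
      using False le CA unfolding A_def by (metis (no_types, lifting) all_not_in_conv mem_Collect_eq order.trans subsetD)
    ultimately show ?thesis
      by (intro bexI[of _ "\<lambda>v. INF q\<in>C. q v"]) (auto simp: P_def A_def)
  qed
  then obtain q where q: "q \<in> A" and "\<forall>r\<in>A. P q r \<longrightarrow> r = q"
    using predicate_Zorn[OF po] by blast
  then have min: "r = q" if "sublinear r" "\<And>v. r v \<le> q v" for r
  proof -
    have "r v \<le> p v" for v using that(2)[of v] q by (auto simp: A_def intro: order.trans)
    then show ?thesis using that \<open>\<forall>r\<in>A. P q r \<longrightarrow> r = q\<close> by (simp add: A_def P_def)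
  qed
  have sq: "sublinear q" using q by (simp add: A_def)
  have tq: "q (t *\<^sub>R y) = t * q y" if "t \<ge> 0" for t y
    using sublinear_scaleR[OF sq, of t y] sublinear_0[OF sq] that by (cases "t = 0") auto
  have ge: "q x + q y \<le> q (x + y)" for x y
  proof -
    define h where "h t x = q (x + t *\<^sub>R y) - t * q y" for t x
    have low: "- q (- x) \<le> h t x" if "t \<ge> 0" for t x
      using sublinear_add[OF sq, of "x + t *\<^sub>R y" "-x"] tq[OF that, of y] by (simp add: h_def)
    then have bdd: "bdd_below ((\<lambda>t. h t x) ` {0..})" for x
      by (intro bdd_belowI[of _ "- q (- x)"]) auto
    have "sublinear (\<lambda>x. INF t\<in>{0..}. h t x)"
    proof (rule sublinear_INF[OF _ bdd])
      fix i j :: real and u v assume "i \<in> {0..}" "j \<in> {0..}"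
      moreover have "h (i + j) (u + v) \<le> h i u + h j v"
        using sublinear_add[OF sq, of "u + i *\<^sub>R y" "v + j *\<^sub>R y"]
        by (simp add: h_def algebra_simps)
      ultimately show "\<exists>k\<in>{0..}. h k (u + v) \<le> h i u + h j v"
        by (intro bexI[of _ "i + j"]) auto
    next
      fix i t :: real and v assume it: "i \<in> {0..}" "t > 0"
      then have "h (t * i) (t *\<^sub>R v) = t * h i v"
        using sublinear_scaleR[OF sq, of t "v + i *\<^sub>R y"] by (simp add: h_def algebra_simps)
      then show "\<exists>k\<in>{0..}. h k (t *\<^sub>R v) \<le> t * h i v"
        using it by (intro bexI[of _ "t * i"]) auto
    qed auto
    moreover have le: "(INF t\<in>{0..}. h t x) \<le> h s x" if "s \<ge> 0" for s x
      using that by (intro cINF_lower[OF bdd]) auto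
    moreover have "h 0 x = q x" for x by (simp add: h_def)
    ultimately have "(\<lambda>x. INF t\<in>{0..}. h t x) = q"
      using le[of 0] by (intro min) auto
    then have "q x \<le> h 1 x" using le[of 1 x] by (metis zero_le_one)
    then show ?thesis by (simp add: h_def)
  qed
  have add: "q (x + y) = q x + q y" for x y
    using ge[of x y] sublinear_add[OF sq, of x y] by simp
  have neg: "q (- x) = - q x" for x
    using add[of x "-x"] sublinear_0[OF sq] by simp
  have "q (t *\<^sub>R x) = t *\<^sub>R q x" for t x
    using tq[of t x] tq[of "-t" x] neg[of "t *\<^sub>R x"] by (cases "t \<ge> 0") auto
  then have "linear q" using add by (intro linearI) auto
  then show ?thesis using q by (auto simp: A_def)
qed

text \<open>A sandwich form of Hahn-Banach. The infimum over \<open>G\<close> of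
  \<open>norm (v - w) + s\<close> is sublinear, and \<open>low\<close> keeps it finite. A linear
  minorant of it is below the norm because of the pair \<open>(0, 0)\<close>, and below
  \<open>s\<close> at \<open>w\<close> on taking \<open>v = w\<close>. If \<open>G\<close> is the
  graph of a linear functional, it contains the negative of each pair and the bound becomes an
  equality.\<close>

lemma linear_functional_below_cone:
  fixes G :: "('a::real_normed_vector \<times> real) set"
  assumes zero: "(0, 0) \<in> G"
    and add: "\<And>w s w' s'. (w, s) \<in> G \<Longrightarrow> (w', s') \<in> G \<Longrightarrow> (w + w', s + s') \<in> G"
    and scale: "\<And>w s t. (w, s) \<in> G \<Longrightarrow> t > 0 \<Longrightarrow> (t *\<^sub>R w, t * s) \<in> G"
    and low: "\<And>w s. (w, s) \<in> G \<Longrightarrow> - norm w \<le> s"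
  shows "\<exists>g. linear g \<and> (\<forall>v. \<bar>g v\<bar> \<le> norm v) \<and> (\<forall>(w, s)\<in>G. g w \<le> s)"
proof -
  define h where "h ws v = norm (v - fst ws) + snd ws" for ws and v :: 'a
  have "- norm v \<le> h ws v" if "ws \<in> G" for ws v
    using low[of "fst ws" "snd ws"] that norm_triangle_ineq4[of v "v - fst ws"]
    by (auto simp: h_def)
  then have bdd: "bdd_below ((\<lambda>ws. h ws v) ` G)" for v
    by (intro bdd_belowI[of _ "- norm v"]) auto
  have "sublinear (\<lambda>v. INF ws\<in>G. h ws v)"
  proof (rule sublinear_INF[OF _ bdd])
    show "G \<noteq> {}" using zero by auto
    fix i j u v assume ij: "i \<in> G" "j \<in> G"
    have "h (fst i + fst j, snd i + snd j) (u + v) \<le> h i u + h j v"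
      using norm_triangle_ineq[of "u - fst i" "v - fst j"] by (simp add: h_def algebra_simps)
    then show "\<exists>k\<in>G. h k (u + v) \<le> h i u + h j v"
      using add[of "fst i" "snd i" "fst j" "snd j"] ij by auto
  next
    fix i v and t :: real assume it: "i \<in> G" "t > 0"
    have "h (t *\<^sub>R fst i, t * snd i) (t *\<^sub>R v) = t * h i v"
      using it by (simp add: h_def scaleR_diff_right[symmetric] algebra_simps del: scaleR_diff_right)
    then show "\<exists>k\<in>G. h k (t *\<^sub>R v) \<le> t * h i v"
      using scale[of "fst i" "snd i" t] it by (intro bexI[of _ "(t *\<^sub>R fst i, t * snd i)"]) auto
  qed
  then obtain g where g: "linear g" "\<And>v. g v \<le> (INF ws\<in>G. h ws v)"
    using sublinear_dominates_linear by blast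
  have gh: "g v \<le> h ws v" if "ws \<in> G" for ws v
    using g(2)[of v] cINF_lower[OF bdd that] by (rule order.trans)
  have "g v \<le> norm v" for v using gh[OF zero, of v] by (simp add: h_def)
  moreover have "- g v \<le> norm v" for v
    using gh[OF zero, of "-v"] linear_neg[OF g(1), of v] by (simp add: h_def)
  moreover have "g w \<le> s" if "(w, s) \<in> G" for w s
    using gh[OF that, of w] by (simp add: h_def)
  ultimately show ?thesis using g(1) by (intro exI[of _ g]) (auto simp: abs_le_iff)
qed

lemma norming_functional:
  fixes v :: "'a::real_normed_vector"
  shows "\<exists>g. linear g \<and> (\<forall>u. \<bar>g u\<bar> \<le> norm u) \<and> g v = norm v"
proof -
  have "\<exists>g. linear g \<and> (\<forall>u. \<bar>g u\<bar> \<le> norm u) \<and>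
      (\<forall>(w, s)\<in>range (\<lambda>t. (t *\<^sub>R v, t * norm v)). g w \<le> s)"
  proof (rule linear_functional_below_cone)
    fix w s w' s' and t :: real
    assume ws: "(w, s) \<in> range (\<lambda>t. (t *\<^sub>R v, t * norm v))"
    then obtain a where a: "w = a *\<^sub>R v" "s = a * norm v" by auto
    show "(t *\<^sub>R w, t * s) \<in> range (\<lambda>t. (t *\<^sub>R v, t * norm v))"
      by (rule image_eqI[of _ _ "t * a"]) (auto simp: a)
    show "- norm w \<le> s"
      using mult_right_mono[of "- \<bar>a\<bar>" a "norm v"] by (simp add: a)
    assume "(w', s') \<in> range (\<lambda>t. (t *\<^sub>R v, t * norm v))"
    then obtain a' where "w' = a' *\<^sub>R v" "s' = a' * norm v" by auto
    then show "(w + w', s + s') \<in> range (\<lambda>t. (t *\<^sub>R v, t * norm v))"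
      by (intro image_eqI[of _ _ "a + a'"]) (auto simp: a algebra_simps)
  qed (auto intro: image_eqI[of _ _ 0])
  then obtain g where g: "linear g" "\<And>u. \<bar>g u\<bar> \<le> norm u" "\<And>t. g (t *\<^sub>R v) \<le> t * norm v"
    by auto
  have "g v = norm v" using g(3)[of 1] g(3)[of "-1"] linear_neg[OF g(1), of v] by simp
  then show ?thesis using g by blast
qed

text \<open>Gliding hump along signed sums of \<open>3\<^sup>-\<^sup>i h\<^sub>i\<close>, where \<open>h\<^sub>i\<close> norms a term of norm at
  least \<open>4\<^sup>i\<close>: the terms after the \<open>i\<close>th cancel at most half of the \<open>i\<close>th one.\<close>

lemma weakly_bounded_imp_bounded:
  fixes x :: "nat \<Rightarrow> 'a::real_normed_vector"
  assumes w: "\<And>g. linear g \<Longrightarrow> (\<And>v. \<bar>g v\<bar> \<le> norm v) \<Longrightarrow> bounded (range (\<lambda>j. g (x j)))"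
  shows "bounded (range x)"
proof (rule ccontr)
  assume "\<not> bounded (range x)"
  then have "\<exists>j. norm (x j) > M" for M unfolding bounded_iff by (auto simp: not_le)
  then have "\<forall>k. \<exists>j. norm (x j) > 4 ^ k" by blast
  then obtain j :: "nat \<Rightarrow> nat" where j: "\<And>k. norm (x (j k)) > 4 ^ k" by metis
  obtain h where h: "\<And>k. linear (h k)" "\<And>k v. \<bar>h k v\<bar> \<le> norm v"
    "\<And>k. h k (x (j k)) = norm (x (j k))"
    using norming_functional[of "x (j k)" for k] by metis
  \<comment> \<open>Since \<open>h k (x (j k))\<close> is positive, this sign makes the term with
    index \<open>k\<close> reinforce the sum of the earlier ones at \<open>x (j k)\<close>.\<close>
  define Q where "Q f k s \<longleftrightarrow>
    s = (if (\<Sum>i<k. f i * (1/3)^i * h i (x (j k))) \<ge> 0 then 1 else - 1)" for f k and s :: real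
  have "\<exists>f. \<forall>k. Q f k (f k)"
  proof (rule dependent_wellorder_choice)
    fix r and f g :: "nat \<Rightarrow> real" and k :: nat assume "\<And>y. y < k \<Longrightarrow> f y = g y"
    then have "(\<Sum>i<k. f i * (1/3)^i * h i (x (j k))) = (\<Sum>i<k. g i * (1/3)^i * h i (x (j k)))"
      by simp
    then show "Q f k r = Q g k r" unfolding Q_def by simp
  next
    show "\<exists>r. Q f k r" for k f unfolding Q_def by (rule exI, rule refl)
  qed
  then obtain f where f: "\<And>k. Q f k (f k)" by blast
  have f1: "\<bar>f k\<bar> = 1" for k using f[of k] by (auto simp: Q_def split: if_splits)
  define T where "T i v = f i * (1/3)^i * h i v" for i v
  have Tle: "norm (T i v) \<le> (1/3)^i * norm v" for i v
    using h(2)[of i v] f1[of i] by (simp add: T_def abs_mult mult_left_mono)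
  have geo: "summable (\<lambda>i. (1/3)^i * norm v)" for v :: 'a
    by (intro summable_mult2 summable_geometric) simp
  have sm: "summable (\<lambda>i. T i v)" for v
    by (rule summable_comparison_test'[OF geo Tle])
  define g where "g v = (\<Sum>i. T i v)" for v
  have "linear g"
  proof (rule linearI)
    show "g (u + v) = g u + g v" for u v
      using suminf_add[OF sm sm, of u v] by (simp add: g_def T_def linear_add[OF h(1)] algebra_simps)
    show "g (c *\<^sub>R v) = c *\<^sub>R g v" for c v
      using suminf_mult[OF sm, of c v] by (simp add: g_def T_def linear_cmul[OF h(1)] algebra_simps)
  qed
  have ggeo: "(\<Sum>i. (1/3)^i * norm v) = 3/2 * norm v" for v :: 'a
    by (subst suminf_mult2[symmetric]) (simp_all add: suminf_geometric)
  have gb: "\<bar>g v\<bar> \<le> 3/2 * norm v" for v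
  proof -
    have "\<bar>g v\<bar> \<le> (\<Sum>i. (1/3)^i * norm v)" unfolding g_def real_norm_def[symmetric]
      by (rule norm_suminf_le[OF Tle geo])
    then show ?thesis by (simp add: ggeo)
  qed
  \<comment> \<open>The factor is the inverse of the sum of all \<open>(1/3)^i\<close> and brings
    \<open>g\<close> into the unit ball.\<close>
  have lin: "linear (\<lambda>v. g v * (2/3))"
    using \<open>linear g\<close> by (auto simp: linear_iff algebra_simps)
  have "\<bar>g v * (2/3)\<bar> \<le> norm v" for v using gb[of v] by (simp add: abs_mult)
  from w[OF lin this] obtain M where M: "\<And>i. \<bar>g (x i) * (2/3)\<bar> \<le> M"
    unfolding bounded_iff by auto
  have big: "(1/2) * (4/3)^k \<le> \<bar>g (x (j k))\<bar>" for k
  proof -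
    let ?y = "x (j k)"
    have "g ?y = (\<Sum>i. T (i + Suc k) ?y) + (\<Sum>i<Suc k. T i ?y)"
      unfolding g_def by (rule suminf_split_initial_segment[OF sm])
    moreover have "\<bar>\<Sum>i<Suc k. T i ?y\<bar> \<ge> (1/3)^k * norm ?y"
      using f[of k] h(3)[of k] by (auto simp: Q_def T_def split: if_splits)
    moreover have "\<bar>\<Sum>i. T (i + Suc k) ?y\<bar> \<le> (1/2) * (1/3)^k * norm ?y"
    proof -
      have s2: "summable (\<lambda>i. (1/3)^(i + Suc k) * norm ?y)"
        using geo summable_ignore_initial_segment by blast
      have "\<bar>\<Sum>i. T (i + Suc k) ?y\<bar> \<le> (\<Sum>i. (1/3)^(i + Suc k) * norm ?y)"
        unfolding real_norm_def[symmetric] by (rule norm_suminf_le[OF Tle s2])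
      also have "\<dots> = (1/3)^Suc k * (\<Sum>i. (1/3)^i * norm ?y)"
        by (subst suminf_mult[OF geo, symmetric]) (simp add: power_add algebra_simps)
      finally show ?thesis by (simp add: ggeo)
    qed
    ultimately have "\<bar>g ?y\<bar> \<ge> (1/2) * ((1/3)^k * norm ?y)" by linarith
    moreover have "(1/3)^k * norm ?y \<ge> (1/3)^k * (4::real)^k"
      using j[of k] by (intro mult_left_mono) auto
    ultimately show ?thesis by (simp add: power_mult_distrib[symmetric])
  qed
  obtain k where "(4/3)^k > 3 * M" using real_arch_pow[of "4/3" "3*M"] by auto
  then show False using big[of k] M[of "j k"] by (simp add: abs_mult)
qed

section \<open>Pointwise null sequences of continuous functions on compact sets\<close>

text \<open>Closure under two-point combinations is all that the minimisation uses, and it makes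
  bounds and continuity plain inductions. Explicit coefficients are recovered only at the end, in
  \<open>convex_combinations_coefficients\<close>.\<close>

inductive_set convex_combinations :: "(nat \<Rightarrow> 't \<Rightarrow> real) \<Rightarrow> nat \<Rightarrow> ('t \<Rightarrow> real) set"
  for g n where
  single: "i \<ge> n \<Longrightarrow> g i \<in> convex_combinations g n"
| conv: "h \<in> convex_combinations g n \<Longrightarrow> h' \<in> convex_combinations g n \<Longrightarrow> 0 \<le> a \<Longrightarrow> a \<le> 1 \<Longrightarrow>
    (\<lambda>t. a * h t + (1 - a) * h' t) \<in> convex_combinations g n"

lemma convex_combinations_antimono:
  "h \<in> convex_combinations g n \<Longrightarrow> m \<le> n \<Longrightarrow> h \<in> convex_combinations g m"
proof (induction rule: convex_combinations.induct)
  case (single i)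
  then show ?case by (intro convex_combinations.single) simp
next
  case (conv h h' a)
  then show ?case by (intro convex_combinations.conv)
qed

lemma convex_combinations_bounds:
  assumes "h \<in> convex_combinations g n" "\<And>i. i \<ge> n \<Longrightarrow> l \<le> g i t \<and> g i t \<le> u"
  shows "l \<le> h t \<and> h t \<le> u"
  using assms(1)
proof induction
  case (conv h h' a)
  have "a * l + (1 - a) * l \<le> a * h t + (1 - a) * h' t"
    using conv by (intro add_mono mult_left_mono) auto
  moreover have "a * h t + (1 - a) * h' t \<le> a * u + (1 - a) * u"
    using conv by (intro add_mono mult_left_mono) auto
  ultimately show ?case by (simp add: algebra_simps)
qed (use assms in auto)

lemma convex_combinations_continuous:
  assumes "h \<in> convex_combinations g n" "\<And>i. continuous_on K (g i)"
  shows "continuous_on K h"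
  using assms(1)
proof induction
  case (conv h h' a)
  show ?case by (intro continuous_intros conv.IH)
qed (rule assms(2))

lemma strict_inc_induct_up [consumes 1, case_names base step]:
  assumes "n < M" "P (Suc n)" "\<And>M. n < M \<Longrightarrow> P M \<Longrightarrow> P (Suc M)"
  shows "P M"
  using assms(1)
proof (induction M)
  case (Suc M)
  then show ?case using assms(2,3) by (cases "n = M") auto
qed simp

text \<open>Appending one term to a weighted mean of total weight \<open>W\<close> is a two-point
  combination with \<open>a = W / (W + w M)\<close>.\<close>

lemma convex_combinations_sum:
  assumes x: "\<And>k. n \<le> k \<Longrightarrow> x k \<in> convex_combinations g n" and M: "n < M"
    and w: "\<And>k. w k > 0"
  shows "(\<lambda>t. (\<Sum>k\<in>{n..<M}. w k * x k t) / (\<Sum>k\<in>{n..<M}. w k)) \<in> convex_combinations g n"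
  using M
proof (induction M rule: strict_inc_induct_up)
  case base
  have "w n \<noteq> 0" using w[of n] by simp
  then show ?case using x[of n] by simp
next
  case (step M)
  define W where "W = (\<Sum>k\<in>{n..<M}. w k)"
  have W: "W > 0" unfolding W_def using step w by (intro sum_pos) auto
  define a where "a = W / (W + w M)"
  have "0 \<le> a" "a \<le> 1" using W w[of M] by (auto simp: a_def)
  from convex_combinations.conv[OF step.IH x[of M] this] step
  have "(\<lambda>t. a * ((\<Sum>k\<in>{n..<M}. w k * x k t) / W) + (1 - a) * x M t) \<in> convex_combinations g n"
    by (simp add: W_def)
  moreover have "a * ((\<Sum>k\<in>{n..<M}. w k * x k t) / W) + (1 - a) * x M t =
     (\<Sum>k\<in>{n..<Suc M}. w k * x k t) / (\<Sum>k\<in>{n..<Suc M}. w k)" for t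
  proof -
    have "1 - a = w M / (W + w M)" "a / W = 1 / (W + w M)"
    proof -
      have "W + w M \<noteq> 0" using W w[of M] by simp
      then show "1 - a = w M / (W + w M)" "a / W = 1 / (W + w M)"
        using W by (simp_all add: a_def diff_divide_eq_iff)
    qed
    then have "(a / W) * (\<Sum>k\<in>{n..<M}. w k * x k t) + (1 - a) * x M t
        = ((\<Sum>k\<in>{n..<M}. w k * x k t) + w M * x M t) / (W + w M)"
      by (simp add: add_divide_distrib mult.commute)
    then show ?thesis using step by (simp add: W_def)
  qed
  ultimately show ?case by simp
qed

lemma convex_combinations_coefficients:
  assumes "h \<in> convex_combinations g n"
  shows "\<exists>N c. n < N \<and> (\<forall>i. 0 \<le> c i) \<and> (\<forall>i\<ge>N. c i = 0) \<and> (\<Sum>i\<in>{n..<N}. c i) = 1 \<and>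
    (\<forall>t. h t = (\<Sum>i\<in>{n..<N}. c i * g i t))"
  using assms
proof induction
  case (single i)
  have "(\<Sum>j\<in>{n..<Suc i}. (if j = i then 1 else 0) * g j t) = g i t" for t
    using single by (subst sum.remove[of _ i]) auto
  then show ?case
    using single by (intro exI[of _ "Suc i"] exI[of _ "\<lambda>j. if j = i then 1 else 0"]) auto
next
  case (conv h h' a)
  from conv.IH(1) obtain N c where
    c: "n < N" "\<And>i. 0 \<le> c i" "\<And>i. i \<ge> N \<Longrightarrow> c i = 0" "(\<Sum>i\<in>{n..<N}. c i) = 1"
      "\<And>t. h t = (\<Sum>i\<in>{n..<N}. c i * g i t)"
    by blast
  from conv.IH(2) obtain N' c' where
    c': "n < N'" "\<And>i. 0 \<le> c' i" "\<And>i. i \<ge> N' \<Longrightarrow> c' i = 0" "(\<Sum>i\<in>{n..<N'}. c' i) = 1"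
      "\<And>t. h' t = (\<Sum>i\<in>{n..<N'}. c' i * g i t)"
    by blast
  define L where "L = max N N'"
  have ext: "(\<Sum>i\<in>{n..<L}. c i * f i) = (\<Sum>i\<in>{n..<N}. c i * f i)"
    "(\<Sum>i\<in>{n..<L}. c' i * f i) = (\<Sum>i\<in>{n..<N'}. c' i * f i)" for f
    by (intro sum.mono_neutral_right; auto simp: L_def c c')+
  show ?case
  proof (intro exI[of _ L] exI[of _ "\<lambda>i. a * c i + (1 - a) * c' i"] conjI allI impI)
    show "(\<Sum>i\<in>{n..<L}. a * c i + (1 - a) * c' i) = 1"
      using ext(1)[of "\<lambda>_. 1"] ext(2)[of "\<lambda>_. 1"] c c'
      by (simp add: sum.distrib sum_distrib_left[symmetric])
    show "a * h t + (1 - a) * h' t = (\<Sum>i\<in>{n..<L}. (a * c i + (1 - a) * c' i) * g i t)" for t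
    proof -
      have "(\<Sum>i\<in>{n..<L}. (a * c i + (1 - a) * c' i) * g i t) =
          a * (\<Sum>i\<in>{n..<L}. c i * g i t) + (1 - a) * (\<Sum>i\<in>{n..<L}. c' i * g i t)"
        by (simp add: sum.distrib sum_distrib_left distrib_right mult.assoc)
      then show ?thesis by (simp add: ext c c')
    qed
  qed (use c c' conv in \<open>auto simp: L_def\<close>)
qed

text \<open>Simons' argument: \<open>x\<^sub>n\<close> nearly minimises \<open>sup\<^sub>K (2\<^sup>n y\<^sub>n + h)\<close> over convex combinations \<open>h\<close>
  of \<open>g\<^sub>n, g\<^sub>n\<^sub>+\<^sub>1, \<dots>\<close>, where \<open>y\<^sub>n\<close> is the \<open>n\<close>th partial sum of \<open>y = \<Sum>k. x\<^sub>k / 2\<^sup>k\<^sup>+\<^sup>1\<close>.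
  Telescoping shows that, where \<open>y\<close> attains its maximum, the normalised tails \<open>2\<^sup>n (y - y\<^sub>n)\<close>
  stay close to that maximum, although they tend to \<open>0\<close> there.\<close>

lemma small_convex_combination_aux:
  fixes g :: "nat \<Rightarrow> 't::topological_space \<Rightarrow> real"
  assumes K: "compact K" "K \<noteq> {}" and cont: "\<And>i. continuous_on K (g i)"
    and bnd: "\<And>i t. t \<in> K \<Longrightarrow> 0 \<le> g i t \<and> g i t \<le> B"
    and lim: "\<And>t. t \<in> K \<Longrightarrow> (\<lambda>i. g i t) \<longlonglongrightarrow> 0" and e: "e > 0"
  shows "\<exists>h\<in>convex_combinations g 0. \<forall>t\<in>K. h t \<le> e"
proof -
  \<comment> \<open>The argument ends with \<open>y t \<le> 3 * d\<close> at the maximum, and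
    \<open>x 0\<close> is twice the first partial sum of \<open>y\<close>, hence at most
    \<open>6 * d\<close>.\<close>
  define d where "d = e / 6"
  have d: "d > 0" using e by (simp add: d_def)
  let ?C = "convex_combinations g"
  define S where "S h = (SUP t\<in>K. h t)" for h :: "'t \<Rightarrow> real"
  have hb: "0 \<le> h t" "h t \<le> B" if "h \<in> ?C n" "t \<in> K" for h n t
    using convex_combinations_bounds[OF that(1), of 0 t B] bnd that by auto
  have Sle: "S h \<le> c" if "\<And>t. t \<in> K \<Longrightarrow> h t \<le> c" for h c
    unfolding S_def using K that by (intro cSUP_least) auto
  have leS: "h t \<le> S h" if "\<And>t. t \<in> K \<Longrightarrow> h t \<le> c" "t \<in> K" for h c t
    unfolding S_def using that by (intro cSUP_upper bdd_aboveI[of _ c]) auto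
  define Y where "Y f n t = (\<Sum>k<n. (1/2)^(k+1) * f k t)" for f :: "nat \<Rightarrow> 't \<Rightarrow> real" and n t
  \<comment> \<open>The infimum need not be attained; the permitted errors
    \<open>d * (1/2)^(n+1)\<close> are summable, with total \<open>d\<close>.\<close>
  define P where "P f n r \<longleftrightarrow> r \<in> ?C n \<and>
    (\<forall>h\<in>?C n. S (\<lambda>t. 2^n * Y f n t + r t) \<le> S (\<lambda>t. 2^n * Y f n t + h t) + d * (1/2)^(n+1))" for f n r
  have "\<exists>f. \<forall>n. P f n (f n)"
  proof (rule dependent_wellorder_choice)
    fix r and f f' :: "nat \<Rightarrow> 't \<Rightarrow> real" and n :: nat assume "\<And>y. y < n \<Longrightarrow> f y = f' y"
    then have "Y f n = Y f' n" by (auto simp: Y_def)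
    then show "P f n r = P f' n r" by (simp add: P_def)
  next
    fix n and f :: "nat \<Rightarrow> 't \<Rightarrow> real" assume f: "\<And>y. y < n \<Longrightarrow> P f y (f y)"
    define D where "D h = S (\<lambda>t. 2^n * Y f n t + h t)" for h
    have fb: "0 \<le> f k t" "f k t \<le> B" if "k < n" "t \<in> K" for k t
      using f[OF that(1)] hb[OF _ that(2)] by (auto simp: P_def)
    have Y0: "Y f n t \<ge> 0" if "t \<in> K" for t
      unfolding Y_def using that fb by (intro sum_nonneg mult_nonneg_nonneg) auto
    have YB: "Y f n t \<le> (\<Sum>k<n. (1/2)^(k+1) * B)" if "t \<in> K" for t
      unfolding Y_def using that fb by (intro sum_mono mult_left_mono) auto
    obtain t0 where t0: "t0 \<in> K" using K by auto
    have "0 \<le> D h" if "h \<in> ?C n" for h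
    proof -
      have "2^n * Y f n t0 + h t0 \<le> D h" unfolding D_def
        by (rule leS[of _ "2^n * (\<Sum>k<n. (1/2)^(k+1) * B) + B"])
          (use hb that YB t0 in \<open>auto intro!: add_mono mult_left_mono\<close>)
      moreover have "0 \<le> 2^n * Y f n t0" using Y0[OF t0] by simp
      ultimately show ?thesis using hb(1)[OF that t0] by linarith
    qed
    then have bdd: "bdd_below (D ` ?C n)" by (intro bdd_belowI[of _ 0]) auto
    have ne: "?C n \<noteq> {}" using convex_combinations.single[of n n g] by auto
    have "(INF h\<in>?C n. D h) < (INF h\<in>?C n. D h) + d * (1/2)^(n+1)" using d by simp
    then obtain r where r: "r \<in> ?C n" "D r < (INF h\<in>?C n. D h) + d * (1/2)^(n+1)"
      using cINF_less_iff[OF ne bdd] by blast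
    then have "D r \<le> D h + d * (1/2)^(n+1)" if "h \<in> ?C n" for h
      using cINF_lower[OF bdd that] by linarith
    then show "\<exists>r. P f n r" using r(1) by (auto simp: P_def D_def)
  qed
  then obtain x where Px: "\<And>n. P x n (x n)" by blast
  then have x: "x n \<in> ?C n" for n by (simp add: P_def)
  have xk: "x k \<in> ?C n" if "n \<le> k" for k n
    using convex_combinations_antimono[OF x that] .
  have xb: "0 \<le> x k t" "x k t \<le> B" if "t \<in> K" for k t using hb[OF x that] by auto
  define y where "y t = (\<Sum>k. (1/2)^(k+1) * x k t)" for t
  have gs: "summable (\<lambda>k. (1/2)^(k+1) * c)" for c :: real
    by (intro summable_mult2) (auto simp: summable_geometric)
  have ub: "norm ((1/2)^(k+1) * x k t) \<le> (1/2)^(k+1) * B" if "t \<in> K" for k t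
    using xb[OF that, of k] by (simp add: mult_left_mono)
  have sm: "summable (\<lambda>k. (1/2)^(k+1) * x k t)" if "t \<in> K" for t
    by (rule summable_comparison_test'[OF gs]) (rule ub[OF that])
  have "uniform_limit K (\<lambda>n t. Y x n t) y sequentially"
    unfolding Y_def y_def by (rule Weierstrass_m_test[OF ub gs])
  moreover have "continuous_on K (Y x n)" for n
    unfolding Y_def using convex_combinations_continuous[OF x cont]
    by (intro continuous_intros) auto
  ultimately have ycont: "continuous_on K y"
    by (intro uniform_limit_theorem[of _ "\<lambda>n. Y x n"]) auto
  obtain t where t: "t \<in> K" "\<And>s. s \<in> K \<Longrightarrow> y s \<le> y t"
    using continuous_attains_sup[OF K ycont] by blast
  have Yy: "Y x n s \<le> y s" if "s \<in> K" for n s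
    unfolding Y_def y_def using xb that by (intro sum_le_suminf sm) auto
  have key: "2^n * Y x n s + x n s \<le> 2^n * y t + 2 * d * (1/2)^(n+1)" if s: "s \<in> K" for n s
  proof -
    have B: "B \<ge> 0" using xb[OF s, of 0] by linarith
    obtain j where j: "(1/2)^j < d * (1/2)^(n+1) / (B + 1)"
      using real_arch_pow_inv[of "d * (1/2)^(n+1) / (B + 1)" "1/2"] d B by auto
    define M where "M = n + Suc j"
    \<comment> \<open>The competitor for \<open>x n\<close>: a truncated version of the normalised
      tail \<open>2^n * (y - Y x n)\<close>. With it, \<open>2^n * Y x n + z\<close> is at most
      \<open>2^n * y t\<close> up to the truncation error, which the choice of \<open>j\<close>
      makes smaller than \<open>d * (1/2)^(n+1)\<close>.\<close>
    define z where "z s = (\<Sum>k\<in>{n..<M}. (1/2)^(k+1) * x k s) / (\<Sum>k\<in>{n..<M}. (1/2)^(k+1))" for s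
    have z: "z \<in> ?C n" unfolding z_def
      by (rule convex_combinations_sum[OF xk]) (auto simp: M_def)
    have w: "(\<Sum>k\<in>{n..<n + i}. (1/2::real)^(k+1)) = (1/2)^n * (1 - (1/2)^i)" for i
      by (induction i) (auto simp: power_add algebra_simps)
    have YM: "Y x M s = Y x n s + (\<Sum>k\<in>{n..<M}. (1/2)^(k+1) * x k s)" for s
      unfolding Y_def lessThan_atLeast0 by (rule sum.atLeastLessThan_concat[symmetric]) (auto simp: M_def)
    have zz: "2^n * Y x n s + z s \<le> 2^n * y t + d * (1/2)^(n+1)" if s: "s \<in> K" for s
    proof -
      have p: "(1 - (1/2)^Suc j) > (0::real)" by (simp add: power_Suc_less_one del: power_Suc)
      have "z s * ((1/2)^n * (1 - (1/2)^Suc j)) = (\<Sum>k\<in>{n..<M}. (1/2)^(k+1) * x k s)"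
        unfolding z_def M_def w using p by (simp del: power_Suc)
      then have "2^n * (Y x M s - Y x n s) = 2^n * (z s * ((1/2)^n * (1 - (1/2)^Suc j)))"
        by (simp add: YM)
      also have "\<dots> = z s * (1 - (1/2)^Suc j)" by (simp add: power_one_over)
      finally have "2^n * Y x n s + z s = 2^n * Y x M s + z s * (1/2)^Suc j"
        by (simp add: algebra_simps)
      moreover have "z s * (1/2)^Suc j \<le> (B + 1) * (1/2)^j"
        using hb[OF z s] by (intro mult_mono) auto
      moreover have "(B + 1) * (1/2)^j \<le> d * (1/2)^(n+1)"
        using j B by (simp add: pos_less_divide_eq algebra_simps)
      moreover have "2^n * Y x M s \<le> 2^n * y t"
        using Yy[OF s, of M] t(2)[OF s] by (intro mult_left_mono) auto
      ultimately show ?thesis by linarith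
    qed
    have "S (\<lambda>t. 2^n * Y x n t + x n t) \<le> S (\<lambda>t. 2^n * Y x n t + z t) + d * (1/2)^(n+1)"
      using Px[of n] z by (auto simp: P_def)
    also have "S (\<lambda>t. 2^n * Y x n t + z t) \<le> 2^n * y t + d * (1/2)^(n+1)"
      by (rule Sle[OF zz])
    finally have "S (\<lambda>t. 2^n * Y x n t + x n t) \<le> 2^n * y t + 2 * d * (1/2)^(n+1)"
      by simp
    moreover have "2^n * Y x n s + x n s \<le> S (\<lambda>t. 2^n * Y x n t + x n t)"
      by (rule leS[of _ "2^n * y t + B", OF _ s])
        (use xb order.trans[OF Yy t(2)] in \<open>auto intro!: add_mono\<close>)
    ultimately show ?thesis by linarith
  qed
  \<comment> \<open>Here \<open>2^(N+1) * Y x (N+1)\<close> is \<open>2^N * Y x N\<close> plus the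
    left side of \<open>key\<close>. Thus the normalised tail \<open>2^N * (y t - Y x N t)\<close>
    is at least \<open>y t - 2 * d\<close> for every \<open>N\<close>.\<close>
  have tel: "2^N * Y x N t \<le> (2^N - 1) * y t + 2 * d * (1 - (1/2)^N)" for N
  proof (induction N)
    case (Suc N)
    have "2^Suc N * Y x (Suc N) t = 2^N * Y x N t + (2^N * Y x N t + x N t)"
      by (simp add: Y_def algebra_simps power_one_over)
    also have "\<dots> \<le> ((2^N - 1) * y t + 2 * d * (1 - (1/2)^N)) + (2^N * y t + 2 * d * (1/2)^(N+1))"
      using Suc key[OF t(1), of N] by linarith
    also have "\<dots> = (2^Suc N - 1) * y t + 2 * d * (1 - (1/2)^Suc N)"
      by (simp add: algebra_simps)
    finally show ?case .
  qed (simp add: Y_def)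
  \<comment> \<open>Pointwise convergence at the maximum point \<open>t\<close> bounds that same
    tail by \<open>d\<close> from above.\<close>
  obtain N where N: "\<And>i. i \<ge> N \<Longrightarrow> g i t \<le> d"
    using LIMSEQ_D[OF lim[OF t(1)] d] by (auto simp: abs_le_iff) (meson less_imp_le abs_le_D1 order.trans abs_ge_self le_less_trans)
  have xN: "x k t \<le> d" if "k \<ge> N" for k
    using convex_combinations_bounds[OF x, of k 0 t d] N bnd[OF t(1)] that by auto
  have "y t - Y x N t = (\<Sum>k. (1/2)^(k+N+1) * x (k+N) t)"
    unfolding y_def Y_def using suminf_split_initial_segment[OF sm[OF t(1)], of N] by simp
  also have "\<dots> \<le> (\<Sum>k. (1/2)^(k+N+1) * d)"
  proof (rule suminf_le)
    show "summable (\<lambda>k. (1/2)^(k+N+1) * x (k+N) t)"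
      using summable_ignore_initial_segment[OF sm[OF t(1)], of N] by simp
    show "summable (\<lambda>k. (1/2)^(k+N+1) * d)"
      using summable_ignore_initial_segment[OF gs[of d], of N] by simp
  qed (use xN d in \<open>auto intro!: mult_left_mono\<close>)
  also have "\<dots> = (\<Sum>k. ((1/2)^(N+1) * d) * (1/2)^k)" by (simp add: power_add mult_ac)
  also have "\<dots> = ((1/2)^(N+1) * d) * 2" by (subst suminf_mult) (auto simp: suminf_geometric)
  finally have "2^N * (y t - Y x N t) \<le> 2^N * ((1/2)^(N+1) * d * 2)" by (intro mult_left_mono) auto
  also have "\<dots> = d" by (simp add: power_one_over)
  finally have "y t \<le> 2 * d * (1 - (1/2)^N) + d" using tel[of N] by (simp add: algebra_simps)
  also have "\<dots> \<le> 2 * d * 1 + d" using d by (intro add_mono mult_left_mono) auto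
  finally have yt: "y t \<le> 3 * d" by simp
  have "x 0 s \<le> e" if "s \<in> K" for s
    using Yy[OF that, of 1] t(2)[OF that] yt by (simp add: Y_def d_def)
  then show ?thesis using x[of 0] by blast
qed

lemma small_convex_combination:
  fixes g :: "nat \<Rightarrow> 't::topological_space \<Rightarrow> real"
  assumes K: "compact K" "K \<noteq> {}" and cont: "\<And>i. continuous_on K (g i)"
    and bnd: "\<And>i t. t \<in> K \<Longrightarrow> 0 \<le> g i t \<and> g i t \<le> B"
    and lim: "\<And>t. t \<in> K \<Longrightarrow> (\<lambda>i. g i t) \<longlonglongrightarrow> 0" and e: "e > 0"
  obtains N c where "m < N" "\<And>i. 0 \<le> c i" "(\<Sum>i\<in>{m..<N}. c i) = 1"
    "\<And>t. t \<in> K \<Longrightarrow> (\<Sum>i\<in>{m..<N}. c i * g i t) \<le> e"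
proof -
  have "\<exists>h\<in>convex_combinations (\<lambda>i. g (i + m)) 0. \<forall>t\<in>K. h t \<le> e"
    by (rule small_convex_combination_aux[OF K cont bnd _ e])
      (auto intro: LIMSEQ_ignore_initial_segment lim)
  then obtain h where h: "h \<in> convex_combinations (\<lambda>i. g (i + m)) 0" "\<And>t. t \<in> K \<Longrightarrow> h t \<le> e"
    by blast
  from convex_combinations_coefficients[OF h(1)] obtain N c where
    c: "0 < N" "\<And>i. 0 \<le> c i" "(\<Sum>i\<in>{0..<N}. c i) = 1"
     "\<And>t. h t = (\<Sum>i\<in>{0..<N}. c i * g (i + m) t)"
    by blast
  show ?thesis
  proof (rule that[of "N + m" "\<lambda>i. c (i - m)"])
    show "(\<Sum>i\<in>{m..<N + m}. c (i - m)) = 1"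
      using c(3) sum.shift_bounds_nat_ivl[of "\<lambda>i. c (i - m)" 0 m N] by simp
    show "(\<Sum>i\<in>{m..<N + m}. c (i - m) * g i t) \<le> e" if "t \<in> K" for t
      using h(2)[OF that] c(4)[of t] sum.shift_bounds_nat_ivl[of "\<lambda>i. c (i - m) * g i t" 0 m N] by simp
  qed (use c in auto)
qed

section \<open>Sequences dominating the summing basis\<close>

text \<open>Real and complex scalars are treated at once: \<open>rp\<close> is the real part, \<open>\<omega>\<close> is \<open>1\<close> or \<open>\<i>\<close>.\<close>

locale banach_real_part = banach_over sc
  for sc :: "'k::{real_normed_field, banach, heine_borel} \<Rightarrow> 'a::banach \<Rightarrow> 'a" +
  fixes rp :: "'k \<Rightarrow> real" and \<omega> :: 'k
  assumes rp: "bounded_linear rp" and rp_le: "\<bar>rp z\<bar> \<le> norm z"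
    and norm_\<omega>: "norm \<omega> = 1" and norm_le_rp: "norm z \<le> \<bar>rp z\<bar> + \<bar>rp (\<omega> * z)\<bar>"
    and represent: "linear g \<Longrightarrow> (\<And>v. \<bar>g v\<bar> \<le> norm v) \<Longrightarrow>
      \<exists>f\<in>dual sc. (\<forall>v. norm (f v) \<le> norm v) \<and> (\<forall>v. rp (f v) = g v)"
begin

section \<open>The dual ball and functionals with prescribed values\<close>

definition dual_ball :: "('a \<Rightarrow> 'k) set" where
  "dual_ball = {f \<in> dual sc. \<forall>v. norm (f v) \<le> norm v}"

abbreviation lincomb :: "(nat \<Rightarrow> 'a) \<Rightarrow> (nat \<Rightarrow> 'k) \<Rightarrow> nat \<Rightarrow> 'a" where
  "lincomb b c N \<equiv> (\<Sum>i<N. sc (c i) (b i))"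

lemma dual_linear:
  assumes "f \<in> dual sc"
  shows "f (u + v) = f u + f v" "f (u - v) = f u - f v" "f (- v) = - f v" "f 0 = 0"
    "f (sc c v) = c * f v" "f (\<Sum>i\<in>I. h i) = (\<Sum>i\<in>I. f (h i))"
proof -
  have bl: "bounded_linear f" using assms by (simp add: dual_def)
  note l = bounded_linear.linear[OF bl]
  show "f (u + v) = f u + f v" "f (u - v) = f u - f v" "f (- v) = - f v" "f 0 = 0"
    "f (\<Sum>i\<in>I. h i) = (\<Sum>i\<in>I. f (h i))"
    using l by (auto simp: linear_add linear_diff linear_neg linear_0 linear_sum)
  show "f (sc c v) = c * f v" using assms by (simp add: dual_def)
qed

lemma dual_lincomb: "f \<in> dual sc \<Longrightarrow> f (lincomb b c N) = (\<Sum>i<N. c i * f (b i))"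
  by (simp add: dual_linear)

lemma dual_tendsto: "f \<in> dual sc \<Longrightarrow> (h \<longlongrightarrow> l) F \<Longrightarrow> ((\<lambda>x. f (h x)) \<longlongrightarrow> f l) F"
  by (simp add: bounded_linear.tendsto dual_def)

lemma tendsto_sc: "(f \<longlongrightarrow> l) F \<Longrightarrow> ((\<lambda>x. sc (f x) v) \<longlongrightarrow> sc l v) F"
proof -
  assume "(f \<longlongrightarrow> l) F"
  then have "((\<lambda>x. norm (f x - l) * norm v) \<longlongrightarrow> norm (l - l) * norm v) F"
    by (intro tendsto_intros)
  then have "((\<lambda>x. norm (sc (f x) v - sc l v)) \<longlongrightarrow> 0) F"
    by (simp add: norm_scale scale_left_diff_distrib[symmetric] del: scale_left_diff_distrib)
  then show ?thesis using Lim_null tendsto_norm_zero_iff by blast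
qed

lemma lincomb_extend:
  assumes "N \<le> M"
  shows "lincomb b c N = lincomb b (\<lambda>i. if i < N then c i else 0) M"
    "(\<Sum>i<N. c i * d i) = (\<Sum>i<M. (if i < N then c i else 0) * d i)"
  using assms by (intro sum.mono_neutral_cong_left; auto)+

lemma lincomb_add: "lincomb b (\<lambda>i. c i + d i) N = lincomb b c N + lincomb b d N"
  by (simp add: scale_left_distrib sum.distrib)

lemma lincomb_diff: "lincomb b (\<lambda>i. c i - d i) N = lincomb b c N - lincomb b d N"
  by (simp add: scale_left_diff_distrib sum_subtractf)

lemma lincomb_scale: "lincomb b (\<lambda>i. a * c i) N = sc a (lincomb b c N)"
  by (simp add: scale_sum_right)

text \<open>Helly's condition. The cone is the graph of the real part of the prescribed functional
  on finite combinations; using a set of pairs avoids checking that the functional is well defined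
  when the \<open>b j\<close> are dependent.\<close>

lemma extend_functional:
  assumes a: "\<And>N c. norm (\<Sum>i<N. c i * a i) \<le> norm (lincomb b c N)"
  shows "\<exists>f\<in>dual_ball. \<forall>j. f (b j) = a j"
proof -
  interpret rp: bounded_linear rp by (rule rp)
  define G where "G = {(lincomb b c N, rp (\<Sum>i<N. c i * a i)) | c N. True}"
  have GI: "(lincomb b c N, rp (\<Sum>i<N. c i * a i)) \<in> G" for c N
    unfolding G_def by (intro CollectI exI[of _ c] exI[of _ N] conjI refl TrueI)
  have "\<exists>g. linear g \<and> (\<forall>v. \<bar>g v\<bar> \<le> norm v) \<and> (\<forall>(w, s)\<in>G. g w \<le> s)"
  proof (rule linear_functional_below_cone)
    show "(0, 0) \<in> G" using GI[of "\<lambda>_. 0" 0] by (simp add: rp.zero)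
    fix w s assume "(w, s) \<in> G"
    then obtain c N where c: "w = lincomb b c N" "s = rp (\<Sum>i<N. c i * a i)"
      unfolding G_def by blast
    show "- norm w \<le> s" using rp_le[of "\<Sum>i<N. c i * a i"] a[of c N] by (simp add: c)
    show "(t *\<^sub>R w, t * s) \<in> G" for t :: real
    proof -
      have "t *\<^sub>R w = lincomb b (\<lambda>i. of_real t * c i) N"
        by (simp add: c lincomb_scale scale_of_real[symmetric] del: scale_scale)
      moreover have "t * s = rp (\<Sum>i<N. of_real t * c i * a i)"
        by (simp add: c mult.assoc scaleR_conv_of_real[symmetric] rp.scaleR scaleR_sum_right[symmetric])
      ultimately show ?thesis using GI[of "\<lambda>i. of_real t * c i" N] by simp
    qed
    fix w' s' assume "(w', s') \<in> G"
    then obtain c' N' where c': "w' = lincomb b c' N'" "s' = rp (\<Sum>i<N'. c' i * a i)"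
      unfolding G_def by blast
    define M where "M = max N N'"
    define e where "e i = (if i < N then c i else 0) + (if i < N' then c' i else 0)" for i
    have "w + w' = lincomb b e M" unfolding e_def lincomb_add c c'
      by (intro arg_cong2[where f = "(+)"] lincomb_extend) (auto simp: M_def)
    moreover have "s + s' = rp (\<Sum>i<M. e i * a i)"
      unfolding e_def distrib_right sum.distrib rp.add c c'
      by (intro arg_cong2[where f = "(+)"] arg_cong[where f = rp] lincomb_extend) (auto simp: M_def)
    ultimately show "(w + w', s + s') \<in> G" using GI[of e M] by simp
  qed
  then obtain g where g: "linear g" "\<And>v. \<bar>g v\<bar> \<le> norm v" "\<And>w s. (w, s) \<in> G \<Longrightarrow> g w \<le> s"
    by blast
  from represent[OF g(1,2)] obtain f where
    f: "f \<in> dual sc" "\<And>v. norm (f v) \<le> norm v" "\<And>v. rp (f v) = g v" by auto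
  have "f (b j) = a j" for j
  proof -
    have le: "rp (z * f (b j)) \<le> rp (z * a j)" for z
    proof -
      have "(sc z (b j), rp (z * a j)) \<in> G" using GI[of "\<lambda>i. if i = j then z else 0" "Suc j"] by simp
      from g(3)[OF this] show ?thesis using f(3)[of "sc z (b j)"] by (simp add: dual_linear[OF f(1)])
    qed
    \<comment> \<open>The scalars \<open>z\<close> and \<open>- z\<close> together give equality of
      real parts; \<open>z = 1\<close> and \<open>z = \<omega>\<close> then control the full norm
      through \<open>norm_le_rp\<close>.\<close>
    have "rp (z * (f (b j) - a j)) = 0" for z
      using le[of z] le[of "- z"] by (simp add: rp.diff linear_neg[OF bounded_linear.linear[OF rp]] right_diff_distrib)
    then have "norm (f (b j) - a j) \<le> 0"
      using norm_le_rp[of "f (b j) - a j"] by (metis abs_zero add_0 mult_1)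
    then show ?thesis by simp
  qed
  then show ?thesis using f by (auto simp: dual_ball_def)
qed

text \<open>For a constant sequence with all prescribed values equal to \<open>norm v\<close>,
  Helly's inequality is an equality.\<close>

lemma norming_dual_functional: "\<exists>f\<in>dual_ball. f v = of_real (norm v)"
proof -
  have "norm (\<Sum>i<N. c i * of_real (norm v)) \<le> norm (lincomb (\<lambda>_. v) c N)" for N c
    by (simp add: sum_distrib_right[symmetric] norm_mult scale_sum_left[symmetric] norm_scale
        del: scale_sum_left)
  then show ?thesis using extend_functional[of "\<lambda>_. of_real (norm v)" "\<lambda>_. v"] by blast
qed

lemma dual_ball_dual: "f \<in> dual_ball \<Longrightarrow> f \<in> dual sc"
  and dual_ball_le: "f \<in> dual_ball \<Longrightarrow> norm (f v) \<le> norm v"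
  by (auto simp: dual_ball_def)

lemma dual_ball_nonempty: "dual_ball \<noteq> {}"
  using norming_dual_functional by blast

lemma weak_Cauchy_bounded:
  assumes "weak_Cauchy sc x"
  shows "bounded (range x)"
proof (rule weakly_bounded_imp_bounded)
  fix g :: "'a \<Rightarrow> real" assume "linear g" "\<And>v. \<bar>g v\<bar> \<le> norm v"
  from represent[OF this] obtain f where f: "f \<in> dual sc" "\<And>v. rp (f v) = g v" by auto
  then have "Bseq (\<lambda>j. f (x j))"
    using assms by (auto simp: weak_Cauchy_def intro: convergent_imp_Bseq)
  then obtain K where "\<And>j. norm (f (x j)) \<le> K" by (auto simp: Bseq_def)
  then have "\<bar>g (x j)\<bar> \<le> K" for j using rp_le[of "f (x j)"] f(2) by (metis order.trans)
  then show "bounded (range (\<lambda>j. g (x j)))" by (auto simp: bounded_iff)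
qed

text \<open>Rosenthal's wide-(s) sequences: basic, and dominating the summing basis.\<close>

definition wide_s :: "(nat \<Rightarrow> 'a) \<Rightarrow> real \<Rightarrow> bool" where
  "wide_s b C \<longleftrightarrow> C > 0 \<and> (\<forall>c n N. n \<le> N \<longrightarrow>
     norm (lincomb b c n) \<le> C * norm (lincomb b c N) \<and> norm (\<Sum>i<n. c i) \<le> C * norm (lincomb b c N))"

lemma span_range: "span (range b) = {lincomb b c N | c N. True}" (is "_ = ?L")
proof
  have LI: "lincomb b c N \<in> ?L" for c N by (intro CollectI exI[of _ c] exI[of _ N] conjI refl TrueI)
  have "subspace ?L"
    unfolding subspace_def
  proof (intro conjI ballI allI)
    show "0 \<in> ?L" using LI[of "\<lambda>_. 0" 0] by simp
  next
    fix u v assume "u \<in> ?L" "v \<in> ?L"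
    then obtain c N d M where "u = lincomb b c N" "v = lincomb b d M" by auto
    then have "u + v = lincomb b (\<lambda>i. (if i < N then c i else 0) + (if i < M then d i else 0)) (max N M)"
      using lincomb_extend(1)[where b = b and N = N and M = "max N M" and c = c]
        lincomb_extend(1)[where b = b and N = M and M = "max N M" and c = d]
      by (simp only: lincomb_add max.cobounded1 max.cobounded2)
    then show "u + v \<in> ?L" using LI by simp
  next
    fix a u assume "u \<in> ?L"
    then obtain c N where "u = lincomb b c N" by auto
    then have "sc a u = lincomb b (\<lambda>i. a * c i) N" by (simp only: lincomb_scale)
    then show "sc a u \<in> ?L" using LI by simp
  qed
  moreover have "b j \<in> ?L" for j using LI[of "\<lambda>i. if i = j then 1 else 0" "Suc j"] by simp
  then have "range b \<subseteq> ?L" by blast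
  ultimately show "span (range b) \<subseteq> ?L" by (intro span_minimal)
  show "?L \<subseteq> span (range b)"
    by (auto intro!: span_sum span_scale intro: span_base)
qed

text \<open>A coefficient is the difference of two consecutive coefficient sums, whence the factor
  2.\<close>

lemma wide_s_coeff:
  assumes "wide_s b C" "i < N"
  shows "norm (c i) \<le> 2 * C * norm (lincomb b c N)"
proof -
  have "norm (\<Sum>k<Suc i. c k) \<le> C * norm (lincomb b c N)" "norm (\<Sum>k<i. c k) \<le> C * norm (lincomb b c N)"
    using assms by (auto simp: wide_s_def simp del: sum.lessThan_Suc)
  moreover have "c i = (\<Sum>k<Suc i. c k) - (\<Sum>k<i. c k)" by simp
  ultimately show ?thesis
    using norm_triangle_ineq4[of "\<Sum>k<Suc i. c k" "\<Sum>k<i. c k"] by (simp del: sum.lessThan_Suc)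
qed

text \<open>The uniform bounds for partial sums and for coefficients, applied to differences of
  finite combinations tending to \<open>y\<close>, make each coefficient converge and the partial
  sums converge uniformly in their length. Uniqueness is the coefficient bound applied to an
  expansion of 0.\<close>

lemma wide_s_basic:
  assumes b: "wide_s b C"
  shows "basic_sequence sc b"
  unfolding basic_sequence_def schauder_basis_of_def
proof (intro conjI ballI)
  have C: "C > 0" using b by (simp add: wide_s_def)
  have up: "norm (lincomb b c n) \<le> C * norm (lincomb b c N)" if "n \<le> N" for c n N
    using b that by (auto simp: wide_s_def)
  show "range b \<subseteq> closed_span sc b"
    unfolding closed_span_def by (meson closure_subset order.trans span_superset)
  fix y assume "y \<in> closed_span sc b"
  then obtain yy where yy: "\<And>k. yy k \<in> span (range b)" "yy \<longlonglongrightarrow> y"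
    unfolding closed_span_def closure_sequential by blast
  have "\<exists>c N. yy k = lincomb b c N \<and> (\<forall>i\<ge>N. c i = 0)" for k
  proof -
    obtain c N where "yy k = lincomb b c N" using yy(1)[of k] by (auto simp: span_range)
    then have "yy k = lincomb b (\<lambda>i. if i < N then c i else 0) N" by simp
    then show ?thesis by (intro exI[of _ "\<lambda>i. if i < N then c i else 0"] exI[of _ N]) auto
  qed
  then obtain c N where c: "\<And>k. yy k = lincomb b (c k) (N k)" "\<And>k i. i \<ge> N k \<Longrightarrow> c k i = 0"
    by metis
  have ext: "yy k = lincomb b (c k) M" if "N k \<le> M" for k M
    unfolding c(1) by (rule sum.mono_neutral_left) (use that c(2) in auto)
  have diff: "yy k - yy l = lincomb b (\<lambda>i. c k i - c l i) M" if "N k \<le> M" "N l \<le> M" for k l M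
    using ext that by (simp add: lincomb_diff)
  have P: "norm (lincomb b (c k) n - lincomb b (c l) n) \<le> C * norm (yy k - yy l)" for k l n
  proof -
    define M where "M = max n (max (N k) (N l))"
    have "norm (lincomb b (\<lambda>i. c k i - c l i) n) \<le> C * norm (lincomb b (\<lambda>i. c k i - c l i) M)"
      by (rule up) (simp add: M_def)
    also have "lincomb b (\<lambda>i. c k i - c l i) M = yy k - yy l" by (rule diff[symmetric]) (auto simp: M_def)
    finally show ?thesis by (simp only: lincomb_diff)
  qed
  have ci: "norm (c k i - c l i) \<le> 2 * C * norm (yy k - yy l)" for k l i
  proof -
    define M where "M = max (Suc i) (max (N k) (N l))"
    have "norm (c k i - c l i) \<le> 2 * C * norm (lincomb b (\<lambda>i. c k i - c l i) M)"
      using wide_s_coeff[OF b, of i M "\<lambda>i. c k i - c l i"] by (simp add: M_def)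
    also have "lincomb b (\<lambda>i. c k i - c l i) M = yy k - yy l" by (rule diff[symmetric]) (auto simp: M_def)
    finally show ?thesis .
  qed
  have Cau: "Cauchy yy" using yy(2) by (intro convergent_Cauchy convergentI)
  have "Cauchy (\<lambda>k. c k i)" for i
  proof (rule metric_CauchyI)
    fix e :: real assume "e > 0"
    then obtain M where M: "\<forall>m\<ge>M. \<forall>n\<ge>M. dist (yy m) (yy n) < e / (2 * C)"
      using metric_CauchyD[OF Cau, of "e / (2 * C)"] C by auto
    have "dist (c m i) (c n i) < e" if "m \<ge> M" "n \<ge> M" for m n
      using ci[of m i n] M[rule_format, OF that] C by (simp add: dist_norm field_simps)
    then show "\<exists>M. \<forall>m\<ge>M. \<forall>n\<ge>M. dist (c m i) (c n i) < e" by blast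
  qed
  then obtain d where d: "\<And>i. (\<lambda>k. c k i) \<longlonglongrightarrow> d i"
    unfolding Cauchy_convergent_iff convergent_def by metis
  have Pd: "norm (lincomb b (c k) n - lincomb b d n) \<le> C * norm (yy k - y)" for k n
  proof (rule LIMSEQ_le)
    show "(\<lambda>l. norm (lincomb b (c k) n - lincomb b (c l) n)) \<longlonglongrightarrow> norm (lincomb b (c k) n - lincomb b d n)"
      by (intro tendsto_intros tendsto_sc d)
    show "(\<lambda>l. C * norm (yy k - yy l)) \<longlonglongrightarrow> C * norm (yy k - y)"
      by (intro tendsto_intros yy)
    show "\<exists>N. \<forall>l\<ge>N. norm (lincomb b (c k) n - lincomb b (c l) n) \<le> C * norm (yy k - yy l)"
      using P by blast
  qed
  have sums: "(\<lambda>j. sc (d j) (b j)) sums y"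
    unfolding sums_def
  proof (rule metric_LIMSEQ_I)
    fix e :: real assume "e > 0"
    then obtain k where k: "dist (yy k) y < e / (C + 1)"
      using metric_LIMSEQ_D[OF yy(2), of "e / (C + 1)"] C by auto
    have "dist (lincomb b d n) y < e" if "n \<ge> N k" for n
    proof -
      have "dist (lincomb b d n) y \<le> norm (lincomb b (c k) n - lincomb b d n) + norm (yy k - y)"
        using ext[OF that] norm_triangle_ineq4[of "yy k - y" "lincomb b (c k) n - lincomb b d n"]
        by (simp add: dist_norm norm_minus_commute algebra_simps)
      also have "\<dots> \<le> (C + 1) * norm (yy k - y)" using Pd[of k n] by (simp add: algebra_simps)
      also have "\<dots> < e" using k C by (simp add: dist_norm field_simps)
      finally show ?thesis .
    qed
    then show "\<exists>M. \<forall>n\<ge>M. dist (lincomb b d n) y < e" by blast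
  qed
  show "\<exists>!c. (\<lambda>j. sc (c j) (b j)) sums y"
  proof (rule ex1I[of _ d])
    fix d' assume "(\<lambda>j. sc (d' j) (b j)) sums y"
    from sums_diff[OF this sums] have "(\<lambda>n. lincomb b (\<lambda>j. d' j - d j) n) \<longlonglongrightarrow> 0"
      by (simp add: sums_def scale_left_diff_distrib)
    then have lim: "(\<lambda>n. 2 * C * norm (lincomb b (\<lambda>j. d' j - d j) n)) \<longlonglongrightarrow> 0"
      using tendsto_mult_right_zero tendsto_norm_zero by blast
    have "norm (d' i - d i) \<le> 0" for i
    proof (rule LIMSEQ_le_const[OF lim])
      show "\<exists>N. \<forall>n\<ge>N. norm (d' i - d i) \<le> 2 * C * norm (lincomb b (\<lambda>j. d' j - d j) n)"
        using wide_s_coeff[OF b, of i _ "\<lambda>j. d' j - d j"] by (intro exI[of _ "Suc i"]) auto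
    qed
    then show "d' = d" by auto
  qed (rule sums)
qed

end

section \<open>The summing space and a criterion for equivalence with its basis\<close>

lemma coord_sum: "coord (\<Sum>i\<in>I. h i) j = (\<Sum>i\<in>I. coord (h i) j)"
  by (induction I rule: infinite_finite_induct)
    (auto simp: zero_summing_space.rep_eq plus_summing_space.rep_eq)

lemma coord_truncation:
  "coord (\<Sum>i<n. scale_summing_space (coord v i) (summing_basis i)) j = (if j < n then coord v j else 0)"
proof -
  have "coord (\<Sum>i<n. scale_summing_space (coord v i) (summing_basis i)) j =
      (\<Sum>i<n. if i = j then coord v j else 0)"
    unfolding coord_sum by (intro sum.cong) (auto simp: scale_summing_space.rep_eq summing_basis.rep_eq)
  then show ?thesis by simp
qed

lemma partial_sums_Cauchy:
  assumes "summable (c :: nat \<Rightarrow> 'k::{real_normed_field, banach})" "e > 0"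
  obtains M where "\<And>m n. m \<ge> M \<Longrightarrow> norm (\<Sum>i\<in>{m..<n}. c i) < e"
  using assms unfolding summable_Cauchy by blast

lemma summing_basis_expansion:
  fixes v :: "'k::{real_normed_field, banach} summing_space"
  shows "(\<lambda>n. \<Sum>i<n. scale_summing_space (coord v i) (summing_basis i)) \<longlonglongrightarrow> v"
proof (rule LIMSEQ_I)
  fix e :: real assume e: "e > 0"
  obtain M where M: "\<And>m n. m \<ge> M \<Longrightarrow> norm (\<Sum>i\<in>{m..<n}. coord v i) < e / 2"
    using partial_sums_Cauchy[OF summable_coord, of "e / 2"] e by auto
  have "norm ((\<Sum>i<n. scale_summing_space (coord v i) (summing_basis i)) - v) \<le> e / 2" if "n \<ge> M" for n
  proof (rule norm_summing_space_le)
    fix p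
    have "(\<Sum>j\<le>p. coord ((\<Sum>i<n. scale_summing_space (coord v i) (summing_basis i)) - v) j) =
      (\<Sum>j\<le>p. if n \<le> j then - coord v j else 0)"
      by (intro sum.cong) (auto simp: minus_summing_space.rep_eq coord_truncation)
    also have "\<dots> = (\<Sum>j\<in>{n..<Suc p}. - coord v j)"
      by (intro sum.mono_neutral_cong_right) auto
    finally show "norm (\<Sum>j\<le>p. coord ((\<Sum>i<n. scale_summing_space (coord v i) (summing_basis i)) - v) j) \<le> e / 2"
      using M[OF that, of "Suc p"] by (simp only: sum_negf norm_minus_cancel less_imp_le)
  qed
  then show "\<exists>M. \<forall>n\<ge>M. norm ((\<Sum>i<n. scale_summing_space (coord v i) (summing_basis i)) - v) < e"
    using e by (intro exI[of _ M]) (smt (verit) field_sum_of_halves)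
qed

lemma closed_span_summing_basis:
  "closed_span scale_summing_space (summing_basis :: nat \<Rightarrow> 'k::{real_normed_field, banach} summing_space) = UNIV"
proof -
  interpret banach_over "scale_summing_space :: 'k \<Rightarrow> _" by (rule banach_over_summing_space)
  have "(\<Sum>i<n. scale_summing_space (coord v i) (summing_basis i)) \<in> span (range summing_basis)" for n
    and v :: "'k summing_space"
    by (intro span_sum span_scale span_base) simp
  then have "v \<in> closed_span scale_summing_space summing_basis" for v :: "'k summing_space"
    unfolding closed_span_def closure_sequential
    by (intro exI[of _ "\<lambda>n. \<Sum>i<n. scale_summing_space (coord v i) (summing_basis i)"] conjI allI
        summing_basis_expansion)
  then show ?thesis by blast
qed

context banach_real_part
begin

text \<open>The synthesis map \<open>S\<close>, sending coefficients to the sum of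
  \<open>sc (c i) (u i)\<close>, is bounded by \<open>D\<close> and bounded below by
  \<open>1 / C\<close>. It is onto the closed span because an expansion there has Cauchy coefficient
  sums, by domination of the summing basis. The required isomorphism is its inverse.\<close>

lemma equivalent_to_summing_basis:
  assumes u: "wide_s u C"
    and up: "\<And>c N K. (\<And>n. n \<le> N \<Longrightarrow> norm (\<Sum>i<n. c i) \<le> K) \<Longrightarrow> norm (lincomb u c N) \<le> D * K"
  shows "equivalent_sequences sc u scale_summing_space (summing_basis :: nat \<Rightarrow> 'k summing_space)"
proof -
  have C: "C > 0" using u by (simp add: wide_s_def)
  have low: "norm (\<Sum>i<n. c i) \<le> C * norm (lincomb u c N)" if "n \<le> N" for c n N
    using u that by (auto simp: wide_s_def)
  have D: "D \<ge> 0" using order.trans[OF norm_ge_zero up[of 0 "\<lambda>_. 0" 1]] by simp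
  have blk: "norm (\<Sum>i\<in>{m..<n}. sc (c i) (u i)) \<le> D * K"
    if K: "\<And>p. norm (\<Sum>i\<in>{m..<p}. c i) \<le> K" for c m n K
  proof -
    define c' where "c' i = (if m \<le> i then c i else 0)" for i
    have "norm (\<Sum>i<p. c' i) \<le> K" for p
    proof -
      have "(\<Sum>i<p. c' i) = (\<Sum>i\<in>{m..<p}. c i)"
        unfolding c'_def by (intro sum.mono_neutral_cong_right) auto
      then show ?thesis using K by simp
    qed
    then have "norm (lincomb u c' n) \<le> D * K" by (intro up)
    also have "lincomb u c' n = (\<Sum>i\<in>{m..<n}. sc (c i) (u i))"
      unfolding c'_def by (intro sum.mono_neutral_cong_right) auto
    finally show ?thesis .
  qed
  have sm: "summable (\<lambda>i. sc (c i) (u i))" if "summable c" for c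
    unfolding summable_Cauchy
  proof (intro allI impI)
    fix e :: real assume e: "e > 0"
    then have "e / (D + 1) > 0" using D by simp
    from partial_sums_Cauchy[OF that this] obtain M where
      M: "\<And>m n. m \<ge> M \<Longrightarrow> norm (\<Sum>i\<in>{m..<n}. c i) < e / (D + 1)" by metis
    have "norm (\<Sum>i\<in>{m..<n}. sc (c i) (u i)) < e" if "m \<ge> M" for m n
    proof -
      have "norm (\<Sum>i\<in>{m..<n}. sc (c i) (u i)) \<le> D * (e / (D + 1))"
        by (rule blk) (use M[OF that] less_imp_le in blast)
      also have "\<dots> < e" using e D by (simp add: field_simps)
      finally show ?thesis .
    qed
    then show "\<exists>N. \<forall>m\<ge>N. \<forall>n. norm (\<Sum>i\<in>{m..<n}. sc (c i) (u i)) < e" by blast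
  qed
  define S where "S v = (\<Sum>i. sc (coord v i) (u i))" for v :: "'k summing_space"
  have Ssums: "(\<lambda>i. sc (coord v i) (u i)) sums S v" for v
    unfolding S_def by (rule summable_sums[OF sm[OF summable_coord]])
  then have Slim: "(\<lambda>n. lincomb u (coord v) n) \<longlonglongrightarrow> S v" for v by (simp add: sums_def)
  have Suniq: "S v = y" if "(\<lambda>i. sc (coord v i) (u i)) sums y" for v y
    using sums_unique2[OF Ssums that] .
  have Sadd: "S (v + w) = S v + S w" for v w
    by (rule Suniq) (use sums_add[OF Ssums Ssums, of v w] in
      \<open>simp add: plus_summing_space.rep_eq scale_left_distrib\<close>)
  have Sscale: "S (scale_summing_space a v) = sc a (S v)" for a v
  proof (rule Suniq)
    have "(\<lambda>n. norm (sc a (lincomb u (coord v) n - S v))) \<longlonglongrightarrow> 0"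
      unfolding norm_scale using tendsto_mult_right_zero tendsto_norm_zero LIM_zero[OF Slim] by blast
    then have "(\<lambda>n. sc a (lincomb u (coord v) n)) \<longlonglongrightarrow> sc a (S v)"
      using Lim_null tendsto_norm_zero_iff by (fastforce simp: scale_right_diff_distrib)
    then show "(\<lambda>i. sc (coord (scale_summing_space a v) i) (u i)) sums sc a (S v)"
      by (simp add: sums_def scale_summing_space.rep_eq scale_sum_right)
  qed
  have Sup: "norm (S v) \<le> D * norm v" for v
  proof (rule LIMSEQ_le_const2[OF tendsto_norm[OF Slim]], intro exI allI impI)
    fix n show "norm (lincomb u (coord v) n) \<le> D * norm v"
    proof (rule up)
      fix m show "norm (\<Sum>i<m. coord v i) \<le> norm v"
        using norm_partial_sum_le[of v "m - 1"] by (cases m) (auto simp: lessThan_Suc_atMost)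
    qed
  qed
  have Slow: "norm v \<le> C * norm (S v)" for v
  proof (rule norm_summing_space_le)
    fix n
    show "norm (\<Sum>j\<le>n. coord v j) \<le> C * norm (S v)"
    proof (rule LIMSEQ_le_const[OF tendsto_mult_left[OF tendsto_norm[OF Slim]]], intro exI allI impI)
      fix N assume "Suc n \<le> N"
      then show "norm (\<Sum>j\<le>n. coord v j) \<le> C * norm (lincomb u (coord v) N)"
        using low[of "Suc n" N "coord v"] by (simp only: lessThan_Suc_atMost)
    qed
  qed
  have Sb: "S (summing_basis j) = u j" for j
  proof (rule Suniq)
    have "(\<lambda>i. sc (coord (summing_basis j :: 'k summing_space) i) (u i)) = (\<lambda>i. if i = j then u i else 0)"
      by (auto simp: summing_basis.rep_eq)
    then show "(\<lambda>i. sc (coord (summing_basis j :: 'k summing_space) i) (u i)) sums u j"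
      using sums_single[of j u] by simp
  qed
  have Sneg: "S (v - w) = S v - S w" for v w
    using Sadd[of "v - w" w] by simp
  have inj: "inj S"
  proof (rule injI)
    fix v w assume "S v = S w"
    then have "norm (v - w) \<le> 0" using Slow[of "v - w"] by (simp add: Sneg)
    then show "v = w" by simp
  qed
  have "S v \<in> closed_span sc u" for v
    unfolding closed_span_def closure_sequential
  proof (intro exI conjI)
    show "\<forall>n. lincomb u (coord v) n \<in> span (range u)"
      by (intro allI span_sum span_scale span_base) simp
  qed (rule Slim)
  moreover have "y \<in> range S" if "y \<in> closed_span sc u" for y
  proof -
    have "\<exists>!c. (\<lambda>i. sc (c i) (u i)) sums y"
      using wide_s_basic[OF u] that by (simp add: basic_sequence_def schauder_basis_of_def)
    then obtain c where c: "(\<lambda>i. sc (c i) (u i)) sums y" by (elim ex1E)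
    have "summable c"
      unfolding summable_Cauchy
    proof (intro allI impI)
      fix e :: real assume "e > 0"
      then have "e / C > 0" using C by simp
      then obtain M where M: "\<And>m n. m \<ge> M \<Longrightarrow> norm (\<Sum>i\<in>{m..<n}. sc (c i) (u i)) < e / C"
        using sums_summable[OF c, unfolded summable_Cauchy] by blast
      have "norm (\<Sum>i\<in>{m..<n}. c i) < e" if "m \<ge> M" for m n
      proof -
        define c' where "c' i = (if m \<le> i then c i else 0)" for i
        have eq: "(\<Sum>i<n. c' i) = (\<Sum>i\<in>{m..<n}. c i)" "lincomb u c' n = (\<Sum>i\<in>{m..<n}. sc (c i) (u i))"
          unfolding c'_def by (intro sum.mono_neutral_cong_right; auto)+
        show ?thesis
          using low[of n n c'] M[OF that, of n] C unfolding eq by (simp add: field_simps)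
      qed
      then show "\<exists>N. \<forall>m\<ge>N. \<forall>n. norm (\<Sum>i\<in>{m..<n}. c i) < e" by blast
    qed
    then have "S (Abs_summing_space c) = y"
      by (intro Suniq) (simp add: Abs_summing_space_inverse c)
    then show ?thesis by blast
  qed
  ultimately have ran: "range S = closed_span sc u" by blast
  define T where "T = inv S"
  have TS: "T (S v) = v" for v unfolding T_def using inj by simp
  have Tex: "\<exists>w. v = S w" if "v \<in> closed_span sc u" for v using that ran by auto
  have bij: "bij_betw T (closed_span sc u) UNIV"
    unfolding bij_betw_def
  proof
    show "inj_on T (closed_span sc u)" by (rule inj_onI) (metis Tex TS)
    show "T ` closed_span sc u = UNIV" unfolding ran[symmetric] image_image TS by simp
  qed
  have invT: "inv_into (closed_span sc u) T w = S w" for w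
    by (rule inv_into_f_eq) (use bij ran TS in \<open>auto simp: bij_betw_def\<close>)
  have "isomorphism_between sc (closed_span sc u) scale_summing_space UNIV T"
    unfolding isomorphism_between_def
  proof (intro conjI ballI allI)
    fix v w assume "v \<in> closed_span sc u" "w \<in> closed_span sc u"
    then show "T (v + w) = T v + T w" by (metis Tex TS Sadd)
  next
    fix a v assume "v \<in> closed_span sc u"
    then show "T (sc a v) = scale_summing_space a (T v)" by (metis Tex TS Sscale)
  next
    show "\<exists>K. \<forall>v\<in>closed_span sc u. norm (T v) \<le> K * norm v"
      by (intro exI[of _ C] ballI) (metis Tex TS Slow)
    show "\<exists>K. \<forall>w\<in>UNIV. norm (inv_into (closed_span sc u) T w) \<le> K * norm w"
      unfolding invT using Sup by blast
  qed (rule bij)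
  then show ?thesis
    unfolding equivalent_sequences_def closed_span_summing_basis using TS Sb by metis
qed

end

section \<open>The weak-star limit in the bidual and the extraction of a wide-(s)
  subsequence\<close>

lemma compact_bounded_sequences: "compact {q :: nat \<Rightarrow> 'k::{heine_borel, real_normed_vector}. \<forall>i. norm (q i) \<le> \<rho>}"
proof -
  have "compactin (product_topology (\<lambda>_. euclidean) UNIV) (PiE UNIV (\<lambda>_::nat. cball (0::'k) \<rho>))"
    by (subst compactin_PiE) auto
  moreover have "PiE UNIV (\<lambda>_::nat. cball (0::'k) \<rho>) = {q. \<forall>i. norm (q i) \<le> \<rho>}"
    by (auto simp: PiE_def Pi_def)
  ultimately show ?thesis
    by (simp add: euclidean_product_topology)
qed

lemma tendsto_coordinate:
  fixes q :: "'b \<Rightarrow> nat \<Rightarrow> 'k::topological_space"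
  shows "(q \<longlongrightarrow> l) F \<Longrightarrow> ((\<lambda>x. q x i) \<longlongrightarrow> l i) F"
  by (rule continuous_on_tendsto_compose[OF continuous_on_product_coordinates[of i]]) auto

locale nontrivial_weak_Cauchy_sequence = banach_real_part sc rp \<omega>
  for sc :: "'k::{real_normed_field, banach, heine_borel} \<Rightarrow> 'a::banach \<Rightarrow> 'a" and rp \<omega> +
  fixes x :: "nat \<Rightarrow> 'a"
  assumes nontrivial: "nontrivial_weak_Cauchy sc x"
begin

lemma weak_Cauchy_x: "weak_Cauchy sc x"
  using nontrivial by (simp add: nontrivial_weak_Cauchy_def)

definition wlim where "wlim f = lim (\<lambda>j. f (x j))"

lemma wlim: "f \<in> dual sc \<Longrightarrow> (\<lambda>j. f (x j)) \<longlonglongrightarrow> wlim f"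
  using weak_Cauchy_x by (simp add: wlim_def weak_Cauchy_def convergent_LIMSEQ_iff)

definition R where "R = (SUP j. norm (x j))"

lemma norm_x_le: "norm (x j) \<le> R"
  unfolding R_def using weak_Cauchy_bounded[OF weak_Cauchy_x]
  by (intro cSUP_upper) (auto simp: bounded_iff bdd_above_def)

lemma R_nonneg: "R \<ge> 0"
  using norm_x_le[of 0] norm_ge_zero order.trans by blast

lemma norm_wlim_le: "f \<in> dual_ball \<Longrightarrow> norm (wlim f) \<le> R"
  by (rule LIMSEQ_le_const2[OF tendsto_norm[OF wlim]])
    (auto intro: dual_ball_dual order.trans[OF dual_ball_le norm_x_le])

text \<open>The norm of \<open>v + s x\<^sup>*\<^sup>*\<close> in the bidual, where \<open>x\<^sup>*\<^sup>*\<close> is the weak-star limit of \<open>x\<close>.\<close>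

definition bidual_norm :: "'a \<Rightarrow> 'k \<Rightarrow> real" where
  "bidual_norm v s = (SUP f\<in>dual_ball. norm (f v + s * wlim f))"

lemma norm_dual_ball_le:
  assumes "f \<in> dual_ball"
  shows "norm (f v + s * wlim f) \<le> norm v + norm s * R"
proof -
  have "norm (f v + s * wlim f) \<le> norm (f v) + norm s * norm (wlim f)"
    by (metis norm_mult norm_triangle_ineq)
  also have "\<dots> \<le> norm v + norm s * R"
    using assms by (intro add_mono mult_left_mono dual_ball_le norm_wlim_le) auto
  finally show ?thesis .
qed

lemma bidual_norm_upper: "f \<in> dual_ball \<Longrightarrow> norm (f v + s * wlim f) \<le> bidual_norm v s"
  unfolding bidual_norm_def
  by (rule cSUP_upper) (auto intro!: bdd_aboveI2[of _ _ "norm v + norm s * R"] norm_dual_ball_le)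

lemma bidual_norm_least: "(\<And>f. f \<in> dual_ball \<Longrightarrow> norm (f v + s * wlim f) \<le> K) \<Longrightarrow> bidual_norm v s \<le> K"
  unfolding bidual_norm_def using dual_ball_nonempty by (intro cSUP_least)

lemma bidual_norm_le: "bidual_norm v s \<le> norm v + norm s * R"
  by (rule bidual_norm_least[OF norm_dual_ball_le])

lemma bidual_norm_nonneg: "0 \<le> bidual_norm v s"
  using dual_ball_nonempty bidual_norm_upper norm_ge_zero order.trans by (metis all_not_in_conv)

lemma bidual_norm_0: "bidual_norm v 0 = norm v"
proof (rule antisym)
  show "bidual_norm v 0 \<le> norm v" using bidual_norm_le[of v 0] by simp
  obtain f where "f \<in> dual_ball" "f v = of_real (norm v)" using norming_dual_functional by blast
  then show "norm v \<le> bidual_norm v 0" using bidual_norm_upper[of f v 0] by simp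
qed

lemma bidual_norm_add: "bidual_norm (v + w) (s + t) \<le> bidual_norm v s + bidual_norm w t"
proof (rule bidual_norm_least)
  fix f assume f: "f \<in> dual_ball"
  have "f (v + w) + (s + t) * wlim f = (f v + s * wlim f) + (f w + t * wlim f)"
    by (simp add: dual_linear[OF dual_ball_dual[OF f]] algebra_simps)
  then show "norm (f (v + w) + (s + t) * wlim f) \<le> bidual_norm v s + bidual_norm w t"
    using bidual_norm_upper[OF f, of v s] bidual_norm_upper[OF f, of w t]
      norm_triangle_ineq[of "f v + s * wlim f" "f w + t * wlim f"] by simp
qed

lemma bidual_norm_scale: "bidual_norm (sc a v) (a * s) = norm a * bidual_norm v s"
proof -
  have le: "bidual_norm (sc a v) (a * s) \<le> norm a * bidual_norm v s" for a v s
  proof (rule bidual_norm_least)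
    fix f assume f: "f \<in> dual_ball"
    have "f (sc a v) + a * s * wlim f = a * (f v + s * wlim f)"
      by (simp add: dual_linear[OF dual_ball_dual[OF f]] algebra_simps)
    then show "norm (f (sc a v) + a * s * wlim f) \<le> norm a * bidual_norm v s"
      using bidual_norm_upper[OF f, of v s] by (simp add: norm_mult mult_left_mono)
  qed
  show ?thesis
  proof (cases "a = 0")
    case True
    then show ?thesis using bidual_norm_0[of 0] by simp
  next
    case False
    have "bidual_norm v s = bidual_norm (sc (inverse a) (sc a v)) (inverse a * (a * s))"
      using False by (simp add: mult.assoc[symmetric])
    also have "\<dots> \<le> norm (inverse a) * bidual_norm (sc a v) (a * s)" by (rule le)
    finally have "norm a * bidual_norm v s \<le> norm a * (norm (inverse a) * bidual_norm (sc a v) (a * s))"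
      by (intro mult_left_mono) auto
    then have "norm a * bidual_norm v s \<le> bidual_norm (sc a v) (a * s)"
      using False by (simp add: mult.assoc[symmetric] norm_mult[symmetric])
    then show ?thesis using le[of a v s] by simp
  qed
qed

lemma bidual_norm_perturb: "bidual_norm v s \<le> bidual_norm w t + norm (v - w) + norm (s - t) * R"
  using bidual_norm_add[of w "v - w" t "s - t"] bidual_norm_le[of "v - w" "s - t"] by simp

text \<open>The distance of \<open>x\<^sup>*\<^sup>*\<close> to the space is positive.\<close>

lemma bidual_norm_bounds_scalar: "\<exists>d>0. \<forall>v s. d * norm s \<le> bidual_norm v s"
proof -
  have "\<exists>d>0. \<forall>v. d \<le> bidual_norm v 1"
  proof (rule ccontr)
    assume "\<not> ?thesis"
    then have "\<exists>v. bidual_norm v 1 < inverse (real (Suc k))" for k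
      by (metis inverse_positive_iff_positive not_le of_nat_0_less_iff zero_less_Suc)
    \<comment> \<open>The vectors \<open>- e k\<close> approach the weak-star limit in norm. By
      completeness that limit would be a vector \<open>- l\<close> of the space, and
      \<open>x\<close> would converge weakly to it.\<close>
    then obtain e where e: "\<And>k. bidual_norm (e k) 1 < inverse (real (Suc k))" by metis
    have neg: "bidual_norm (- v) (- 1) = bidual_norm v 1" for v
      using bidual_norm_scale[of "- 1" v 1] by simp
    have ee: "norm (e k - e l) \<le> inverse (real (Suc k)) + inverse (real (Suc l))" for k l
      using bidual_norm_add[of "e k" "- e l" 1 "- 1"] e[of k] e[of l] neg[of "e l"]
      by (simp add: bidual_norm_0)
    have "Cauchy e"
    proof (rule metric_CauchyI)
      fix r :: real assume "r > 0"
      then obtain n where n: "inverse (real (Suc n)) < r / 2" using reals_Archimedean[of "r/2"] by auto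
      have "dist (e k) (e l) < r" if "k \<ge> n" "l \<ge> n" for k l
      proof -
        have "inverse (real (Suc k)) \<le> inverse (real (Suc n))" "inverse (real (Suc l)) \<le> inverse (real (Suc n))"
          using that by (auto intro!: le_imp_inverse_le)
        then show ?thesis unfolding dist_norm using ee[of k l] n by linarith
      qed
      then show "\<exists>M. \<forall>m\<ge>M. \<forall>n\<ge>M. dist (e m) (e n) < r" by blast
    qed
    then obtain l where l: "e \<longlonglongrightarrow> l" using Cauchy_convergent convergent_def by blast
    have ball: "wlim f = f (- l)" if f: "f \<in> dual_ball" for f
    proof -
      note fd = dual_ball_dual[OF f]
      have "(\<lambda>k. norm (f (e k) + 1 * wlim f)) \<longlonglongrightarrow> norm (f l + 1 * wlim f)"
        by (intro tendsto_intros dual_tendsto[OF fd l])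
      moreover have "(\<lambda>k. norm (f (e k) + 1 * wlim f)) \<longlonglongrightarrow> 0"
      proof (rule tendsto_sandwich[OF _ _ tendsto_const LIMSEQ_inverse_real_of_nat])
        show "\<forall>\<^sub>F k in sequentially. norm (f (e k) + 1 * wlim f) \<le> inverse (real (Suc k))"
          using order.trans[OF bidual_norm_upper[OF f] less_imp_le[OF e]] by (intro always_eventually allI)
      qed simp
      ultimately have "norm (f l + 1 * wlim f) = 0" by (rule LIMSEQ_unique)
      then show ?thesis by (simp add: dual_linear[OF fd] eq_neg_iff_add_eq_0 add.commute)
    qed
    have "(\<lambda>j. f (x j)) \<longlonglongrightarrow> f (- l)" if f: "f \<in> dual sc" for f
    proof -
      have "bounded_linear f" using f by (simp add: dual_def)
      then obtain K where K: "K > 0" "\<And>v. norm (f v) \<le> norm v * K"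
        using bounded_linear.pos_bounded by metis
      \<comment> \<open>The limit has been identified on the dual ball only, so a general functional
        is scaled into it.\<close>
      define g where "g v = of_real (inverse K) * f v" for v
      have "bounded_linear g" unfolding g_def
        using f by (intro bounded_linear_const_mult) (simp add: dual_def)
      moreover have "norm (g v) \<le> norm v" for v
      proof -
        have "norm (g v) = inverse K * norm (f v)" using K by (simp add: g_def norm_mult norm_inverse)
        also have "\<dots> \<le> inverse K * (norm v * K)" using K by (intro mult_left_mono) auto
        also have "\<dots> = norm v" using K by simp
        finally show ?thesis .
      qed
      ultimately have "g \<in> dual_ball"
        using f by (simp add: dual_ball_def dual_def g_def mult.left_commute)
      then have "(\<lambda>j. g (x j)) \<longlonglongrightarrow> g (- l)" using wlim[of g] ball[of g] dual_ball_dual by simp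
      then have "(\<lambda>j. of_real K * g (x j)) \<longlonglongrightarrow> of_real K * g (- l)" by (intro tendsto_intros)
      moreover have "of_real K * g v = f v" for v
        using K by (simp add: g_def mult.assoc[symmetric] of_real_mult[symmetric] del: of_real_mult)
      ultimately show ?thesis by simp
    qed
    then have "weakly_convergent sc x" unfolding weakly_convergent_def by blast
    then show False using nontrivial by (simp add: nontrivial_weak_Cauchy_def)
  qed
  then obtain d where d: "d > 0" "\<And>v. d \<le> bidual_norm v 1" by blast
  have "d * norm s \<le> bidual_norm v s" for v s
  proof (cases "s = 0")
    case True
    then show ?thesis by (simp add: bidual_norm_nonneg)
  next
    case False
    then have "bidual_norm v s = norm s * bidual_norm (sc (inverse s) v) 1"
      using bidual_norm_scale[of s "sc (inverse s) v" 1] by simp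
    then show ?thesis
      using mult_left_mono[OF d(2)[of "sc (inverse s) v"], of "norm s"] by (simp add: mult.commute)
  qed
  then show ?thesis using d(1) by blast
qed

text \<open>Otherwise normalised counterexamples with \<open>j \<rightarrow> \<infinity>\<close> would have a limit of norm \<open>1\<close> on which every
  functional in the dual ball is at most \<open>1 / \<theta>\<close>.\<close>

lemma selection_step:
  fixes b :: "nat \<Rightarrow> 'a"
  assumes L: "\<And>c s i. i < n \<Longrightarrow> norm (c i) \<le> L * bidual_norm (lincomb b c n) s" and th: "\<theta> > 1"
  shows "\<exists>j0. \<forall>j\<ge>j0. \<forall>c s t. bidual_norm (lincomb b c n) s
    \<le> \<theta> * bidual_norm (lincomb b c n + sc t (x j)) (s - t)"
proof (rule ccontr)
  assume "\<not> ?thesis"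
  then have *: "\<exists>j\<ge>j0. \<exists>c s t. \<theta> * bidual_norm (lincomb b c n + sc t (x j)) (s - t)
      < bidual_norm (lincomb b c n) s" for j0 unfolding not_le[symmetric] by blast
  define P where "P k j c s t \<longleftrightarrow> j \<ge> k \<and> \<theta> * bidual_norm (lincomb b c n + sc t (x j)) (s - t)
      < bidual_norm (lincomb b c n) s" for k j c s t
  have "\<forall>k. \<exists>j c s t. P k j c s t" unfolding P_def using * by blast
  then obtain J c s t where "\<And>k. P k (J k) (c k) (s k) (t k)" by metis
  then have J: "J k \<ge> k" and
    less: "\<theta> * bidual_norm (lincomb b (c k) n + sc (t k) (x (J k))) (s k - t k)
      < bidual_norm (lincomb b (c k) n) (s k)" for k by (auto simp: P_def)
  obtain d where d: "d > 0" "\<And>v s. d * norm s \<le> bidual_norm v s"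
    using bidual_norm_bounds_scalar by blast
  have sd: "norm s \<le> bidual_norm v s / d" for v s using d by (simp add: field_simps)
  define A where "A k = bidual_norm (lincomb b (c k) n) (s k)" for k
  have A: "A k > 0" for k
    using less[of k] th bidual_norm_nonneg[of "lincomb b (c k) n + sc (t k) (x (J k))" "s k - t k"]
    unfolding A_def by (meson le_less_trans mult_nonneg_nonneg less_imp_le zero_less_one order.trans)
  define z where "z k = (of_real (inverse (A k)) :: 'k)" for k
  define c' where "c' k i = z k * c k i" for k i
  define s' where "s' k = z k * s k" for k
  define t' where "t' k = z k * t k" for k
  have nz: "norm (z k) = inverse (A k)" for k using A[of k] by (simp add: z_def norm_inverse)
  have sc1: "lincomb b (c' k) n = sc (z k) (lincomb b (c k) n)" for k
    unfolding c'_def by (rule lincomb_scale)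
  have one: "bidual_norm (lincomb b (c' k) n) (s' k) = 1" for k
    unfolding sc1 s'_def bidual_norm_scale nz using A[of k] by (simp add: A_def)
  have less1: "bidual_norm (lincomb b (c' k) n + sc (t' k) (x (J k))) (s' k - t' k) \<le> 1 / \<theta>" for k
  proof -
    have "bidual_norm (lincomb b (c' k) n + sc (t' k) (x (J k))) (s' k - t' k) =
       bidual_norm (sc (z k) (lincomb b (c k) n + sc (t k) (x (J k)))) (z k * (s k - t k))"
      unfolding sc1 s'_def t'_def by (simp add: scale_right_distrib right_diff_distrib)
    also have "\<dots> = inverse (A k) * bidual_norm (lincomb b (c k) n + sc (t k) (x (J k))) (s k - t k)"
      unfolding bidual_norm_scale nz ..
    also have "\<dots> \<le> 1 / \<theta>" using less[of k] A[of k] th unfolding A_def[symmetric]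
      by (simp add: field_simps)
    finally show ?thesis .
  qed
  \<comment> \<open>Normalised, \<open>s'\<close> and \<open>s' - t'\<close> are each bounded by
    \<open>1 / d\<close>, which bounds \<open>t'\<close> by \<open>2 / d\<close>; the coefficients
    are bounded through \<open>L\<close>.\<close>
  define \<rho> where "\<rho> = max \<bar>L\<bar> (2 / d)"
  have "1 / \<theta> \<le> 1" using th by simp
  then have st: "norm (s' k - t' k) \<le> 1 / d" for k
    using sd[of "s' k - t' k" "lincomb b (c' k) n + sc (t' k) (x (J k))"] less1[of k] d
    by (meson divide_right_mono less_imp_le order.trans)
  have s1: "norm (s' k) \<le> 1 / d" for k using sd[of "s' k" "lincomb b (c' k) n"] one[of k] by simp
  \<comment> \<open>Both scalars and the \<open>n\<close> coefficients are packed into one sequence,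
    so that a single compactness argument extracts all limits at once.\<close>
  define q where "q k i = (if i = 0 then s' k else if i = 1 then t' k else if i - 2 < n then c' k (i - 2) else 0)"
    for k i
  have "norm (q k i) \<le> \<rho>" for k i
  proof -
    have "norm (s' k) \<le> \<rho>" using s1[of k] d(1) by (simp add: \<rho>_def field_simps le_max_iff_disj)
    moreover have "norm (t' k) \<le> \<rho>"
      using st[of k] s1[of k] norm_triangle_ineq4[of "s' k" "s' k - t' k"]
      by (simp add: \<rho>_def le_max_iff_disj)
    moreover have "norm (c' k j) \<le> \<rho>" if "j < n" for j
      using L[OF that, of "c' k" "s' k"] one[of k] by (simp add: \<rho>_def le_max_iff_disj abs_ge_self order.trans)
    moreover have "0 \<le> \<rho>" by (simp add: \<rho>_def le_max_iff_disj)
    ultimately show ?thesis by (simp add: q_def)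
  qed
  then have "\<forall>k. q k \<in> {q. \<forall>i. norm (q i) \<le> \<rho>}" by simp
  with compact_bounded_sequences[of \<rho>] obtain l \<phi> where \<phi>: "strict_mono \<phi>" "(q \<circ> \<phi>) \<longlonglongrightarrow> l"
    unfolding compact_eq_seq_compact_metric seq_compact_def by metis
  have lim: "(\<lambda>k. q (\<phi> k) i) \<longlonglongrightarrow> l i" for i
    using tendsto_coordinate[OF \<phi>(2), of i] by simp
  have slim: "(\<lambda>k. s' (\<phi> k)) \<longlonglongrightarrow> l 0" using lim[of 0] by (simp add: q_def)
  have tlim: "(\<lambda>k. t' (\<phi> k)) \<longlonglongrightarrow> l 1" using lim[of 1] by (simp add: q_def)
  have clim: "(\<lambda>k. c' (\<phi> k) i) \<longlonglongrightarrow> l (i + 2)" if "i < n" for i using lim[of "i + 2"] that by (simp add: q_def)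
  define e where "e = (\<Sum>i<n. sc (l (i + 2)) (b i))"
  have elim: "(\<lambda>k. lincomb b (c' (\<phi> k)) n) \<longlonglongrightarrow> e"
    unfolding e_def by (intro tendsto_sum tendsto_sc clim) auto
  have "bidual_norm e (l 0) \<le> 1 / \<theta>"
  proof (rule bidual_norm_least)
    fix f assume f: "f \<in> dual_ball"
    note fd = dual_ball_dual[OF f]
    \<comment> \<open>Tested against a fixed functional, the term with factor \<open>t'\<close>
      tends to \<open>l 1\<close> times the value of the weak-star limit, and this cancels the
      \<open>- l 1\<close> in the other scalar.\<close>
    have "filterlim (\<lambda>k. J (\<phi> k)) at_top sequentially"
    proof (rule filterlim_at_top_mono[OF filterlim_ident])
      show "\<forall>\<^sub>F k in sequentially. k \<le> J (\<phi> k)"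
        using J seq_suble[OF \<phi>(1)] order.trans by (intro always_eventually) blast
    qed
    then have "(\<lambda>k. f (x (J (\<phi> k)))) \<longlonglongrightarrow> wlim f"
      by (rule filterlim_compose[OF wlim[OF fd]])
    then have "(\<lambda>k. norm ((f (lincomb b (c' (\<phi> k)) n) + t' (\<phi> k) * f (x (J (\<phi> k)))) + (s' (\<phi> k) - t' (\<phi> k)) * wlim f))
        \<longlonglongrightarrow> norm ((f e + l 1 * wlim f) + (l 0 - l 1) * wlim f)"
      by (intro tendsto_intros dual_tendsto[OF fd] elim slim tlim)
    moreover have "norm ((f (lincomb b (c' k) n) + t' k * f (x (J k))) + (s' k - t' k) * wlim f) \<le> 1 / \<theta>" for k
      using bidual_norm_upper[OF f, of "lincomb b (c' k) n + sc (t' k) (x (J k))" "s' k - t' k"] less1[of k]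
      by (simp add: dual_linear[OF fd])
    ultimately have "norm ((f e + l 1 * wlim f) + (l 0 - l 1) * wlim f) \<le> 1 / \<theta>"
      by (intro LIMSEQ_le_const2) auto
    then show "norm (f e + l 0 * wlim f) \<le> 1 / \<theta>" by (simp add: algebra_simps)
  qed
  moreover have "1 \<le> bidual_norm e (l 0)"
  proof (rule LIMSEQ_le_const)
    have "(\<lambda>k. bidual_norm e (l 0) + norm (lincomb b (c' (\<phi> k)) n - e) + norm (s' (\<phi> k) - l 0) * R)
      \<longlonglongrightarrow> bidual_norm e (l 0) + norm (e - e) + norm (l 0 - l 0) * R"
      by (intro tendsto_intros elim slim)
    then show "(\<lambda>k. bidual_norm e (l 0) + norm (lincomb b (c' (\<phi> k)) n - e) + norm (s' (\<phi> k) - l 0) * R)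
      \<longlonglongrightarrow> bidual_norm e (l 0)" by simp
    show "\<exists>N. \<forall>k\<ge>N. 1 \<le> bidual_norm e (l 0) + norm (lincomb b (c' (\<phi> k)) n - e) + norm (s' (\<phi> k) - l 0) * R"
      using bidual_norm_perturb one by metis
  qed
  ultimately have "1 \<le> 1 / \<theta>" by linarith
  then show False using th by simp
qed

text \<open>Putting the coefficient \<open>c n\<close> on the weak-star limit instead of on the new
  vector \<open>x j\<close> raises the norm at most by a factor. The factors telescope: any product
  of consecutive ones is below 2.\<close>

definition selects :: "(nat \<Rightarrow> nat) \<Rightarrow> nat \<Rightarrow> nat \<Rightarrow> bool" where
  "selects r n j \<longleftrightarrow> (\<forall>m<n. r m < j) \<and> (\<forall>c s.
     bidual_norm (lincomb (x \<circ> r) c n) (s + c n) \<le> (1 + (1/2)^n) / (1 + (1/2)^Suc n) *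
       bidual_norm (lincomb (x \<circ> r) c n + sc (c n) (x j)) s)"

text \<open>Supplies the bound that \<open>selection_step\<close> needs for compactness; it may
  depend on \<open>n\<close>. The last coefficient is \<open>(s + c n) - s\<close>, with norms at
  most \<open>2 / d\<close> and \<open>1 / d\<close> times the total norm, hence
  \<open>3 / d\<close>.\<close>

lemma selects_coefficients:
  assumes "\<And>m. m < n \<Longrightarrow> selects r m (r m)"
  shows "\<exists>L. \<forall>c s. \<forall>i<n. norm (c i) \<le> L * bidual_norm (lincomb (x \<circ> r) c n) s"
  using assms
proof (induction n)
  case (Suc n)
  then obtain L where L: "\<And>c s i. i < n \<Longrightarrow> norm (c i) \<le> L * bidual_norm (lincomb (x \<circ> r) c n) s"
    by (metis less_Suc_eq)
  obtain d where d: "d > 0" "\<And>v s. d * norm s \<le> bidual_norm v s"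
    using bidual_norm_bounds_scalar by blast
  have sd: "norm s \<le> bidual_norm v s / d" for v s using d by (simp add: field_simps)
  have "norm (c i) \<le> (2 * \<bar>L\<bar> + 3 / d) * bidual_norm (lincomb (x \<circ> r) c (Suc n)) s" if "i < Suc n" for c s i
  proof -
    let ?N = "bidual_norm (lincomb (x \<circ> r) c (Suc n)) s"
    have N: "?N \<ge> 0" by (rule bidual_norm_nonneg)
    have "bidual_norm (lincomb (x \<circ> r) c n) (s + c n) \<le> (1 + (1/2)^n) / (1 + (1/2)^Suc n) * ?N"
      using Suc.prems[of n] by (simp add: selects_def)
    also have "\<dots> \<le> 2 * ?N"
    proof (rule mult_right_mono[OF _ N])
      have "1 + (1/2)^n \<le> (2::real)" "(2::real) \<le> 2 * (1 + (1/2)^Suc n)" by (simp_all add: power_le_one)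
      then have "1 + (1/2)^n \<le> 2 * (1 + (1/2::real)^Suc n)" by (rule order.trans)
      moreover have "0 < 1 + (1/2::real)^Suc n" by (intro add_pos_pos) auto
      ultimately show "(1 + (1/2)^n) / (1 + (1/2)^Suc n) \<le> (2::real)"
        by (simp only: pos_divide_le_eq)
    qed
    finally have *: "bidual_norm (lincomb (x \<circ> r) c n) (s + c n) \<le> 2 * ?N" .
    show ?thesis
    proof (cases "i < n")
      case True
      have "norm (c i) \<le> L * bidual_norm (lincomb (x \<circ> r) c n) (s + c n)" using L[OF True] .
      also have "\<dots> \<le> \<bar>L\<bar> * (2 * ?N)" using * bidual_norm_nonneg by (intro mult_mono) auto
      also have "\<dots> \<le> (2 * \<bar>L\<bar> + 3 / d) * ?N" using N d by (simp add: algebra_simps)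
      finally show ?thesis .
    next
      case False
      then have i: "i = n" using that by simp
      have "norm (s + c n) \<le> 2 * ?N / d"
        using sd[of "s + c n" "lincomb (x \<circ> r) c n"] * d by (meson divide_right_mono less_imp_le order.trans)
      moreover have "norm s \<le> ?N / d" by (rule sd)
      ultimately have "norm (c n) \<le> 3 * ?N / d"
        using norm_triangle_ineq4[of "s + c n" s] by (simp add: add_divide_distrib)
      also have "\<dots> \<le> (2 * \<bar>L\<bar> + 3 / d) * ?N" using N by (simp add: algebra_simps)
      finally show ?thesis by (simp add: i)
    qed
  qed
  then show ?case by blast
qed simp

lemma wide_s_subsequence: "\<exists>r C. strict_mono r \<and> wide_s (x \<circ> r) C"
proof -
  have "\<exists>r. \<forall>n. selects r n (r n)"
  proof (rule dependent_wellorder_choice)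
    fix j n :: nat and r r' :: "nat \<Rightarrow> nat" assume eq: "\<And>m. m < n \<Longrightarrow> r m = r' m"
    then have "lincomb (x \<circ> r) c n = lincomb (x \<circ> r') c n" for c by simp
    then show "selects r n j = selects r' n j" using eq by (simp add: selects_def)
  next
    fix n :: nat and r :: "nat \<Rightarrow> nat" assume r: "\<And>m. m < n \<Longrightarrow> selects r m (r m)"
    then obtain L where L: "\<And>c s i. i < n \<Longrightarrow> norm (c i) \<le> L * bidual_norm (lincomb (x \<circ> r) c n) s"
      using selects_coefficients[of n r] by blast
    have "(1/2)^Suc n < (1/2::real)^n" by simp
    then have "(1 + (1/2)^n) / (1 + (1/2)^Suc n) > (1::real)"
      by (subst less_divide_eq_1_pos) (auto intro: add_pos_pos simp del: power_Suc)
    from selection_step[OF L this] obtain j0 where j0: "\<And>j c s t. j \<ge> j0 \<Longrightarrow>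
       bidual_norm (lincomb (x \<circ> r) c n) s \<le> (1 + (1/2)^n) / (1 + (1/2)^Suc n) *
         bidual_norm (lincomb (x \<circ> r) c n + sc t (x j)) (s - t)" by blast
    define j where "j = max j0 (Suc (Max (r ` {..<n} \<union> {0})))"
    have "r m < j" if "m < n" for m
    proof -
      have "r m \<le> Max (r ` {..<n} \<union> {0})" using that by (intro Max_ge) auto
      then show ?thesis by (simp add: j_def)
    qed
    moreover have "bidual_norm (lincomb (x \<circ> r) c n) (s + c n) \<le> (1 + (1/2)^n) / (1 + (1/2)^Suc n) *
         bidual_norm (lincomb (x \<circ> r) c n + sc (c n) (x j)) s" for c s
      using j0[of j c "s + c n" "c n"] by (simp add: j_def)
    ultimately show "\<exists>j. selects r n j" unfolding selects_def by blast
  qed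
  then obtain r where r: "\<And>n. selects r n (r n)" by blast
  have "strict_mono r" using r unfolding selects_def strict_mono_Suc_iff by blast
  obtain d where d: "d > 0" "\<And>v s. d * norm s \<le> bidual_norm v s"
    using bidual_norm_bounds_scalar by blast
  define b where "b = x \<circ> r"
  \<comment> \<open>All coefficients from \<open>n\<close> on are moved to the weak-star limit.
    Divided by \<open>1 + (1/2)^n\<close>, this norm increases with \<open>n\<close> up to the norm
    of the full combination.\<close>
  have main: "bidual_norm (lincomb b c n) (\<Sum>i\<in>{n..<N}. c i) \<le> 2 * norm (lincomb b c N)" if "n \<le> N" for c n N
  proof -
    define A where "A n = bidual_norm (lincomb b c n) (\<Sum>i\<in>{n..<N}. c i)" for n
    have step: "A n / (1 + (1/2)^n) \<le> A (Suc n) / (1 + (1/2)^Suc n)" if "n < N" for n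
    proof -
      have "A n = bidual_norm (lincomb b c n) ((\<Sum>i\<in>{Suc n..<N}. c i) + c n)"
        unfolding A_def using that by (simp add: sum.atLeast_Suc_lessThan add.commute)
      also have "\<dots> \<le> (1 + (1/2)^n) / (1 + (1/2)^Suc n) * A (Suc n)"
        using r[of n] by (simp add: selects_def A_def b_def)
      finally have "A n \<le> (1 + (1/2)^n) * (A (Suc n) / (1 + (1/2)^Suc n))" by simp
      moreover have "1 + (1/2)^n > (0::real)" by (intro add_pos_pos) auto
      ultimately show ?thesis by (simp only: pos_divide_le_eq mult.commute)
    qed
    have "A n / (1 + (1/2)^n) \<le> A N / (1 + (1/2)^N)"
      using that by (induction rule: inc_induct) (use step in \<open>auto intro: order.trans simp del: power_Suc\<close>)
    also have "\<dots> \<le> A N"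
    proof -
      have "0 \<le> A N" by (simp add: A_def bidual_norm_nonneg)
      then show ?thesis using divide_left_mono[of 1 "1 + (1/2)^N" "A N"] by (simp add: add_pos_pos)
    qed
    also have "A N = norm (lincomb b c N)" by (simp add: A_def bidual_norm_0)
    finally have "A n \<le> (1 + (1/2)^n) * norm (lincomb b c N)"
      by (subst (asm) pos_divide_le_eq) (auto intro: add_pos_pos simp: mult.commute)
    also have "\<dots> \<le> 2 * norm (lincomb b c N)"
      by (intro mult_right_mono) (auto simp: power_le_one)
    finally show ?thesis by (simp add: A_def)
  qed
  \<comment> \<open>Removing the tail from the weak-star limit costs \<open>2 * R / d\<close> on top
    of the factor 2. An initial coefficient sum is the total minus a tail, each at most
    \<open>2 / d\<close> times the norm.\<close>
  define C where "C = 2 + 2 * R / d + 4 / d"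
  have "wide_s b C"
    unfolding wide_s_def
  proof (intro conjI allI impI)
    show "C > 0" unfolding C_def using R_nonneg d by (intro add_pos_nonneg add_pos_pos) auto
    fix c and n N :: nat assume nN: "n \<le> N"
    let ?V = "norm (lincomb b c N)"
    have tail: "norm (\<Sum>i\<in>{n..<N}. c i) \<le> 2 * ?V / d" if "n \<le> N" for n
      using order.trans[OF d(2) main[OF that, of c]] d(1) by (simp add: field_simps)
    have "norm (lincomb b c n) \<le> 2 * ?V + (2 * ?V / d) * R"
    proof -
      have "norm (lincomb b c n) \<le> bidual_norm (lincomb b c n) (\<Sum>i\<in>{n..<N}. c i) + norm (\<Sum>i\<in>{n..<N}. c i) * R"
        using bidual_norm_perturb[of "lincomb b c n" 0 "lincomb b c n" "\<Sum>i\<in>{n..<N}. c i"] by (simp add: bidual_norm_0)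
      also have "\<dots> \<le> 2 * ?V + (2 * ?V / d) * R"
        using main[OF nN] tail[OF nN] R_nonneg by (intro add_mono mult_right_mono) auto
      finally show ?thesis .
    qed
    also have "\<dots> \<le> C * ?V" using d by (simp add: C_def algebra_simps)
    finally show "norm (lincomb b c n) \<le> C * ?V" .
    have "(\<Sum>i<n. c i) = (\<Sum>i\<in>{0..<N}. c i) - (\<Sum>i\<in>{n..<N}. c i)"
      using sum.atLeastLessThan_concat[of 0 n N c] nN by (simp add: lessThan_atLeast0 algebra_simps)
    then have "norm (\<Sum>i<n. c i) \<le> 2 * ?V / d + 2 * ?V / d"
      using tail[of 0] tail[OF nN] norm_triangle_ineq4[of "\<Sum>i\<in>{0..<N}. c i" "\<Sum>i\<in>{n..<N}. c i"] by simp
    also have "\<dots> \<le> C * ?V"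
      using d R_nonneg by (simp add: C_def algebra_simps)
    finally show "norm (\<Sum>i<n. c i) \<le> C * ?V" .
  qed
  then show ?thesis using \<open>strict_mono r\<close> unfolding b_def by blast
qed

end

section \<open>Unbounded oscillation: strongly summing subsequences\<close>

text \<open>A node offers one move for each index \<open>n\<close>, to be used if the jump occurs at
  \<open>n\<close>; the flag says whether the increment of that move is counted. Being a datatype
  makes every play finite.\<close>

datatype 't tree = Leaf 't | Node bool 't "nat \<Rightarrow> 't tree"

primrec apex :: "'t tree \<Rightarrow> 't" where
  "apex (Leaf t) = t"
| "apex (Node up t br) = t"

text \<open>A leaf is its own branch, so branching can be applied to a whole finite set of trees
  without distinguishing cases.\<close>

primrec branch :: "nat \<Rightarrow> 't tree \<Rightarrow> 't tree" where
  "branch n (Leaf t) = Leaf t"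
| "branch n (Node up t br) = br n"

text \<open>A basic neighbourhood in the product topology. The tolerance \<open>(1/4)^n\<close>
  remains small when added up over fewer than \<open>2^n\<close> indices.\<close>

definition agree :: "nat \<Rightarrow> (nat \<Rightarrow> 'k::real_normed_vector) \<Rightarrow> (nat \<Rightarrow> 'k) \<Rightarrow> bool" where
  "agree n t y \<longleftrightarrow> (\<forall>j\<le>n. norm (y j - t j) \<le> (1/4)^n)"

lemma Abel_summation:
  fixes c z :: "nat \<Rightarrow> 'k::comm_ring"
  shows "(\<Sum>j\<le>N. c j * z j) = (\<Sum>j\<le>N. c j) * z N - (\<Sum>j<N. (\<Sum>i\<le>j. c i) * (z (Suc j) - z j))"
proof (induction N)
  case (Suc N)
  have "g * y - x + d * w = (g + d) * w - (x + g * (w - y))" for g y x d w :: 'k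
    by (simp add: algebra_simps)
  then show ?case by (simp only: sum.atMost_Suc sum.lessThan_Suc Suc.IH)
qed simp

text \<open>The second cluster point comes from the infinitely many terms that keep a fixed distance
  from the first.\<close>

lemma two_cluster_points:
  fixes s :: "nat \<Rightarrow> 'k::heine_borel"
  assumes "bounded (range s)" "\<not> convergent s"
  obtains \<alpha> \<beta> where "\<alpha> \<noteq> \<beta>" "\<And>e m. e > 0 \<Longrightarrow> \<exists>n>m. dist (s n) \<alpha> < e" "\<And>e m. e > 0 \<Longrightarrow> \<exists>n>m. dist (s n) \<beta> < e"
proof -
  have cluster: "\<exists>n>m. dist (s n) l < e"
    if r: "strict_mono r" and l: "(s \<circ> r) \<longlonglongrightarrow> l" and e: "e > 0" for r l e and m :: nat
  proof -
    obtain N where "\<And>n. n \<ge> N \<Longrightarrow> dist (s (r n)) l < e"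
      using metric_LIMSEQ_D[OF l e] by auto
    then show ?thesis
      using seq_suble[OF r, of "max N (Suc m)"] by (intro exI[of _ "r (max N (Suc m))"]) auto
  qed
  obtain \<alpha> r where \<alpha>: "strict_mono r" "(s \<circ> r) \<longlonglongrightarrow> \<alpha>"
    using bounded_imp_convergent_subsequence[OF assms(1)] by blast
  have "\<not> s \<longlonglongrightarrow> \<alpha>" using assms(2) by (auto simp: convergent_def)
  then obtain e where e: "e > 0" "\<And>m. \<exists>n\<ge>m. dist (s n) \<alpha> \<ge> e"
    unfolding lim_sequentially by (meson not_le)
  define A where "A = {n. dist (s n) \<alpha> \<ge> e}"
  have inf: "infinite A" unfolding infinite_nat_iff_unbounded_le A_def using e(2) by blast
  define q where "q = enumerate A"
  have q: "strict_mono q" "\<And>n. dist (s (q n)) \<alpha> \<ge> e"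
    using strict_mono_enumerate[OF inf] enumerate_in_set[OF inf] by (auto simp: q_def A_def)
  have "bounded (range (s \<circ> q))" by (rule bounded_subset[OF assms(1)]) auto
  then obtain \<beta> p where \<beta>: "strict_mono p" "((s \<circ> q) \<circ> p) \<longlonglongrightarrow> \<beta>"
    using bounded_imp_convergent_subsequence by blast
  have "(\<lambda>n. dist (s (q (p n))) \<alpha>) \<longlonglongrightarrow> dist \<beta> \<alpha>"
    using \<beta>(2) by (intro tendsto_intros) (simp add: o_def)
  then have "e \<le> dist \<beta> \<alpha>" by (rule LIMSEQ_le_const) (use q(2) in auto)
  then have "\<alpha> \<noteq> \<beta>" using e(1) by auto
  moreover have "strict_mono (q \<circ> p)" using q(1) \<beta>(1) by (simp add: strict_mono_o)
  ultimately show ?thesis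
    using cluster[OF \<alpha>] cluster[of "q \<circ> p" \<beta>] \<beta>(2) by (intro that[of \<alpha> \<beta>]) (auto simp: o_assoc)
qed

context banach_real_part
begin

text \<open>Along every branch of the tree, the increments of \<open>rp \<circ> lim\<close> at the nodes marked \<open>True\<close> (the
  counted ones) add up to at least \<open>a\<close>.\<close>

inductive certifies :: "(nat \<Rightarrow> 'k) set \<Rightarrow> (nat \<Rightarrow> 'k) tree \<Rightarrow> real \<Rightarrow> bool" for K where
  Leaf: "t \<in> K \<Longrightarrow> a \<le> 0 \<Longrightarrow> certifies K (Leaf t) a"
| Node: "t \<in> K \<Longrightarrow> (\<And>n. agree n t (apex (br n))) \<Longrightarrow>
    (\<And>n. certifies K (br n) (if up then a - (rp (lim (apex (br n))) - rp (lim t)) else a)) \<Longrightarrow>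
    certifies K (Node up t br) a"

lemma certifies_apex: "certifies K T a \<Longrightarrow> apex T \<in> K"
  by (induction rule: certifies.induct) auto

lemma certifies_branch: "certifies K T a \<Longrightarrow> \<exists>a'. certifies K (branch n T) a'"
  by (erule certifies.cases) (auto intro: certifies.Leaf)

lemma certifies_antimono: "certifies K T a \<Longrightarrow> a' \<le> a \<Longrightarrow> certifies K T a'"
proof (induction arbitrary: a' rule: certifies.induct)
  case (Node t br up a)
  show ?case by (rule certifies.Node) (use Node in auto)
qed (auto intro: certifies.Leaf)

text \<open>Jumping at an index \<open>n\<close> with \<open>D n\<close> close to \<open>\<beta>\<close> at counted nodes, and close to \<open>0\<close> at the others,
  makes the sum collect \<open>\<beta>\<close> times the certified oscillation.\<close>

lemma certified_play:
  fixes r :: "nat \<Rightarrow> nat" and S :: "nat \<Rightarrow> (nat \<Rightarrow> 'k) tree set"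
  assumes r: "strict_mono r"
    and S_branch: "\<And>m T. T \<in> S m \<Longrightarrow> branch (r (Suc m)) T \<in> S (Suc m)"
    and S_Suc: "\<And>m T. T \<in> S m \<Longrightarrow> T \<in> S (Suc m)"
    and stable: "\<And>m T j. T \<in> S m \<Longrightarrow> r (Suc m) \<le> j \<Longrightarrow> norm (apex T j - lim (apex T)) \<le> (1/2)^m"
    and K_bound: "\<And>t j. t \<in> K \<Longrightarrow> norm (lim t) \<le> B"
    and D: "\<And>j. norm (D j) \<le> A" and \<beta>: "\<beta> \<ge> 0"
    and D0: "\<And>e m. e > 0 \<Longrightarrow> \<exists>n>m. norm (D n) \<le> e"
    and D\<beta>: "\<And>e m. e > 0 \<Longrightarrow> \<exists>n>m. norm (D n - of_real \<beta>) \<le> e"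
    and T: "certifies K T a" "T \<in> S m"
  shows "\<exists>z\<in>K. \<exists>N>m. (\<forall>j\<le>Suc m. norm (z (r j) - apex T (r j)) \<le> (1/4)^m) \<and>
    \<beta> * a - (26 * A + 4 * B) * (1/2)^m \<le> rp (\<Sum>j\<in>{m<..<N}. D j * (z (r (Suc j)) - z (r j)))"
  using T
proof (induction arbitrary: m rule: certifies.induct)
  case (Leaf t a)
  have "0 \<le> A" using D[of 0] norm_ge_zero order.trans by blast
  moreover have "0 \<le> B" using K_bound[OF Leaf(1)] norm_ge_zero order.trans by blast
  ultimately have "0 \<le> (26 * A + 4 * B) * (1/2)^m" by (intro mult_nonneg_nonneg add_nonneg_nonneg) auto
  moreover have "\<beta> * a \<le> 0" using Leaf \<beta> by (simp add: mult_nonneg_nonpos)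
  ultimately show ?case
    using Leaf bounded_linear.linear[OF rp, THEN linear_0]
    by (intro bexI[of _ t] exI[of _ "Suc m"]) (auto simp: atLeastSucLessThan_greaterThanLessThan[symmetric])
next
  case (Node t br up a)
  interpret rp: bounded_linear rp by (rule rp)
  have A: "0 \<le> A" using D[of 0] norm_ge_zero order.trans by blast
  have B: "0 \<le> B" using K_bound[OF Node(1)] norm_ge_zero order.trans by blast
  define \<tau> :: 'k where "\<tau> = (if up then of_real \<beta> else 0)"
  \<comment> \<open>The next jump time: the weight there is close to the target
    \<open>\<tau>\<close> of this node. The corresponding index of the original sequence, and thus
    the branch taken, is \<open>r m1\<close>.\<close>
  obtain m1 where m1: "m1 > m" "norm (D m1 - \<tau>) \<le> (1/2)^m"
    using D0[of "(1/2)^m" m] D\<beta>[of "(1/2)^m" m] by (cases up) (auto simp: \<tau>_def)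
  let ?T = "Node up t br"
  have mono_S: "T \<in> S j" if "T \<in> S i" "i \<le> j" for i j T
    using that(2,1) by (induction rule: dec_induct) (auto intro: S_Suc)
  define y where "y = apex (br (r m1))"
  obtain m' where m': "m1 = Suc m'" "m \<le> m'" using m1(1) by (cases m1) auto
  have brS: "br (r m1) \<in> S m1"
    using S_branch[OF mono_S[OF Node.prems m'(2)]] by (simp add: m')
  define a' where "a' = (if up then a - (rp (lim y) - rp (lim t)) else a)"
  from Node.IH[of "r m1" m1, OF brS, folded y_def, folded a'_def] obtain z N where z: "z \<in> K" "N > m1"
    "\<forall>j\<le>Suc m1. norm (z (r j) - y (r j)) \<le> (1/4)^m1"
    "\<beta> * a' - (26 * A + 4 * B) * (1/2)^m1 \<le> rp (\<Sum>j\<in>{m1<..<N}. D j * (z (r (Suc j)) - z (r j)))"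
    by (elim bexE exE conjE)
  have yK: "y \<in> K" using certifies_apex[OF Node.hyps(3)] by (simp add: y_def)
  have rm: "m1 \<le> r m1" using r by (rule seq_suble)
  have yt: "norm (y (r j) - t (r j)) \<le> (1/4)^m1" if "j \<le> m1" for j
  proof -
    have "r j \<le> r m1" using r that by (simp add: strict_mono_less_eq)
    then have "norm (y (r j) - t (r j)) \<le> (1/4)^r m1"
      using Node.hyps(2)[of "r m1"] by (simp add: agree_def y_def)
    also have "\<dots> \<le> (1/4)^m1" using rm by (intro power_decreasing) auto
    finally show ?thesis .
  qed
  have zt: "norm (z (r j) - t (r j)) \<le> 2 * (1/4)^m1" if "j \<le> m1" for j
    using z(3)[rule_format, of j] yt[OF that] that norm_triangle_ineq[of "z (r j) - y (r j)" "y (r j) - t (r j)"] by simp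
  have tl: "norm (t (r j) - lim t) \<le> 2 * (1/2)^j" if j: "m < j" for j
  proof -
    obtain i where i: "j = Suc i" "m \<le> i" using j by (cases j) auto
    have "norm (t (r j) - lim t) \<le> (1/2)^i"
      using stable[OF mono_S[OF Node.prems i(2)], of "r j"] by (simp add: i)
    then show ?thesis by (simp add: i)
  qed
  have q4: "(1/4::real)^n \<le> (1/2)^n" for n by (intro power_mono) auto
  have h: "(1/2::real)^m1 \<le> (1/2)^m" using m1(1) by (intro power_decreasing) auto
  define \<delta> where "\<delta> j = z (r (Suc j)) - z (r j)" for j
  \<comment> \<open>Before the jump the final sequence \<open>z\<close> follows \<open>t\<close>,
    which is already nearly constant along \<open>r\<close>; these increments are negligible
    whatever their weights.\<close>
  have small: "norm (\<delta> j) \<le> 4 * (1/4)^m1 + 3 * (1/2)^j" if "m < j" "j < m1" for j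
  proof -
    have "\<delta> j = (z (r (Suc j)) - t (r (Suc j))) + (t (r (Suc j)) - lim t) - (z (r j) - t (r j)) - (t (r j) - lim t)"
      by (simp add: \<delta>_def)
    also have "norm \<dots> \<le> norm (z (r (Suc j)) - t (r (Suc j))) + norm (t (r (Suc j)) - lim t)
       + norm (z (r j) - t (r j)) + norm (t (r j) - lim t)"
      by (intro order.trans[OF norm_triangle_ineq4] add_mono norm_triangle_ineq order.refl)
    also have "\<dots> \<le> 2 * (1/4)^m1 + 2 * (1/2)^Suc j + 2 * (1/4)^m1 + 2 * (1/2)^j"
      using that by (intro add_mono zt tl) auto
    also have "\<dots> = 4 * (1/4)^m1 + 3 * (1/2)^j" by simp
    finally show ?thesis .
  qed
  have geo: "(\<Sum>j\<in>{m<..<n}. (1/2::real)^j) \<le> (1/2)^m" for n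
  proof -
    have "(\<Sum>j\<in>{m<..<Suc m + i}. (1/2::real)^j) = (1/2)^m - (1/2)^(m+i)" for i
    proof (induction i)
      case (Suc i)
      have "{m<..<Suc m + Suc i} = insert (Suc m + i) {m<..<Suc m + i}" by auto
      then show ?case using Suc by (simp add: power_add)
    qed (simp add: atLeastSucLessThan_greaterThanLessThan[symmetric])
    from this[of "n - Suc m"] show ?thesis by (cases "Suc m \<le> n") auto
  qed
  have "norm (\<Sum>j\<in>{m<..<m1}. D j * \<delta> j) \<le> (\<Sum>j\<in>{m<..<m1}. A * (4 * (1/4)^m1 + 3 * (1/2)^j))"
  proof (rule sum_norm_le)
    fix j assume "j \<in> {m<..<m1}"
    then have "norm (\<delta> j) \<le> 4 * (1/4)^m1 + 3 * (1/2)^j" by (intro small) auto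
    then show "norm (D j * \<delta> j) \<le> A * (4 * (1/4)^m1 + 3 * (1/2)^j)"
      unfolding norm_mult by (intro mult_mono D A norm_ge_zero)
  qed
  also have "\<dots> = A * (4 * (card {m<..<m1} * (1/4)^m1) + 3 * (\<Sum>j\<in>{m<..<m1}. (1/2)^j))"
    by (simp add: sum_distrib_left[symmetric] sum.distrib algebra_simps)
  also have "\<dots> \<le> A * (4 * (1/2)^m + 3 * (1/2)^m)"
  proof (intro mult_left_mono add_mono geo A)
    \<comment> \<open>There are fewer than \<open>2^m1\<close> indices, each with an agreement error
      of order \<open>(1/4)^m1\<close>.\<close>
    have "card {m<..<m1} \<le> 2 ^ m1" unfolding card_greaterThanLessThan using less_exp[of m1] by linarith
    then have "real (card {m<..<m1}) \<le> 2 ^ m1" by (metis of_nat_le_iff of_nat_numeral of_nat_power)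
    then have "card {m<..<m1} * (1/4::real)^m1 \<le> 2 ^ m1 * (1/4)^m1" by (intro mult_right_mono) auto
    also have "\<dots> = (1/2)^m1" by (simp add: power_mult_distrib[symmetric])
    finally show "card {m<..<m1} * (1/4::real)^m1 \<le> (1/2)^m" using h by linarith
  qed auto
  finally have s1: "norm (\<Sum>j\<in>{m<..<m1}. D j * \<delta> j) \<le> 7 * A * (1/2)^m" by simp
  define \<Delta> where "\<Delta> = lim y - lim t"
  \<comment> \<open>At the jump itself, \<open>z\<close> passes from near \<open>lim t\<close> to
    near \<open>lim y\<close>.\<close>
  have \<delta>\<Delta>: "norm (\<delta> m1 - \<Delta>) \<le> 6 * (1/2)^m"
  proof -
    have "\<delta> m1 - \<Delta> = (z (r (Suc m1)) - y (r (Suc m1))) + (y (r (Suc m1)) - lim y) - (z (r m1) - t (r m1)) - (t (r m1) - lim t)"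
      by (simp add: \<delta>_def \<Delta>_def)
    also have "norm \<dots> \<le> norm (z (r (Suc m1)) - y (r (Suc m1))) + norm (y (r (Suc m1)) - lim y)
       + norm (z (r m1) - t (r m1)) + norm (t (r m1) - lim t)"
      by (intro order.trans[OF norm_triangle_ineq4] add_mono norm_triangle_ineq order.refl)
    also have "\<dots> \<le> (1/4)^m1 + (1/2)^m1 + 2 * (1/4)^m1 + 2 * (1/2)^m1"
      using m1(1) stable[OF brS, of "r (Suc m1)"] by (intro add_mono zt tl z(3)[rule_format]) (auto simp: y_def)
    also have "\<dots> \<le> 6 * (1/2)^m" using q4[of m1] h by linarith
    finally show ?thesis .
  qed
  have \<Delta>: "norm \<Delta> \<le> 2 * B"
    using K_bound[OF yK] K_bound[OF Node.hyps(1)] norm_triangle_ineq4[of "lim y" "lim t"] by (simp add: \<Delta>_def)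
  have s2: "rp (\<tau> * \<Delta>) - (6 * A + 2 * B) * (1/2)^m \<le> rp (D m1 * \<delta> m1)"
  proof -
    define E where "E = D m1 * (\<delta> m1 - \<Delta>) + (D m1 - \<tau>) * \<Delta>"
    have "D m1 * \<delta> m1 = \<tau> * \<Delta> + E"
      by (simp add: E_def algebra_simps)
    then have "rp (D m1 * \<delta> m1) = rp (\<tau> * \<Delta>) + rp E" by (simp only: rp.add)
    moreover have "norm E \<le> A * (6 * (1/2)^m) + (1/2)^m * (2 * B)"
      unfolding E_def
    proof (rule order.trans[OF norm_triangle_ineq add_mono])
      show "norm (D m1 * (\<delta> m1 - \<Delta>)) \<le> A * (6 * (1/2)^m)"
        unfolding norm_mult by (intro mult_mono D \<delta>\<Delta> A norm_ge_zero)
      show "norm ((D m1 - \<tau>) * \<Delta>) \<le> (1/2)^m * (2 * B)"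
        unfolding norm_mult by (intro mult_mono m1(2) \<Delta> norm_ge_zero) simp
    qed
    then have "norm E \<le> (6 * A + 2 * B) * (1/2)^m" by (simp add: algebra_simps)
    ultimately show ?thesis using rp_le[of E] by linarith
  qed
  have \<tau>: "rp (\<tau> * \<Delta>) = (if up then \<beta> * (rp (lim y) - rp (lim t)) else 0)"
  proof -
    have "of_real \<beta> * \<Delta> = \<beta> *\<^sub>R \<Delta>" by (simp add: scaleR_conv_of_real)
    then show ?thesis by (auto simp: \<tau>_def rp.scaleR rp.zero) (simp add: \<Delta>_def rp.diff)
  qed
  have "{m<..<N} = {m<..<m1} \<union> insert m1 {m1<..<N}" using m1(1) z(2) by auto
  moreover have "{m<..<m1} \<inter> insert m1 {m1<..<N} = {}" by auto
  ultimately have "(\<Sum>j\<in>{m<..<N}. D j * \<delta> j) =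
      (\<Sum>j\<in>{m<..<m1}. D j * \<delta> j) + (D m1 * \<delta> m1 + (\<Sum>j\<in>{m1<..<N}. D j * \<delta> j))"
    by (simp add: sum.union_disjoint)
  then have "rp (\<Sum>j\<in>{m<..<N}. D j * \<delta> j) =
      rp (\<Sum>j\<in>{m<..<m1}. D j * \<delta> j) + (rp (D m1 * \<delta> m1) + rp (\<Sum>j\<in>{m1<..<N}. D j * \<delta> j))"
    by (simp add: rp.add)
  moreover have "- (7 * A * (1/2)^m) \<le> rp (\<Sum>j\<in>{m<..<m1}. D j * \<delta> j)"
    using rp_le[of "\<Sum>j\<in>{m<..<m1}. D j * \<delta> j"] s1 by linarith
  \<comment> \<open>This node loses \<open>7 * A\<close> before the jump and
    \<open>6 * A + 2 * B\<close> at it, in units of \<open>(1/2)^m\<close>. The loss of the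
    remaining play is at least halved since \<open>m1 > m\<close>, so \<open>26 * A + 4 * B\<close>,
    twice \<open>13 * A + 2 * B\<close>, reproduces itself.\<close>
  moreover have "(26 * A + 4 * B) * (1/2)^m1 \<le> (13 * A + 2 * B) * (1/2)^m"
  proof -
    have "(1/2::real)^m1 \<le> (1/2)^Suc m" using m1(1) by (intro power_decreasing) auto
    then have "(26 * A + 4 * B) * (1/2)^m1 \<le> (26 * A + 4 * B) * (1/2)^Suc m"
      using A B by (intro mult_left_mono) auto
    then show ?thesis by (simp add: algebra_simps)
  qed
  moreover have "\<beta> * a' + rp (\<tau> * \<Delta>) = \<beta> * a" unfolding \<tau> by (simp add: a'_def algebra_simps)
  ultimately have "\<beta> * a - (26 * A + 4 * B) * (1/2)^m \<le> rp (\<Sum>j\<in>{m<..<N}. D j * \<delta> j)"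
    using s2 z(4) unfolding \<delta>_def[symmetric] by (simp add: algebra_simps)
  moreover have "norm (z (r j) - t (r j)) \<le> (1/4)^m" if "j \<le> Suc m" for j
  proof -
    have "(1/4::real)^m1 \<le> (1/4)^Suc m" using m1(1) by (intro power_decreasing) auto
    moreover have "0 \<le> (1/4::real)^m" by simp
    ultimately have "2 * (1/4::real)^m1 \<le> (1/4)^m" by (simp only: power_Suc)
    then show ?thesis using zt[of j] that m1(1) by simp
  qed
  ultimately show ?case using z(1,2) m1(1)
    by (intro bexI[of _ z] exI[of _ N]) (auto simp: \<delta>_def)
qed

text \<open>Helly's inequalities instead of an image of the dual ball: in this form the set is
  visibly closed in the product topology. \<open>values_of_eq\<close> recovers the
  functionals.\<close>

definition values_of :: "(nat \<Rightarrow> 'a) \<Rightarrow> (nat \<Rightarrow> 'k) set" where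
  "values_of b = {a. \<forall>N c. norm (\<Sum>i<N. c i * a i) \<le> norm (lincomb b c N)}"

lemma values_of_eq: "values_of b = (\<lambda>f i. f (b i)) ` dual_ball"
proof (intro equalityI subsetI)
  fix a assume "a \<in> values_of b"
  then have "\<And>N c. norm (\<Sum>i<N. c i * a i) \<le> norm (lincomb b c N)" by (simp add: values_of_def)
  from extend_functional[OF this] obtain f where "f \<in> dual_ball" "\<forall>j. f (b j) = a j" by blast
  then show "a \<in> (\<lambda>f i. f (b i)) ` dual_ball" by (intro image_eqI[of _ _ f]) auto
next
  fix a assume "a \<in> (\<lambda>f i. f (b i)) ` dual_ball"
  then obtain f where f: "f \<in> dual_ball" "a = (\<lambda>i. f (b i))" by blast
  have "(\<Sum>i<N. c i * a i) = f (lincomb b c N)" for c N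
    by (simp add: f dual_lincomb[OF dual_ball_dual])
  then show "a \<in> values_of b" using dual_ball_le[OF f(1)] by (simp add: values_of_def)
qed

lemma values_of_le: "t \<in> values_of b \<Longrightarrow> norm (t j) \<le> norm (b j)"
  by (auto simp: values_of_eq dual_ball_le)

lemma values_of_convergent: "weak_Cauchy sc b \<Longrightarrow> t \<in> values_of b \<Longrightarrow> t \<longlonglongrightarrow> lim t"
  unfolding convergent_LIMSEQ_iff[symmetric]
  by (auto simp: values_of_eq weak_Cauchy_def dual_ball_dual)

lemma wide_s_subseq:
  assumes "wide_s b C" "strict_mono r"
  shows "wide_s (b \<circ> r) C"
proof -
  have inj: "inj r" using assms(2) by (rule strict_mono_imp_inj_on)
  define c' where "c' c k = (if k \<in> range r then c (inv r k) else 0)" for c :: "nat \<Rightarrow> 'k" and k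
  \<comment> \<open>Inserting zeros at the omitted indices; a general \<open>h\<close> covers vector
    sums and coefficient sums alike.\<close>
  have eq: "(\<Sum>k<r n. h (c' c k) k) = (\<Sum>i<n. h (c i) (r i))"
    if "\<And>k. h 0 k = 0" for h :: "'k \<Rightarrow> nat \<Rightarrow> 'd::comm_monoid_add" and c n
  proof -
    have "(\<Sum>k<r n. h (c' c k) k) = (\<Sum>k\<in>r ` {..<n}. h (c' c k) k)"
    proof (rule sum.mono_neutral_right)
      show "r ` {..<n} \<subseteq> {..<r n}" using assms(2) by (auto simp: strict_mono_less)
      show "\<forall>k\<in>{..<r n} - r ` {..<n}. h (c' c k) k = 0"
        using assms(2) that by (auto simp: c'_def strict_mono_less)
    qed simp
    also have "\<dots> = (\<Sum>i<n. h (c i) (r i))"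
      using inj by (subst sum.reindex) (auto simp: c'_def inj_on_def)
    finally show ?thesis .
  qed
  have e1: "lincomb (b \<circ> r) c n = lincomb b (c' c) (r n)" for c n
    using eq[of "\<lambda>a k. sc a (b k)" c n] by simp
  have e2: "(\<Sum>i<n. c i) = (\<Sum>i<r n. c' c i)" for c n
    using eq[of "\<lambda>a k. a" c n] by simp
  show ?thesis
    unfolding wide_s_def
  proof (intro conjI allI impI)
    fix c and n N :: nat assume "n \<le> N"
    then have "r n \<le> r N" using assms(2) by (simp add: strict_mono_less_eq)
    then show "norm (lincomb (b \<circ> r) c n) \<le> C * norm (lincomb (b \<circ> r) c N)"
      "norm (\<Sum>i<n. c i) \<le> C * norm (lincomb (b \<circ> r) c N)"
      using assms(1) unfolding wide_s_def e1 e2[of c] by blast+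
  qed (use assms(1) in \<open>simp add: wide_s_def\<close>)
qed

lemma weak_Cauchy_subseq: "weak_Cauchy sc b \<Longrightarrow> strict_mono r \<Longrightarrow> weak_Cauchy sc (b \<circ> r)"
  unfolding weak_Cauchy_def using convergent_subseq_convergent by (fastforce simp: o_def)

lemma strongly_summing_subsequence:
  assumes wC: "weak_Cauchy sc b" and s: "wide_s b C"
    and unbounded: "\<And>n::nat. \<exists>T. certifies (values_of b) T (real n)"
  shows "\<exists>r. strict_mono r \<and> strongly_summing sc (b \<circ> r)"
proof -
  let ?K = "values_of b"
  obtain T where T: "\<And>n. certifies ?K (T n) (real n)" using unbounded by metis
  \<comment> \<open>A state pairs the selected index \<open>r n\<close> with the finite set of trees
    met so far: \<open>T n\<close> enters at stage \<open>n\<close>, and all branches at each newly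
    selected index are added. \<open>Q\<close> puts that index beyond the point where the current
    apexes are within \<open>(1/2)^n\<close> of their limits.\<close>
  define P where "P n p \<longleftrightarrow> finite (snd p) \<and> T n \<in> snd p \<and> (\<forall>U\<in>snd p. \<exists>a. certifies ?K U a)"
    for n and p :: "nat \<times> (nat \<Rightarrow> 'k) tree set"
  define Q where "Q n p q \<longleftrightarrow> fst p < fst q \<and>
      (\<forall>U\<in>snd p. \<forall>j\<ge>fst q. norm (apex U j - lim (apex U)) \<le> (1/2)^n) \<and>
      snd p \<union> branch (fst q) ` snd p \<subseteq> snd q" for n :: nat and p q :: "nat \<times> (nat \<Rightarrow> 'k) tree set"
  have "\<exists>f. \<forall>n. P n (f n) \<and> Q n (f n) (f (Suc n))"
  proof (rule dependent_nat_choice)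
    show "\<exists>p. P 0 p" using T by (intro exI[of _ "(0, {T 0})"]) (auto simp: P_def)
    fix p n assume p: "P n p"
    have "\<exists>N. \<forall>j\<ge>N. norm (apex U j - lim (apex U)) \<le> (1/2)^n" if U: "U \<in> snd p" for U
    proof -
      have "apex U \<in> ?K" using p U certifies_apex by (auto simp: P_def)
      from LIMSEQ_D[OF values_of_convergent[OF wC this], of "(1/2)^n"] show ?thesis
        by (auto intro: less_imp_le)
    qed
    then obtain N where N: "\<And>U j. U \<in> snd p \<Longrightarrow> j \<ge> N U \<Longrightarrow> norm (apex U j - lim (apex U)) \<le> (1/2)^n"
      by metis
    define k where "k = Suc (fst p) + Max (insert 0 (N ` snd p))"
    have "N U \<le> k" if "U \<in> snd p" for U
    proof -
      have "N U \<le> Max (insert 0 (N ` snd p))" using p that by (intro Max_ge) (auto simp: P_def)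
      then show ?thesis by (simp add: k_def)
    qed
    then have "norm (apex U j - lim (apex U)) \<le> (1/2)^n" if "U \<in> snd p" "j \<ge> k" for U j
      using N that order.trans by metis
    moreover have "fst p < k" by (simp add: k_def)
    moreover have "\<exists>a. certifies ?K U a" if "U \<in> insert (T (Suc n)) (snd p \<union> branch k ` snd p)" for U
      using that p T[of "Suc n"] certifies_branch unfolding P_def by blast
    ultimately show "\<exists>q. P (Suc n) q \<and> Q n p q"
      using p by (intro exI[of _ "(k, insert (T (Suc n)) (snd p \<union> branch k ` snd p))"])
        (auto simp: P_def Q_def)
  qed
  then obtain f where f: "\<And>n. P n (f n)" "\<And>n. Q n (f n) (f (Suc n))" by blast
  define r where "r n = fst (f n)" for n
  define S where "S n = snd (f n)" for n
  have r: "strict_mono r" using f(2) by (simp add: strict_mono_Suc_iff Q_def r_def)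
  have s': "wide_s (b \<circ> r) C" by (rule wide_s_subseq[OF s r])
  have C: "C > 0" using s by (simp add: wide_s_def)
  have "bounded (range b)" by (rule weak_Cauchy_bounded[OF wC])
  then obtain B where B: "\<And>i. norm (b i) \<le> B" by (auto simp: bounded_iff)
  have KB: "norm (t i) \<le> B" if "t \<in> ?K" for t i using values_of_le[OF that] B order.trans by blast
  have KL: "norm (lim t) \<le> B" if "t \<in> ?K" for t
    by (rule LIMSEQ_le_const2[OF tendsto_norm[OF values_of_convergent[OF wC that]]]) (use KB[OF that] in auto)
  have "summable c" if bdd: "bdd_above (range (\<lambda>n. norm (\<Sum>j\<le>n. sc (c j) ((b \<circ> r) j))))" for c
  proof (rule ccontr)
    assume nsum: "\<not> summable c"
    obtain M where M: "\<And>n. norm (\<Sum>j\<le>n. sc (c j) ((b \<circ> r) j)) \<le> M"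
      using bdd by (auto simp: bdd_above_def)
    define G where "G n = (\<Sum>j\<le>n. c j)" for n
    have GM: "norm (G n) \<le> C * M" for n
    proof -
      have "norm (G n) \<le> C * norm (lincomb (b \<circ> r) c (Suc n))"
        using s' unfolding wide_s_def G_def lessThan_Suc_atMost[symmetric] by blast
      also have "\<dots> \<le> C * M" using M[of n] C by (intro mult_left_mono) (auto simp only: lessThan_Suc_atMost)
      finally show ?thesis .
    qed
    have "bounded (range G)" using GM by (auto simp: bounded_iff)
    moreover have "\<not> convergent G" using nsum unfolding summable_iff_convergent' G_def[symmetric] .
    ultimately obtain \<alpha> \<gamma> where \<alpha>\<gamma>: "\<alpha> \<noteq> \<gamma>" "\<And>e m. e > 0 \<Longrightarrow> \<exists>n>m. dist (G n) \<alpha> < e"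
      "\<And>e m. e > 0 \<Longrightarrow> \<exists>n>m. dist (G n) \<gamma> < e"
      by (rule two_cluster_points) blast
    define \<beta> where "\<beta> = norm (\<gamma> - \<alpha>)"
    \<comment> \<open>A rotation: after subtracting \<open>\<alpha>\<close>, the two cluster points
      become 0 and the positive number \<open>\<beta>\<close>.\<close>
    define u where "u = of_real \<beta> / (\<gamma> - \<alpha>)"
    have \<beta>: "\<beta> > 0" using \<alpha>\<gamma>(1) by (simp add: \<beta>_def)
    have u: "norm u = 1" "u * (\<gamma> - \<alpha>) = of_real \<beta>"
      using \<alpha>\<gamma>(1) by (auto simp: u_def \<beta>_def norm_divide)
    define D where "D n = u * (G n - \<alpha>)" for n
    define A where "A = C * M + norm \<alpha>"
    have DA: "norm (D n) \<le> A" for n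
      using GM[of n] norm_triangle_ineq4[of "G n" \<alpha>] by (simp add: D_def norm_mult u A_def)
    have D0: "\<exists>n>m. norm (D n) \<le> e" if "e > 0" for e m
      using \<alpha>\<gamma>(2)[OF that, of m] by (auto simp: D_def norm_mult u dist_norm intro: less_imp_le)
    have D\<beta>: "\<exists>n>m. norm (D n - of_real \<beta>) \<le> e" if "e > 0" for e m
    proof -
      have "D n - of_real \<beta> = u * (G n - \<gamma>)" for n unfolding u(2)[symmetric] by (simp add: D_def algebra_simps)
      then show ?thesis using \<alpha>\<gamma>(3)[OF that, of m] by (auto simp: norm_mult u dist_norm intro: less_imp_le)
    qed
    define E where "E = C * M * B + M + 2 * norm \<alpha> * B"
    \<comment> \<open>Abel summation turns the sum into the value of a dual-ball functional on the
      bounded vector sums, plus boundary terms; the subtracted \<open>\<alpha>\<close> only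
      contributes a telescoping sum. The bound is independent of \<open>z\<close> and
      \<open>N\<close>, whereas the plays of \<open>T n\<close> force at least about
      \<open>\<beta> * n\<close>.\<close>
    have total: "norm (\<Sum>j<N. D j * (z (r (Suc j)) - z (r j))) \<le> E" if z: "z \<in> ?K" for z N
    proof -
      obtain g where g: "g \<in> dual_ball" "z = (\<lambda>i. g (b i))" using z by (auto simp: values_of_eq)
      have "g (\<Sum>j\<le>N. sc (c j) ((b \<circ> r) j)) = (\<Sum>j\<le>N. c j * z (r j))"
        by (simp add: g(2) dual_linear[OF dual_ball_dual[OF g(1)]])
      then have "norm (\<Sum>j\<le>N. c j * z (r j)) \<le> M"
        using order.trans[OF dual_ball_le[OF g(1)] M[of N]] by simp
      moreover have "(\<Sum>j<N. D j * (z (r (Suc j)) - z (r j))) =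
         u * (G N * z (r N) - (\<Sum>j\<le>N. c j * z (r j)) - \<alpha> * (z (r N) - z (r 0)))"
      proof -
        have "(\<Sum>j<N. z (r (Suc j)) - z (r j)) = z (r N) - z (r 0)"
          using sum_lessThan_telescope[of "\<lambda>j. z (r j)" N] by simp
        then show ?thesis
          using Abel_summation[of c "\<lambda>j. z (r j)" N]
          by (simp add: D_def G_def[symmetric] sum_distrib_left[symmetric] mult.assoc left_diff_distrib sum_subtractf)
      qed
      moreover have "norm (G N * z (r N)) \<le> C * M * B"
        unfolding norm_mult using GM[of N] KB[OF z, of "r N"] order.trans[OF norm_ge_zero GM[of N]]
        by (intro mult_mono) auto
      moreover have "norm (\<alpha> * (z (r N) - z (r 0))) \<le> norm \<alpha> * (2 * B)"
        unfolding norm_mult using KB[OF z, of "r N"] KB[OF z, of "r 0"] norm_triangle_ineq4[of "z (r N)" "z (r 0)"]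
        by (intro mult_left_mono) auto
      ultimately show ?thesis
        using norm_triangle_ineq4[of "G N * z (r N) - (\<Sum>j\<le>N. c j * z (r j))" "\<alpha> * (z (r N) - z (r 0))"]
          norm_triangle_ineq4[of "G N * z (r N)" "\<Sum>j\<le>N. c j * z (r j)"]
        by (simp add: norm_mult u E_def)
    qed
    have "\<beta> * real n \<le> 2 * E + (26 * A + 4 * B)" for n
    proof -
      have "\<exists>z\<in>?K. \<exists>N>n. (\<forall>j\<le>Suc n. norm (z (r j) - apex (T n) (r j)) \<le> (1/4)^n) \<and>
        \<beta> * real n - (26 * A + 4 * B) * (1/2)^n \<le> rp (\<Sum>j\<in>{n<..<N}. D j * (z (r (Suc j)) - z (r j)))"
      proof (rule certified_play[where S = S, OF r _ _ _ KL DA less_imp_le[OF \<beta>] D0 D\<beta> T])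
        show "T n \<in> S n" using f(1)[of n] by (simp add: P_def S_def)
        fix m U assume U: "U \<in> S m"
        show "branch (r (Suc m)) U \<in> S (Suc m)" "U \<in> S (Suc m)"
          using f(2)[of m] U by (auto simp: Q_def S_def r_def)
        show "norm (apex U j - lim (apex U)) \<le> (1/2)^m" if "r (Suc m) \<le> j" for j
          using f(2)[of m] U that by (auto simp: Q_def S_def r_def)
      qed
      then obtain z N where z: "z \<in> ?K" "N > n"
        "\<beta> * real n - (26 * A + 4 * B) * (1/2)^n \<le> rp (\<Sum>j\<in>{n<..<N}. D j * (z (r (Suc j)) - z (r j)))"
        by blast
      have "(\<Sum>j<N. D j * (z (r (Suc j)) - z (r j))) =
        (\<Sum>j<Suc n. D j * (z (r (Suc j)) - z (r j))) + (\<Sum>j\<in>{n<..<N}. D j * (z (r (Suc j)) - z (r j)))"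
      proof -
        have "{..<N} = {..<Suc n} \<union> {n<..<N}" "{..<Suc n} \<inter> {n<..<N} = {}" using z(2) by auto
        then show ?thesis by (simp add: sum.union_disjoint del: sum.lessThan_Suc)
      qed
      then have "norm (\<Sum>j\<in>{n<..<N}. D j * (z (r (Suc j)) - z (r j))) \<le> 2 * E"
        using total[OF z(1), of N] total[OF z(1), of "Suc n"]
          norm_triangle_ineq4[of "\<Sum>j<N. D j * (z (r (Suc j)) - z (r j))" "\<Sum>j<Suc n. D j * (z (r (Suc j)) - z (r j))"]
        by (simp del: sum.lessThan_Suc)
      moreover have "(26 * A + 4 * B) * (1/2)^n \<le> (26 * A + 4 * B) * 1"
        using order.trans[OF norm_ge_zero DA[of 0]] order.trans[OF norm_ge_zero B[of 0]]
        by (intro mult_left_mono) (auto simp: power_le_one)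
      moreover have "\<beta> * real n \<le> rp (\<Sum>j\<in>{n<..<N}. D j * (z (r (Suc j)) - z (r j))) +
          (26 * A + 4 * B) * (1/2)^n" using z(3) by (simp only: diff_le_eq)
      ultimately show ?thesis
        using rp_le[of "\<Sum>j\<in>{n<..<N}. D j * (z (r (Suc j)) - z (r j))"]
        by (simp only: mult_1_right)
    qed
    moreover obtain n where "(2 * E + (26 * A + 4 * B)) / \<beta> < real n" using reals_Archimedean2 by blast
    ultimately show False using \<beta> by (metis mult.commute not_le pos_divide_less_eq)
  qed
  then have "strongly_summing sc (b \<circ> r)"
    unfolding strongly_summing_def using weak_Cauchy_subseq[OF wC r] wide_s_basic[OF s'] by blast
  then show ?thesis using r by blast
qed

end

section \<open>Bounded oscillation: convex blocks equivalent to the summing basis\<close>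

lemma agree_if_dist_less:
  fixes t :: "nat \<Rightarrow> 'k::real_normed_vector"
  obtains \<delta> where "\<delta> > 0" "\<And>y. dist y t < \<delta> \<Longrightarrow> agree n t y"
proof -
  have "((\<lambda>y. y j) \<longlongrightarrow> t j) (nhds t)" for j
    by (rule tendsto_coordinate) (rule filterlim_ident)
  then have "\<forall>\<^sub>F y in nhds t. dist (y j) (t j) < (1/4)^n" for j
    by (rule tendstoD) simp
  then have "\<forall>\<^sub>F y in nhds t. \<forall>j\<in>{..n}. dist (y j) (t j) < (1/4)^n"
    by (intro eventually_ball_finite) auto
  then obtain \<delta> where "\<delta> > 0" "\<And>y. dist y t < \<delta> \<Longrightarrow> \<forall>j\<in>{..n}. dist (y j) (t j) < (1/4)^n"
    unfolding eventually_nhds_metric by blast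
  then show ?thesis
    by (intro that[of \<delta>]) (auto simp: agree_def dist_norm intro: less_imp_le)
qed

text \<open>Upper semicontinuity on \<open>K\<close> in terms of \<open>agree\<close>, so that its
  failure at a point directly supplies one move for each \<open>n\<close>, that is, the branches of
  a node.\<close>

definition agree_usc :: "(nat \<Rightarrow> 'k::real_normed_vector) set \<Rightarrow> ((nat \<Rightarrow> 'k) \<Rightarrow> real) \<Rightarrow> bool" where
  "agree_usc K h \<longleftrightarrow> (\<forall>t\<in>K. \<forall>c>h t. \<exists>n. \<forall>y\<in>K. agree n t y \<longrightarrow> h y < c)"

text \<open>Baire's approximation: \<open>g n\<close> is the least majorant of \<open>h\<close> on
  \<open>K\<close> with Lipschitz constant \<open>n\<close>.\<close>

lemma agree_usc_decreasing_limit: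
  assumes h: "agree_usc K h" and H: "\<And>t. t \<in> K \<Longrightarrow> \<bar>h t\<bar> \<le> H"
  obtains g where "\<And>n::nat. continuous_on K (g n)" "\<And>n t. t \<in> K \<Longrightarrow> g (Suc n) t \<le> g n t"
    "\<And>n t. t \<in> K \<Longrightarrow> \<bar>g n t\<bar> \<le> H" "\<And>t. t \<in> K \<Longrightarrow> (\<lambda>n. g n t) \<longlonglongrightarrow> h t"
proof -
  define g where "g n t = (SUP s\<in>K. h s - real n * dist s t)" for n t
  have ub: "h s - real n * dist s t \<le> H" if "s \<in> K" for s n t
  proof -
    have "0 \<le> real n * dist s t" by simp
    then show ?thesis using H[OF that] by linarith
  qed
  have upper: "h s - real n * dist s t \<le> g n t" if "s \<in> K" for s n t
    unfolding g_def by (rule cSUP_upper[OF that]) (use ub in \<open>auto intro!: bdd_aboveI2\<close>)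
  have least: "g n t \<le> c" if "t \<in> K" "\<And>s. s \<in> K \<Longrightarrow> h s - real n * dist s t \<le> c" for n t c
    unfolding g_def by (rule cSUP_least) (use that in auto)
  have hg: "h t \<le> g n t" if "t \<in> K" for n t using upper[OF that, of n t] by simp
  have lip: "g n t \<le> g n t' + real n * dist t t'" if "t \<in> K" for n t t'
  proof (rule least[OF that])
    fix s assume s: "s \<in> K"
    have "real n * dist s t' \<le> real n * (dist s t + dist t t')"
      by (intro mult_left_mono dist_triangle) auto
    then show "h s - real n * dist s t \<le> g n t' + real n * dist t t'"
      using upper[OF s, of n t'] by (simp add: algebra_simps)
  qed
  show ?thesis
  proof (rule that[of g])
    show "continuous_on K (g n)" for n
    proof (rule lipschitz_on_continuous_on)
      show "(real n)-lipschitz_on K (g n)"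
      proof (rule lipschitz_onI)
        fix t t' assume "t \<in> K" "t' \<in> K"
        then show "dist (g n t) (g n t') \<le> real n * dist t t'"
          using lip[of t n t'] lip[of t' n t] by (simp add: dist_real_def abs_le_iff dist_commute)
      qed simp
    qed
    show "g (Suc n) t \<le> g n t" if "t \<in> K" for n t
    proof (rule least[OF that])
      fix s assume s: "s \<in> K"
      have "real n * dist s t \<le> real (Suc n) * dist s t" by (intro mult_right_mono) auto
      then show "h s - real (Suc n) * dist s t \<le> g n t" using upper[OF s, of n t] by linarith
    qed
    show "\<bar>g n t\<bar> \<le> H" if "t \<in> K" for n t
      using hg[OF that, of n] H[OF that] least[OF that, of n H] ub by (simp add: abs_le_iff)
    show "(\<lambda>n. g n t) \<longlonglongrightarrow> h t" if t: "t \<in> K" for t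
    proof (rule LIMSEQ_I)
      fix e :: real assume e: "e > 0"
      then obtain n0 where n0: "\<And>y. y \<in> K \<Longrightarrow> agree n0 t y \<Longrightarrow> h y < h t + e / 2"
        using h[unfolded agree_usc_def, rule_format, OF t, of "h t + e / 2"] by auto
      obtain \<delta> where \<delta>: "\<delta> > 0" "\<And>y. dist y t < \<delta> \<Longrightarrow> agree n0 t y"
        using agree_if_dist_less[of t n0] by blast
      \<comment> \<open>For such slopes a point outside the \<open>\<delta>\<close>-ball pays a
        penalty of at least \<open>2 * H\<close> and cannot exceed \<open>h t\<close>.\<close>
      obtain N where N: "2 * H / \<delta> < real N" using reals_Archimedean2 by blast
      have "norm (g n t - h t) < e" if n: "n \<ge> N" for n
      proof -
        have "g n t \<le> h t + e / 2"
        proof (rule least[OF t])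
          fix s assume s: "s \<in> K"
          show "h s - real n * dist s t \<le> h t + e / 2"
          proof (cases "dist s t < \<delta>")
            case True
            have "0 \<le> real n * dist s t" by simp
            then show ?thesis using n0[OF s \<delta>(2)[OF True]] by linarith
          next
            case False
            have "2 * H \<le> real N * \<delta>" using N \<delta>(1) by (simp add: pos_divide_less_eq)
            also have "\<dots> \<le> real n * dist s t" using n False \<delta>(1) by (intro mult_mono) auto
            finally show ?thesis using H[OF s] H[OF t] e by (simp add: abs_le_iff)
          qed
        qed
        then show ?thesis using hg[OF t, of n] e by simp
      qed
      then show "\<exists>N. \<forall>n\<ge>N. norm (g n t - h t) < e" by blast
    qed
  qed
qed

lemma sum_blocks:
  fixes n :: "nat \<Rightarrow> nat"
  assumes "strict_mono n" "n 0 = 0"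
  shows "(\<Sum>k<m. \<Sum>i\<in>{n k..<n (Suc k)}. h i) = (\<Sum>i<n m. h i)"
proof (induction m)
  case (Suc m)
  have "n m \<le> n (Suc m)" using assms(1) by (simp add: strict_mono_less_eq)
  then show ?case
    using Suc sum.atLeastLessThan_concat[of 0 "n m" "n (Suc m)" h] by (simp add: lessThan_atLeast0)
qed (simp add: assms)

lemma block_index:
  fixes n :: "nat \<Rightarrow> nat"
  assumes "strict_mono n" "i \<in> {n k..<n (Suc k)}"
  shows "(LEAST k. i < n (Suc k)) = k"
proof (rule Least_equality)
  fix l assume l: "i < n (Suc l)"
  show "k \<le> l"
  proof (rule ccontr)
    assume "\<not> k \<le> l"
    then have "n (Suc l) \<le> n k" using assms(1) by (simp add: strict_mono_less_eq)
    then show False using l assms(2) by simp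
  qed
qed (use assms in simp)

context banach_real_part
begin

text \<open>The oscillation is the least nonnegative \<open>h\<close> such that \<open>h\<close> and \<open>h + rp \<circ> lim\<close> are upper
  semicontinuous.\<close>

definition oscillation :: "(nat \<Rightarrow> 'k) set \<Rightarrow> (nat \<Rightarrow> 'k) \<Rightarrow> real" where
  "oscillation K t = Sup {a. \<exists>T. certifies K T a \<and> apex T = t}"

lemma
  assumes bounded: "\<And>T. \<not> certifies K T \<Lambda>" and t: "t \<in> K"
  shows oscillation_nonneg: "0 \<le> oscillation K t"
    and oscillation_le: "oscillation K t \<le> \<Lambda>"
    and certifies_le_oscillation: "certifies K T a \<Longrightarrow> apex T = t \<Longrightarrow> a \<le> oscillation K t"
    and less_oscillation_certifies: "a < oscillation K t \<Longrightarrow> \<exists>T. certifies K T a \<and> apex T = t"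
proof -
  let ?A = "{a. \<exists>T. certifies K T a \<and> apex T = t}"
  have zero: "0 \<in> ?A" using certifies.Leaf[OF t, of 0] by (auto intro!: exI[of _ "Leaf t"])
  have up: "a \<le> \<Lambda>" if "a \<in> ?A" for a
  proof (rule ccontr)
    assume "\<not> a \<le> \<Lambda>"
    moreover obtain T where "certifies K T a" using \<open>a \<in> ?A\<close> by blast
    ultimately show False using bounded[of T] certifies_antimono[of K T a \<Lambda>] by simp
  qed
  then have bdd: "bdd_above ?A" by (rule bdd_aboveI)
  show "0 \<le> oscillation K t" unfolding oscillation_def by (rule cSup_upper[OF zero bdd])
  show "oscillation K t \<le> \<Lambda>" unfolding oscillation_def using zero up by (intro cSup_least) auto
  show "a \<le> oscillation K t" if "certifies K T a" "apex T = t"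
    unfolding oscillation_def using that by (intro cSup_upper[OF _ bdd]) blast
  assume "a < oscillation K t"
  then obtain a' where "a < a'" "a' \<in> ?A"
    unfolding oscillation_def using less_cSup_iff[OF _ bdd] zero by blast
  then show "\<exists>T. certifies K T a \<and> apex T = t" using certifies_antimono less_imp_le by blast
qed

text \<open>If semicontinuity failed at \<open>t\<close>, trees nearly attaining the oscillation at
  nearby points could be hung below a new node at \<open>t\<close>, counted or not according to
  \<open>up\<close>, and would certify more than the oscillation at \<open>t\<close>.\<close>

lemma oscillation_usc:
  assumes bounded: "\<And>T. \<not> certifies K T \<Lambda>"
  shows "agree_usc K (\<lambda>t. oscillation K t + (if up then rp (lim t) else 0))"
  unfolding agree_usc_def
proof (intro ballI allI impI)
  fix t c assume t: "t \<in> K" and c: "oscillation K t + (if up then rp (lim t) else 0) < c"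
  define f where "f t = (if up then rp (lim t) else 0)" for t :: "nat \<Rightarrow> 'k"
  \<comment> \<open>The slack below \<open>c\<close> is needed since the oscillation is a supremum
    that need not be attained by a tree.\<close>
  obtain c' where c': "oscillation K t + f t < c'" "c' < c" using dense c by (auto simp: f_def)
  show "\<exists>n. \<forall>y\<in>K. agree n t y \<longrightarrow> oscillation K y + (if up then rp (lim y) else 0) < c"
  proof (rule ccontr)
    assume "\<not> ?thesis"
    then have "\<forall>n. \<exists>y. y \<in> K \<and> agree n t y \<and> c \<le> oscillation K y + f y"
      unfolding f_def by (meson not_le)
    then obtain y where y: "\<And>n. y n \<in> K" "\<And>n. agree n t (y n)" "\<And>n. c \<le> oscillation K (y n) + f (y n)"
      by metis
    have "\<exists>T. certifies K T (c' - f (y n)) \<and> apex T = y n" for n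
      using y(3)[of n] c'(2) by (intro less_oscillation_certifies[OF bounded y(1)]) linarith
    then obtain br where br: "\<And>n. certifies K (br n) (c' - f (y n))" "\<And>n. apex (br n) = y n" by metis
    have "certifies K (Node up t br) (c' - f t)"
    proof (rule certifies.Node[OF t])
      fix n
      show "agree n t (apex (br n))" using y(2) br(2) by simp
      show "certifies K (br n) (if up then c' - f t - (rp (lim (apex (br n))) - rp (lim t)) else c' - f t)"
        using br[of n] by (cases up) (simp_all add: f_def)
    qed
    then have "c' - f t \<le> oscillation K t" by (rule certifies_le_oscillation[OF bounded t]) simp
    then show False using c'(1) by simp
  qed
qed

lemma values_of_compact:
  assumes "bounded (range b)"
  shows "compact (values_of b)"
proof -
  obtain B where B: "\<And>i. norm (b i) \<le> B" using assms by (auto simp: bounded_iff)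
  have "values_of b = (\<Inter>N. \<Inter>c. {a. norm (\<Sum>i<N. c i * a i) \<le> norm (lincomb b c N)})"
    by (auto simp: values_of_def)
  also have "closed \<dots>"
    by (intro closed_INT ballI closed_Collect_le continuous_intros) simp_all
  finally have "compact ({q. \<forall>i. norm (q i) \<le> B} \<inter> values_of b)"
    by (intro compact_Int_closed compact_bounded_sequences)
  moreover have "values_of b \<subseteq> {q. \<forall>i. norm (q i) \<le> B}"
    using values_of_le B order.trans by blast
  ultimately show ?thesis by (simp add: Int_absorb1)
qed

text \<open>Averages over successive blocks of a decreasing sequence decrease, so
  the real parts of the blocks \<open>u\<^sub>k\<close>, being uniformly close to a difference of two such averages,
  have uniformly bounded variation.\<close>

lemma blocks_of_bounded_variation:
  assumes wC: "weak_Cauchy sc b" and bounded: "\<And>T. \<not> certifies (values_of b) T \<Lambda>"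
  obtains n :: "nat \<Rightarrow> nat" and w :: "nat \<Rightarrow> real" and M where "strict_mono n" "n 0 = 0" "\<And>i. 0 \<le> w i"
    "\<And>k. (\<Sum>i\<in>{n k..<n (Suc k)}. w i) = 1"
    "\<And>t N. t \<in> values_of b \<Longrightarrow>
      (\<Sum>k<N. \<bar>rp (\<Sum>i\<in>{n (Suc k)..<n (Suc (Suc k))}. of_real (w i) * t i)
        - rp (\<Sum>i\<in>{n k..<n (Suc k)}. of_real (w i) * t i)\<bar>) \<le> M"
proof -
  interpret rp: bounded_linear rp by (rule rp)
  let ?K = "values_of b"
  have bb: "bounded (range b)" by (rule weak_Cauchy_bounded[OF wC])
  then obtain B where B: "\<And>i. norm (b i) \<le> B" by (auto simp: bounded_iff)
  have K: "compact ?K" by (rule values_of_compact[OF bb])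
  have Kne: "?K \<noteq> {}" using dual_ball_nonempty by (simp add: values_of_eq)
  have tB: "norm (t i) \<le> B" if "t \<in> ?K" for t i using values_of_le[OF that] B order.trans by blast
  have lB: "norm (lim t) \<le> B" if "t \<in> ?K" for t
    by (rule LIMSEQ_le_const2[OF tendsto_norm[OF values_of_convergent[OF wC that]]]) (use tB[OF that] in auto)
  define h where "h up t = oscillation ?K t + (if up then rp (lim t) else 0)" for up and t :: "nat \<Rightarrow> 'k"
  define H where "H = \<Lambda> + B"
  have hH: "\<bar>h up t\<bar> \<le> H" if "t \<in> ?K" for up t
    using oscillation_nonneg[OF bounded that] oscillation_le[OF bounded that] rp_le[of "lim t"] lB[OF that]
    by (auto simp: h_def H_def)
  have "\<exists>g. (\<forall>n. continuous_on ?K (g n)) \<and> (\<forall>n. \<forall>t\<in>?K. g (Suc n) t \<le> g n t) \<and>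
      (\<forall>n. \<forall>t\<in>?K. \<bar>g n t\<bar> \<le> H) \<and> (\<forall>t\<in>?K. (\<lambda>n. g n t) \<longlonglongrightarrow> h up t)" for up
  proof -
    have "agree_usc ?K (h up)" unfolding h_def by (rule oscillation_usc[OF bounded])
    from agree_usc_decreasing_limit[OF this hH] show ?thesis by metis
  qed
  then obtain g where g: "\<And>up n. continuous_on ?K (g up n)" "\<And>up n t. t \<in> ?K \<Longrightarrow> g up (Suc n) t \<le> g up n t"
    "\<And>up n t. t \<in> ?K \<Longrightarrow> \<bar>g up n t\<bar> \<le> H" "\<And>up t. t \<in> ?K \<Longrightarrow> (\<lambda>n. g up n t) \<longlonglongrightarrow> h up t"
    by metis
  \<comment> \<open>The two limit functions differ by \<open>rp (lim t)\<close>, so these errors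
    tend to 0 pointwise and Simons' argument makes their convex blocks uniformly small.\<close>
  define e where "e n t = \<bar>rp (t n) - (g True n t - g False n t)\<bar>" for n and t :: "nat \<Rightarrow> 'k"
  have econt: "continuous_on ?K (e n)" for n
    unfolding e_def
    by (intro continuous_intros g rp.continuous_on continuous_on_subset[OF continuous_on_product_coordinates]) auto
  have eb: "0 \<le> e n t \<and> e n t \<le> B + 2 * H" if "t \<in> ?K" for n t
    using rp_le[of "t n"] tB[OF that, of n] g(3)[OF that, of True n] g(3)[OF that, of False n]
    by (auto simp: e_def)
  have elim: "(\<lambda>n. e n t) \<longlonglongrightarrow> 0" if t: "t \<in> ?K" for t
  proof -
    have "(\<lambda>n. e n t) \<longlonglongrightarrow> \<bar>rp (lim t) - (h True t - h False t)\<bar>"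
      unfolding e_def by (intro tendsto_intros rp.tendsto g(4) values_of_convergent[OF wC] t)
    then show ?thesis by (simp add: h_def)
  qed
  define Q where "Q m k N c \<longleftrightarrow> m < N \<and> (\<forall>i. 0 \<le> c i) \<and> (\<Sum>i\<in>{m..<N}. c i) = 1 \<and>
      (\<forall>t\<in>?K. (\<Sum>i\<in>{m..<N}. c i * e i t) \<le> (1/2)^k)" for m k N :: nat and c :: "nat \<Rightarrow> real"
  have "\<exists>N c. Q m k N c" for m k :: nat
  proof -
    have "(0::real) < (1/2)^k" by simp
    show ?thesis
    proof (rule small_convex_combination[OF K Kne econt eb elim \<open>(0::real) < (1/2)^k\<close>, of m])
      fix N c assume "m < N" "\<And>i. 0 \<le> c i" "(\<Sum>i\<in>{m..<N}. c i) = 1"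
        "\<And>t. t \<in> ?K \<Longrightarrow> (\<Sum>i\<in>{m..<N}. c i * e i t) \<le> (1/2)^k"
      then have "Q m k N c" by (simp add: Q_def)
      then show ?thesis by blast
    qed
  qed
  then obtain Nf cf where "\<And>m k. Q m k (Nf m k) (cf m k)" by metis
  then have Nc: "m < Nf m k" "0 \<le> cf m k i" "(\<Sum>i\<in>{m..<Nf m k}. cf m k i) = 1"
    "t \<in> ?K \<Longrightarrow> (\<Sum>i\<in>{m..<Nf m k}. cf m k i * e i t) \<le> (1/2)^k" for m k i t
    by (simp_all add: Q_def)
  define n where "n = rec_nat 0 (\<lambda>k m. Nf m k)"
  have n0: "n 0 = 0" and nS: "\<And>k. n (Suc k) = Nf (n k) k" by (simp_all add: n_def)
  have n: "strict_mono n" using Nc(1) by (simp add: strict_mono_Suc_iff nS)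
  define w where "w i = (let k = LEAST k. i < n (Suc k) in cf (n k) k i)" for i
  have w: "w i = cf (n k) k i" if "i \<in> {n k..<n (Suc k)}" for i k
    unfolding w_def Let_def block_index[OF n that] ..
  have w0: "0 \<le> w i" for i unfolding w_def Let_def by (rule Nc(2))
  have w1: "(\<Sum>i\<in>{n k..<n (Suc k)}. w i) = 1" for k
  proof -
    have "(\<Sum>i\<in>{n k..<n (Suc k)}. w i) = (\<Sum>i\<in>{n k..<n (Suc k)}. cf (n k) k i)"
      by (intro sum.cong refl) (simp only: w)
    then show ?thesis using Nc(3)[of "n k" k] by (simp add: nS)
  qed
  have we: "(\<Sum>i\<in>{n k..<n (Suc k)}. w i * e i t) \<le> (1/2)^k" if "t \<in> ?K" for k t
  proof -
    have "(\<Sum>i\<in>{n k..<n (Suc k)}. w i * e i t) = (\<Sum>i\<in>{n k..<n (Suc k)}. cf (n k) k i * e i t)"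
      by (intro sum.cong refl) (simp only: w)
    then show ?thesis using Nc(4)[OF that, of "n k" k] by (simp add: nS)
  qed
  show ?thesis
  proof (rule that[OF n n0 w0 w1])
    fix t N assume t: "t \<in> ?K"
    define U where "U k = rp (\<Sum>i\<in>{n k..<n (Suc k)}. of_real (w i) * t i)" for k
    define A where "A up k = (\<Sum>i\<in>{n k..<n (Suc k)}. w i * g up i t)" for up k
    have dec: "g up j t \<le> g up i t" if "i \<le> j" for up i j
      using that by (induction rule: dec_induct) (use g(2)[OF t] order.trans in blast)+
    have A_le: "A up k \<le> c" if "\<And>i. i \<ge> n k \<Longrightarrow> g up i t \<le> c" for up k c
    proof -
      have "A up k \<le> (\<Sum>i\<in>{n k..<n (Suc k)}. w i * c)"
        unfolding A_def using that w0 by (intro sum_mono mult_left_mono) auto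
      then show ?thesis using w1[of k] by (simp add: sum_distrib_right[symmetric])
    qed
    have A_ge: "c \<le> A up k" if "\<And>i. i < n (Suc k) \<Longrightarrow> c \<le> g up i t" for up k c
    proof -
      have "(\<Sum>i\<in>{n k..<n (Suc k)}. w i * c) \<le> A up k"
        unfolding A_def using that w0 by (intro sum_mono mult_left_mono) auto
      then show ?thesis using w1[of k] by (simp add: sum_distrib_right[symmetric])
    qed
    \<comment> \<open>The value at index \<open>n (Suc k)\<close> separates the two blocks: all
      earlier values lie above it and all later ones below.\<close>
    have A_dec: "A up (Suc k) \<le> A up k" for up k
      by (rule order.trans[of _ "g up (n (Suc k)) t"]) (auto intro!: A_le A_ge dec)
    have AH: "\<bar>A up k\<bar> \<le> H" for up k
      using A_le[of k up H] A_ge[of k "-H" up] g(3)[OF t] by (auto simp: abs_le_iff) (smt (verit) abs_le_iff)+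
    have UA: "\<bar>U k - (A True k - A False k)\<bar> \<le> (1/2)^k" for k
    proof -
      have "rp (of_real (w i) * t i) = w i * rp (t i)" for i
        using rp.scaleR[of "w i" "t i"] by (simp add: scaleR_conv_of_real)
      then have "U k = (\<Sum>i\<in>{n k..<n (Suc k)}. w i * rp (t i))" by (simp add: U_def rp.sum)
      then have "U k - (A True k - A False k) =
          (\<Sum>i\<in>{n k..<n (Suc k)}. w i * (rp (t i) - (g True i t - g False i t)))"
        by (simp add: A_def sum_subtractf[symmetric] algebra_simps)
      also have "\<bar>\<dots>\<bar> \<le> (\<Sum>i\<in>{n k..<n (Suc k)}. w i * e i t)"
        using w0 by (intro order.trans[OF sum_abs] sum_mono) (simp add: abs_mult e_def)
      finally show ?thesis using we[OF t, of k] by linarith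
    qed
    have "\<bar>U (Suc k) - U k\<bar> \<le> (A True k - A True (Suc k)) + (A False k - A False (Suc k)) + 2 * (1/2)^k" for k
    proof -
      have "(1/2::real)^Suc k \<le> (1/2)^k" by (intro power_decreasing) auto
      then show ?thesis using UA[of k] UA[of "Suc k"] A_dec[of True k] A_dec[of False k] by linarith
    qed
    then have "(\<Sum>k<N. \<bar>U (Suc k) - U k\<bar>) \<le>
        (\<Sum>k<N. (A True k - A True (Suc k)) + (A False k - A False (Suc k)) + 2 * (1/2)^k)"
      by (intro sum_mono)
    also have "\<dots> = (A True 0 - A True N) + (A False 0 - A False N) + 2 * (\<Sum>k<N. (1/2)^k)"
      by (simp add: sum.distrib sum_lessThan_telescope' sum_distrib_left)
    \<comment> \<open>Each of the two telescoped averages falls by at most \<open>2 * H\<close>, and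
      the approximation errors add up to at most 4.\<close>
    also have "\<dots> \<le> 4 * H + 4"
    proof -
      have "(\<Sum>k<N. (1/2::real)^k) = 2 - 2 * (1/2)^N" by (induction N) auto
      moreover have "(0::real) \<le> (1/2)^N" by simp
      ultimately have "(\<Sum>k<N. (1/2::real)^k) \<le> 2" by linarith
      then show ?thesis using AH[of True 0] AH[of True N] AH[of False 0] AH[of False N] by linarith
    qed
    finally show "(\<Sum>k<N. \<bar>rp (\<Sum>i\<in>{n (Suc k)..<n (Suc (Suc k))}. of_real (w i) * t i)
        - rp (\<Sum>i\<in>{n k..<n (Suc k)}. of_real (w i) * t i)\<bar>) \<le> 4 * H + 4"
      by (simp only: U_def)
  qed
qed

lemma convex_block_basis_subseq:
  assumes u: "convex_block_basis sc (x \<circ> r) u" and r: "strict_mono r"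
  shows "convex_block_basis sc x u"
proof -
  from u obtain n and c :: "nat \<Rightarrow> real" where n: "strict_mono n"
    "\<forall>j. u j \<noteq> 0 \<and> u j = (\<Sum>i\<in>{n j..<n (Suc j)}. sc (of_real (c i)) (x (r i)))"
    "\<forall>i. c i \<ge> 0" "\<forall>j. (\<Sum>i\<in>{n j..<n (Suc j)}. c i) = 1"
    unfolding convex_block_basis_def block_basis_with_def o_apply by blast
  have inj: "inj r" using r by (rule strict_mono_imp_inj_on)
  define c' where "c' k = (if k \<in> range r then c (inv r k) else 0)" for k
  have eq: "(\<Sum>k\<in>{r m..<r m'}. h (c' k) k) = (\<Sum>i\<in>{m..<m'}. h (c i) (r i))"
    if "\<And>k. h 0 k = 0" for h :: "real \<Rightarrow> nat \<Rightarrow> 'd::comm_monoid_add" and m m'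
  proof -
    have "(\<Sum>k\<in>{r m..<r m'}. h (c' k) k) = (\<Sum>k\<in>r ` {m..<m'}. h (c' k) k)"
    proof (rule sum.mono_neutral_right)
      show "r ` {m..<m'} \<subseteq> {r m..<r m'}" using r by (auto simp: strict_mono_less strict_mono_less_eq)
      show "\<forall>k\<in>{r m..<r m'} - r ` {m..<m'}. h (c' k) k = 0"
        using r that by (auto simp: c'_def strict_mono_less strict_mono_less_eq)
    qed simp
    also have "\<dots> = (\<Sum>i\<in>{m..<m'}. h (c i) (r i))"
      using inj by (subst sum.reindex) (auto simp: c'_def inj_on_def)
    finally show ?thesis .
  qed
  have "u j = (\<Sum>k\<in>{r (n j)..<r (n (Suc j))}. sc (of_real (c' k)) (x k))" for j
    using eq[of "\<lambda>a k. sc (of_real a) (x k)"] n(2) by simp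
  moreover have "(\<Sum>k\<in>{r (n j)..<r (n (Suc j))}. c' k) = 1" for j
    using eq[of "\<lambda>a k. a"] n(4) by simp
  moreover have "c' k \<ge> 0" for k using n(3) by (simp add: c'_def)
  moreover have "strict_mono (r \<circ> n)" using r n(1) by (rule strict_mono_o)
  ultimately show ?thesis
    unfolding convex_block_basis_def block_basis_with_def
  proof (intro exI[of _ "r \<circ> n"] exI[of _ c'] conjI allI)
    show "u j \<noteq> 0" for j using n(2) by blast
  qed (simp_all only: o_apply)
qed

text \<open>Convex weights preserve coefficient sums, so the blocks inherit the wide-(s) estimates
  with the same constant. The upper estimate is Abel summation: bounded coefficient sums against the
  bounded variation of \<open>f (u k)\<close>.\<close>

lemma summing_convex_blocks:
  assumes wC: "weak_Cauchy sc b" and s: "wide_s b C" and bounded: "\<And>T. \<not> certifies (values_of b) T \<Lambda>"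
  shows "\<exists>u. convex_block_basis sc b u \<and>
    equivalent_sequences sc u scale_summing_space (summing_basis :: nat \<Rightarrow> 'k summing_space)"
proof -
  from blocks_of_bounded_variation[OF wC bounded] obtain n :: "nat \<Rightarrow> nat" and w :: "nat \<Rightarrow> real" and M where
    n: "strict_mono n" "n 0 = 0" and w: "\<And>i. 0 \<le> w i" "\<And>k. (\<Sum>i\<in>{n k..<n (Suc k)}. w i) = 1" and
    M: "\<And>t N. t \<in> values_of b \<Longrightarrow>
      (\<Sum>k<N. \<bar>rp (\<Sum>i\<in>{n (Suc k)..<n (Suc (Suc k))}. of_real (w i) * t i)
        - rp (\<Sum>i\<in>{n k..<n (Suc k)}. of_real (w i) * t i)\<bar>) \<le> M" by blast
  interpret rp: bounded_linear rp by (rule rp)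
  define u where "u k = (\<Sum>i\<in>{n k..<n (Suc k)}. sc (of_real (w i)) (b i))" for k
  define c' where "c' c i = c (LEAST k. i < n (Suc k)) * of_real (w i)" for c :: "nat \<Rightarrow> 'k" and i
  have c': "c' c i = c k * of_real (w i)" if "i \<in> {n k..<n (Suc k)}" for c i k
    unfolding c'_def block_index[OF n(1) that] ..
  have e1: "lincomb u c m = lincomb b (c' c) (n m)" for c m
  proof -
    have "sc (c k) (u k) = (\<Sum>i\<in>{n k..<n (Suc k)}. sc (c' c i) (b i))" for k
      unfolding u_def scale_sum_right by (intro sum.cong refl) (simp only: c' scale_scale)
    then show ?thesis by (simp add: sum_blocks[OF n])
  qed
  have e2: "(\<Sum>i<m. c i) = (\<Sum>i<n m. c' c i)" for c m
  proof -
    have "c k = (\<Sum>i\<in>{n k..<n (Suc k)}. c' c i)" for k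
    proof -
      have "(\<Sum>i\<in>{n k..<n (Suc k)}. c' c i) = c k * of_real (\<Sum>i\<in>{n k..<n (Suc k)}. w i)"
        unfolding of_real_sum sum_distrib_left by (intro sum.cong refl) (simp only: c')
      then show ?thesis by (simp add: w(2))
    qed
    then have "(\<Sum>i<m. c i) = (\<Sum>k<m. \<Sum>i\<in>{n k..<n (Suc k)}. c' c i)" by (intro sum.cong) auto
    then show ?thesis by (simp only: sum_blocks[OF n])
  qed
  have u: "wide_s u C"
    unfolding wide_s_def
  proof (intro conjI allI impI)
    fix c and m N :: nat assume "m \<le> N"
    then have "n m \<le> n N" using n(1) by (simp add: strict_mono_less_eq)
    then show "norm (lincomb u c m) \<le> C * norm (lincomb u c N)"
      "norm (\<Sum>i<m. c i) \<le> C * norm (lincomb u c N)"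
      using s unfolding wide_s_def e1 e2[of c] by blast+
  qed (use s in \<open>simp add: wide_s_def\<close>)
  have "bounded (range b)" by (rule weak_Cauchy_bounded[OF wC])
  then obtain B where B: "\<And>i. norm (b i) \<le> B" by (auto simp: bounded_iff)
  have uB: "norm (u k) \<le> B" for k
  proof -
    have "norm (u k) \<le> (\<Sum>i\<in>{n k..<n (Suc k)}. w i * B)"
      unfolding u_def using w(1) B by (intro sum_norm_le) (simp add: norm_scale mult_left_mono)
    then show ?thesis by (simp add: sum_distrib_right[symmetric] w(2))
  qed
  \<comment> \<open>Only real parts were controlled. The functional times \<open>\<omega>\<close> is
    again in the dual ball, and the two real variations dominate the variation in norm.\<close>
  have var: "(\<Sum>k<N. norm (f (u (Suc k)) - f (u k))) \<le> 2 * M" if f: "f \<in> dual_ball" for f N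
  proof -
    note fd = dual_ball_dual[OF f]
    define z where "z v i = v * f (b i)" for v i
    have z: "z v \<in> values_of b" if "norm v = 1" for v
    proof -
      have "(\<lambda>x. v * f x) \<in> dual_ball"
        using f that by (auto simp: dual_ball_def dual_def norm_mult intro: bounded_linear_const_mult)
      then show ?thesis unfolding values_of_eq z_def by (rule rev_image_eqI) simp
    qed
    have fu: "(\<Sum>i\<in>{n k..<n (Suc k)}. of_real (w i) * z v i) = v * f (u k)" for v k
      by (simp add: u_def z_def dual_linear[OF fd] sum_distrib_left mult.left_commute)
    have "norm (f (u (Suc k)) - f (u k)) \<le> \<bar>rp (1 * f (u (Suc k))) - rp (1 * f (u k))\<bar>
        + \<bar>rp (\<omega> * f (u (Suc k))) - rp (\<omega> * f (u k))\<bar>" for k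
      using norm_le_rp[of "f (u (Suc k)) - f (u k)"] by (simp add: rp.diff right_diff_distrib)
    then have "(\<Sum>k<N. norm (f (u (Suc k)) - f (u k))) \<le> (\<Sum>k<N. \<bar>rp (1 * f (u (Suc k))) - rp (1 * f (u k))\<bar>
        + \<bar>rp (\<omega> * f (u (Suc k))) - rp (\<omega> * f (u k))\<bar>)"
      by (intro sum_mono)
    also have "\<dots> \<le> M + M"
      unfolding sum.distrib
      using M[OF z[of 1], of N] M[OF z[OF norm_\<omega>], of N] by (intro add_mono) (simp_all only: fu norm_one)
    finally show ?thesis by simp
  qed
  have "equivalent_sequences sc u scale_summing_space (summing_basis :: nat \<Rightarrow> 'k summing_space)"
  proof (rule equivalent_to_summing_basis[OF u])
    fix c :: "nat \<Rightarrow> 'k" and N :: nat and Q assume Q: "\<And>m. m \<le> N \<Longrightarrow> norm (\<Sum>i<m. c i) \<le> (Q::real)"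
    have Q0: "0 \<le> Q" using Q[of 0] by simp
    show "norm (lincomb u c N) \<le> (B + 2 * M) * Q"
    proof (cases N)
      case 0
      have "0 \<le> B" using uB[of 0] norm_ge_zero order.trans by blast
      moreover obtain f where "f \<in> dual_ball" using dual_ball_nonempty by blast
      then have "0 \<le> 2 * M" using var[of f 0] by simp
      ultimately show ?thesis using Q0 by (simp add: 0)
    next
      case (Suc N')
      obtain f where f: "f \<in> dual_ball" "f (lincomb u c N) = of_real (norm (lincomb u c N))"
        using norming_dual_functional by blast
      have Q': "norm (\<Sum>i\<le>j. c i) \<le> Q" if "j \<le> N'" for j
        using Q[of "Suc j"] that by (simp only: lessThan_Suc_atMost Suc Suc_le_mono)
      have "f (lincomb u c N) = (\<Sum>j\<le>N'. c j * f (u j))"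
        using dual_lincomb[OF dual_ball_dual[OF f(1)], where b = u and c = c and N = N]
        by (simp only: Suc lessThan_Suc_atMost)
      also have "\<dots> = (\<Sum>j\<le>N'. c j) * f (u N') - (\<Sum>j<N'. (\<Sum>i\<le>j. c i) * (f (u (Suc j)) - f (u j)))"
        by (rule Abel_summation)
      also have "norm \<dots> \<le> Q * B + Q * (2 * M)"
      proof (rule order.trans[OF norm_triangle_ineq4 add_mono])
        show "norm ((\<Sum>j\<le>N'. c j) * f (u N')) \<le> Q * B"
          unfolding norm_mult using Q'[of N'] Q0 order.trans[OF dual_ball_le[OF f(1)] uB]
          by (intro mult_mono) auto
        have "norm (\<Sum>j<N'. (\<Sum>i\<le>j. c i) * (f (u (Suc j)) - f (u j))) \<le>
            (\<Sum>j<N'. Q * norm (f (u (Suc j)) - f (u j)))"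
          using Q' by (intro sum_norm_le) (simp add: norm_mult mult_right_mono)
        also have "\<dots> \<le> Q * (2 * M)"
          unfolding sum_distrib_left[symmetric] by (intro mult_left_mono var f Q0)
        finally show "norm (\<Sum>j<N'. (\<Sum>i\<le>j. c i) * (f (u (Suc j)) - f (u j))) \<le> Q * (2 * M)" .
      qed
      finally show ?thesis using f(2) by (simp add: algebra_simps)
    qed
  qed
  moreover have "u k \<noteq> 0" for k
  proof
    assume 0: "u k = 0"
    have "lincomb u (\<lambda>i. if i = k then 1 else 0) (Suc k) = u k" by simp
    then show False using wide_s_coeff[OF u, of k "Suc k" "\<lambda>i. if i = k then 1 else 0"] 0 by simp
  qed
  then have "convex_block_basis sc b u"
    unfolding convex_block_basis_def block_basis_with_def
    using n(1) w by (intro exI[of _ n] exI[of _ w]) (auto simp: u_def)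
  ultimately show ?thesis by blast
qed

end

context nontrivial_weak_Cauchy_sequence
begin

lemma dichotomy:
  "(\<exists>r. strict_mono r \<and> strongly_summing sc (x \<circ> r)) \<or>
   (\<exists>u. convex_block_basis sc x u \<and>
     equivalent_sequences sc u scale_summing_space (summing_basis :: nat \<Rightarrow> 'k summing_space))"
proof -
  obtain r C where r: "strict_mono r" and s: "wide_s (x \<circ> r) C" using wide_s_subsequence by blast
  have wC: "weak_Cauchy sc (x \<circ> r)" by (rule weak_Cauchy_subseq[OF weak_Cauchy_x r])
  show ?thesis
  proof (cases "\<forall>n::nat. \<exists>T. certifies (values_of (x \<circ> r)) T (real n)")
    case True
    then obtain q where q: "strict_mono q" "strongly_summing sc ((x \<circ> r) \<circ> q)"
      using strongly_summing_subsequence[OF wC s] by blast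
    then have "strict_mono (r \<circ> q)" "strongly_summing sc (x \<circ> (r \<circ> q))"
      using r by (auto simp: strict_mono_o o_assoc)
    then show ?thesis by blast
  next
    case False
    then show ?thesis
      using summing_convex_blocks[OF wC s] convex_block_basis_subseq[OF _ r] by blast
  qed
qed

end

section \<open>The real and the complex case\<close>

lemma bounded_linear_of_real_linear:
  fixes g :: "'a::real_normed_vector \<Rightarrow> real"
  assumes "linear g" "\<And>v. \<bar>g v\<bar> \<le> norm v"
  shows "bounded_linear g"
  using assms(2)
  by (intro bounded_linear_intro[where K = 1]) (simp_all add: linear_add[OF assms(1)] linear_cmul[OF assms(1)])

lemma banach_real_part_real:
  "banach_real_part (scaleR :: real \<Rightarrow> 'a::banach \<Rightarrow> 'a) (\<lambda>z. z) 1"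
proof -
  interpret banach_over "scaleR :: real \<Rightarrow> 'a \<Rightarrow> 'a" by (rule banach_over_scaleR)
  show ?thesis
  proof
    fix g :: "'a \<Rightarrow> real" assume g: "linear g" "\<And>v. \<bar>g v\<bar> \<le> norm v"
    then have "g \<in> dual scaleR" by (simp add: dual_def bounded_linear_of_real_linear linear_cmul[OF g(1)])
    then show "\<exists>f\<in>dual scaleR. (\<forall>v. norm (f v) \<le> norm v) \<and> (\<forall>v. f v = g v)"
      using g(2) by (intro bexI[of _ g]) auto
  qed (auto intro: exI[of _ 1])
qed

text \<open>The complexification of Bohnenblust and Sobczyk: \<open>g\<close> is the real part of
  the complex-linear functional with imaginary part \<open>- g (sc \<i> v)\<close>.\<close>

lemma banach_real_part_complex:
  assumes "banach_over (sc :: complex \<Rightarrow> 'a::banach \<Rightarrow> 'a)"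
  shows "banach_real_part sc Re \<i>"
proof -
  interpret banach_over sc by (rule assms)
  show ?thesis
  proof
    fix g :: "'a \<Rightarrow> real" assume g: "linear g" "\<And>v. \<bar>g v\<bar> \<le> norm v"
    define f where "f v = Complex (g v) (- g (sc \<i> v))" for v
    have sc: "sc c v = Re c *\<^sub>R v + Im c *\<^sub>R sc \<i> v" for c v
    proof -
      have "sc c v = sc (of_real (Re c) + of_real (Im c) * \<i>) v"
        by (simp add: complex_eq mult.commute)
      then show ?thesis by (simp only: scale_left_distrib scale_scale[symmetric] scale_of_real)
    qed
    have gsc: "g (sc c v) = Re c * g v + Im c * g (sc \<i> v)" for c v
      by (subst sc) (simp add: linear_add[OF g(1)] linear_cmul[OF g(1)])
    have fsc: "f (sc c v) = c * f v" for c v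
    proof -
      have "g (sc \<i> (sc c v)) = - Im c * g v + Re c * g (sc \<i> v)"
        using gsc[of "\<i> * c" v] by simp
      then show ?thesis using gsc[of c v] by (simp add: f_def complex_eq_iff)
    qed
    have fle: "norm (f v) \<le> norm v" for v
    proof (cases "f v = 0")
      case False
      \<comment> \<open>Rotating \<open>v\<close> makes \<open>f v\<close> real and nonnegative, so
        that its modulus is a value of \<open>g\<close> and the bound is not worsened.\<close>
      define a where "a = cnj (f v) / of_real (norm (f v))"
      have a: "norm a = 1"
        using False unfolding a_def norm_divide complex_mod_cnj norm_of_real by simp
      have "cnj (f v) * f v = of_real ((norm (f v))\<^sup>2)"
        by (simp only: complex_norm_square mult.commute)
      then have "a * f v = of_real ((norm (f v))\<^sup>2) / of_real (norm (f v))" by (simp add: a_def)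
      then have "a * f v = of_real (norm (f v))" using False by (simp add: power2_eq_square)
      then have "Re (f (sc a v)) = norm (f v)" by (simp add: fsc)
      then have "norm (f v) = g (sc a v)" by (simp add: f_def)
      also have "\<dots> \<le> norm (sc a v)" using g(2)[of "sc a v"] by simp
      finally show ?thesis by (simp add: norm_scale a)
    qed simp
    have "bounded_linear f"
    proof (rule bounded_linear_intro[where K = 1])
      show "f (u + v) = f u + f v" for u v
        by (simp add: f_def scale_right_distrib linear_add[OF g(1)] complex_eq_iff)
      show "f (r *\<^sub>R v) = r *\<^sub>R f v" for r v
        using fsc[of "of_real r" v] by (simp add: scale_of_real scaleR_conv_of_real)
    qed (use fle in simp)
    then have "f \<in> dual sc" by (simp add: dual_def fsc)
    then show "\<exists>f\<in>dual sc. (\<forall>v. norm (f v) \<le> norm v) \<and> (\<forall>v. Re (f v) = g v)"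
      using fle by (intro bexI[of _ f]) (auto simp: f_def)
  qed (auto intro!: exI[of _ 1] simp: abs_Re_le_cmod cmod_le)
qed

theorem theorem1p1:
  shows "(\<forall>x :: nat \<Rightarrow> 'a::banach.
            nontrivial_weak_Cauchy (scaleR :: real \<Rightarrow> 'a \<Rightarrow> 'a) x \<longrightarrow>
              (\<exists>r. strict_mono r \<and> strongly_summing (scaleR :: real \<Rightarrow> 'a \<Rightarrow> 'a) (x \<circ> r)) \<or>
              (\<exists>u. convex_block_basis (scaleR :: real \<Rightarrow> 'a \<Rightarrow> 'a) x u \<and>
                   equivalent_sequences (scaleR :: real \<Rightarrow> 'a \<Rightarrow> 'a) u
                     scale_summing_space summing_basis)) \<and>
         (\<forall>(scaleC :: complex \<Rightarrow> 'b::banach \<Rightarrow> 'b) (x :: nat \<Rightarrow> 'b).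
            banach_over scaleC \<longrightarrow> nontrivial_weak_Cauchy scaleC x \<longrightarrow>
              (\<exists>r. strict_mono r \<and> strongly_summing scaleC (x \<circ> r)) \<or>
              (\<exists>u. convex_block_basis scaleC x u \<and>
                   equivalent_sequences scaleC u scale_summing_space summing_basis))"
proof (intro conjI allI impI)
  fix x :: "nat \<Rightarrow> 'a" assume x: "nontrivial_weak_Cauchy scaleR x"
  interpret nontrivial_weak_Cauchy_sequence "scaleR :: real \<Rightarrow> 'a \<Rightarrow> 'a" "\<lambda>z. z" 1 x
    by (intro nontrivial_weak_Cauchy_sequence.intro banach_real_part_real
        nontrivial_weak_Cauchy_sequence_axioms.intro x)
  show "(\<exists>r. strict_mono r \<and> strongly_summing scaleR (x \<circ> r)) \<or>
      (\<exists>u. convex_block_basis scaleR x u \<and> equivalent_sequences scaleR u scale_summing_space summing_basis)"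
    by (rule dichotomy)
next
  fix scaleC :: "complex \<Rightarrow> 'b \<Rightarrow> 'b" and x :: "nat \<Rightarrow> 'b"
  assume "banach_over scaleC" and x: "nontrivial_weak_Cauchy scaleC x"
  interpret nontrivial_weak_Cauchy_sequence scaleC Re \<i> x
    by (intro nontrivial_weak_Cauchy_sequence.intro banach_real_part_complex
        nontrivial_weak_Cauchy_sequence_axioms.intro x) fact
  show "(\<exists>r. strict_mono r \<and> strongly_summing scaleC (x \<circ> r)) \<or>
      (\<exists>u. convex_block_basis scaleC x u \<and> equivalent_sequences scaleC u scale_summing_space summing_basis)"
    by (rule dichotomy)
qed

end
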